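(* Let $\Delta$ be the quiver with three vertices $v_1,v_2,v_3$ and exactly three arrows: $a$ from $v_1$ to $v_2$, a loop $x$ at $v_2$, and $b$ from $v_2$ to $v_3$. Let $N\ge3$ and let $A=\mathrm{k}\Delta/I^N$ be the $N$-truncated quiver algebra associated with $\Delta$. Then, for all integers $n\ge1$, there exist non zero cohomology classes $\omega_{n,j}\in H^n(A,A)$, $j=1,\dots,N-1$, such that for all $n_1,n_2\ge1$ and $1\le j_1,j_2\le N-1$ $$\omega_{n_1,j_1}\cup\omega_{n_2,j_2}=\begin{cases}\omega_{n_1+n_2,\,j_1+j_2},&\text{if }n_1\text{ or }n_2\text{ is even and }j_1+j_2<N;\\0,&\text{otherwise.}\end{cases}$$
   Context: $\mathrm{k}$ is a field of characteristic $0$; $\mathrm{k}\Delta$ is the path algebra, with basis all paths $a_1\dots a_n$ (sequences of arrows in which the end of $a_i$ is the source of $a_{i+1}$), including the vertices as paths of length $0$, and product given by concatenation of paths; $I$ is the two-sided ideal generated by the arrows. $A^e=A\otimes_{\mathrm k}A^{op}$ and $H^n(A,A)=\mathrm{Ext}^n_{A^e}(A,A)$ is Hochschild cohomology. The cup product $\cup$ (which coincides with the Yoneda product) on $H^*(A,A)$ is induced by $(f\cup g)(\alpha_1\otimes\dots\otimes\alpha_{m+n})=f(\alpha_1\otimes\dots\otimes\alpha_m)\,g(\alpha_{m+1}\otimes\dots\otimes\alpha_{m+n})$ for cochains $f\in\mathrm{Hom}_{\mathrm k}(A^{\otimes m},A)$, $g\in\mathrm{Hom}_{\mathrm k}(A^{\otimes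 n},A)$ of the bar complex. *)

theory Defs
  imports "HOL-Algebra.Module" "HOL-Algebra.Ideal_Product" "HOL-Algebra.QuotRing" "Graph_Theory.Arc_Walk"
begin

section \<open>Path algebras of quivers\<close>

text \<open>
  A quiver is a \<^typ>\<open>('v, 'e) pre_digraph\<close>. A path is a triple: source, list of arrows, target.
  The end points are recorded so that the paths of length 0 at different vertices are distinct.
\<close>

type_synonym ('v, 'e) qpath = "'v \<times> 'e list \<times> 'v"

definition qpaths :: "('v, 'e) pre_digraph \<Rightarrow> ('v, 'e) qpath set" where
  "qpaths Q = {(u, p, v). pre_digraph.awalk Q u p v}"

definition concats_to :: "('v, 'e) qpath \<Rightarrow> ('v, 'e) qpath \<Rightarrow> ('v, 'e) qpath \<Rightarrow> bool" where
  "concats_to p q r \<longleftrightarrow>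
     (case (p, q) of ((u, es, v), (v', fs, w)) \<Rightarrow> v = v' \<and> r = (u, es @ fs, w))"

text \<open>
  Elements are finitely supported coefficient functions on the paths. The field of scalars is
  the whole type \<^typ>\<open>'k\<close>. In the product, each path \<open>r\<close> has only finitely many factorizations;
  a unit exists when \<^term>\<open>verts Q\<close> is finite.
\<close>

definition path_algebra ::
    "('v, 'e) pre_digraph \<Rightarrow> ('k::field, ('v, 'e) qpath \<Rightarrow> 'k) module" where
  "path_algebra Q =
     \<lparr>carrier = {f. finite {p. f p \<noteq> 0} \<and> {p. f p \<noteq> 0} \<subseteq> qpaths Q},
      monoid.mult = (\<lambda>f g r. \<Sum>(p, q) \<in> {(p, q). p \<in> qpaths Q \<and> q \<in> qpaths Q \<and> concats_to p q r}.
                f p * g q),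
      one = (\<lambda>r. if r \<in> {(v, [], v) | v. v \<in> verts Q} then 1 else 0),
      ring.zero = (\<lambda>r. 0),
      add = (\<lambda>f g r. f r + g r),
      smult = (\<lambda>c f r. c * f r)\<rparr>"

definition path_vec :: "('v, 'e) qpath \<Rightarrow> ('v, 'e) qpath \<Rightarrow> 'k::field" where
  "path_vec p = (\<lambda>q. if q = p then 1 else 0)"

definition arrow_ideal :: "('v, 'e) pre_digraph \<Rightarrow> (('v, 'e) qpath \<Rightarrow> 'k::field) set" where
  "arrow_ideal Q = Idl\<^bsub>path_algebra Q\<^esub> ((\<lambda>e. path_vec (tail Q e, [e], head Q e)) ` arcs Q)"

primrec ideal_power :: "('a, 'b) ring_scheme \<Rightarrow> 'a set \<Rightarrow> nat \<Rightarrow> 'a set" where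
  "ideal_power R J 0 = carrier R"
| "ideal_power R J (Suc n) = ideal_prod R (ideal_power R J n) J"

definition quotient_algebra :: "('k, 'a) module \<Rightarrow> 'a set \<Rightarrow> ('k, 'a set) module" where
  "quotient_algebra A J =
     \<lparr>carrier = carrier (A Quot J),
      monoid.mult = monoid.mult (A Quot J),
      one = one (A Quot J),
      ring.zero = ring.zero (A Quot J),
      add = add (A Quot J),
      smult = (\<lambda>c X. \<Union>x\<in>X. J +>\<^bsub>A\<^esub> (c \<odot>\<^bsub>A\<^esub> x))\<rparr>"

definition truncated_quiver_algebra ::
    "('v, 'e) pre_digraph \<Rightarrow> nat \<Rightarrow> ('k::field, (('v, 'e) qpath \<Rightarrow> 'k) set) module" where
  "truncated_quiver_algebra Q N =
     quotient_algebra (path_algebra Q) (ideal_power (path_algebra Q) (arrow_ideal Q) N)"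


section \<open>Hochschild cohomology of an algebra with coefficients in itself\<close>

text \<open>
  \<open>Hom\<^sub>k(A\<^sup>\<otimes>\<^sup>n, A)\<close> is represented by the \<open>n\<close>-multilinear maps, as extensional functions on the
  lists of length \<open>n\<close> over \<^term>\<open>carrier A\<close>.
\<close>

definition tuples :: "('k, 'a) module \<Rightarrow> nat \<Rightarrow> 'a list set" where
  "tuples A n = {xs. length xs = n \<and> set xs \<subseteq> carrier A}"

definition hcochains :: "('k, 'a) module \<Rightarrow> nat \<Rightarrow> ('a list \<Rightarrow> 'a) set" where
  "hcochains A n =
     {f \<in> tuples A n \<rightarrow>\<^sub>E carrier A.
        \<forall>xs \<in> tuples A n. \<forall>i<n. \<forall>y \<in> carrier A. \<forall>c.
          f (xs[i := xs ! i \<oplus>\<^bsub>A\<^esub> y]) = f xs \<oplus>\<^bsub>A\<^esub> f (xs[i := y]) \<and>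
          f (xs[i := c \<odot>\<^bsub>A\<^esub> xs ! i]) = c \<odot>\<^bsub>A\<^esub> f xs}"

text \<open>
  As in HOL-Homology, the additive groups of (co)chains and (co)homology classes are written
  with the multiplicative record \<^typ>\<open>'a monoid\<close>; thus \<^const>\<open>one\<close> is the zero element.
\<close>

definition hcochain_group :: "('k, 'a) module \<Rightarrow> nat \<Rightarrow> ('a list \<Rightarrow> 'a) monoid" where
  "hcochain_group A n =
     \<lparr>carrier = hcochains A n,
      monoid.mult = (\<lambda>f g. \<lambda>xs \<in> tuples A n. f xs \<oplus>\<^bsub>A\<^esub> g xs),
      one = (\<lambda>xs \<in> tuples A n. \<zero>\<^bsub>A\<^esub>)\<rparr>"

text \<open>
  The differential of \<open>Hom\<close> from the bar resolution to \<open>A\<close>: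
  \<open>(df)(a\<^sub>1,\<dots>,a\<^sub>n\<^sub>+\<^sub>1) = a\<^sub>1 f(a\<^sub>2,\<dots>,a\<^sub>n\<^sub>+\<^sub>1) + (\<Sum>i=1..n. (-1)\<^sup>i f(\<dots>,a\<^sub>i a\<^sub>i\<^sub>+\<^sub>1,\<dots>))
    + (-1)\<^sup>n\<^sup>+\<^sup>1 f(a\<^sub>1,\<dots>,a\<^sub>n) a\<^sub>n\<^sub>+\<^sub>1\<close>. List positions start at 0.
\<close>

definition hdiff ::
    "('k::field, 'a) module \<Rightarrow> nat \<Rightarrow> ('a list \<Rightarrow> 'a) \<Rightarrow> 'a list \<Rightarrow> 'a" where
  "hdiff A n f = (\<lambda>xs \<in> tuples A (Suc n).
     (hd xs \<otimes>\<^bsub>A\<^esub> f (tl xs)) \<oplus>\<^bsub>A\<^esub>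
     (\<Oplus>\<^bsub>A\<^esub>i\<in>{1..n}. (-1) ^ i \<odot>\<^bsub>A\<^esub>
        f (take (i - 1) xs @ (xs ! (i - 1) \<otimes>\<^bsub>A\<^esub> xs ! i) # drop (i + 1) xs)) \<oplus>\<^bsub>A\<^esub>
     ((-1) ^ (n + 1) \<odot>\<^bsub>A\<^esub> (f (butlast xs) \<otimes>\<^bsub>A\<^esub> last xs)))"

definition hcocycles :: "('k::field, 'a) module \<Rightarrow> nat \<Rightarrow> ('a list \<Rightarrow> 'a) set" where
  "hcocycles A n = kernel (hcochain_group A n) (hcochain_group A (Suc n)) (hdiff A n)"

fun hcoboundaries :: "('k::field, 'a) module \<Rightarrow> nat \<Rightarrow> ('a list \<Rightarrow> 'a) set" where
  "hcoboundaries A 0 = {\<one>\<^bsub>hcochain_group A 0\<^esub>}"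
| "hcoboundaries A (Suc n) = hdiff A n ` hcochains A n"

definition HH :: "('k::field, 'a) module \<Rightarrow> nat \<Rightarrow> ('a list \<Rightarrow> 'a) set monoid" where
  "HH A n = (hcochain_group A n)\<lparr>carrier := hcocycles A n\<rparr> Mod hcoboundaries A n"

definition cochain_cup ::
    "('k::field, 'a) module \<Rightarrow> nat \<Rightarrow> nat \<Rightarrow> ('a list \<Rightarrow> 'a) \<Rightarrow> ('a list \<Rightarrow> 'a) \<Rightarrow> 'a list \<Rightarrow> 'a" where
  "cochain_cup A m n f g =
     (\<lambda>xs \<in> tuples A (m + n). f (take m xs) \<otimes>\<^bsub>A\<^esub> g (drop m xs))"

text \<open>
  Elements of \<^term>\<open>carrier (HH A n)\<close> are cosets. As in \<^const>\<open>rcoset_mult\<close>, the union runs over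
  all representatives; the cosets joined coincide, since the cup product is compatible with
  the differential.
\<close>

definition hcup ::
    "('k::field, 'a) module \<Rightarrow> nat \<Rightarrow> nat \<Rightarrow> ('a list \<Rightarrow> 'a) set \<Rightarrow> ('a list \<Rightarrow> 'a) set
       \<Rightarrow> ('a list \<Rightarrow> 'a) set" where
  "hcup A m n X Y = (\<Union>f\<in>X. \<Union>g\<in>Y.
     hcoboundaries A (m + n) #>\<^bsub>hcochain_group A (m + n)\<^esub> cochain_cup A m n f g)"


section \<open>The quiver\<close>

datatype vertex = v1 | v2 | v3

datatype arrow = arr_a | arr_x | arr_b

definition \<Delta> :: "(vertex, arrow) pre_digraph" where
  "\<Delta> = \<lparr>verts = {v1, v2, v3}, arcs = {arr_a, arr_x, arr_b},
        tail = (\<lambda>e. case e of arr_a \<Rightarrow> v1 | arr_x \<Rightarrow> v2 | arr_b \<Rightarrow> v2),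
        head = (\<lambda>e. case e of arr_a \<Rightarrow> v2 | arr_x \<Rightarrow> v2 | arr_b \<Rightarrow> v3)\<rparr>"

end

theory Submission
  imports Defs "HOL-Library.Function_Algebras"
begin

text \<open>
  Between two vertices of \<open>\<Delta>\<close> there is at most one path of each length. A path is thus known from
  its ends and its length, and a cochain of \<open>A\<close> can be described by a function \<open>c\<close> on lists of natural
  numbers and an integer \<open>s\<close>: a composable tuple of paths of lengths \<open>l\<^sub>1, \<dots>, l\<^sub>n\<close> goes to
  \<open>c(l\<^sub>1, \<dots>, l\<^sub>n)\<close> times the path with the same ends as the composite and with \<open>s\<close> loops \<open>x\<close> fewer,
  read as \<open>0\<close> if that path does not exist or has length \<open>\<ge> N\<close>. The differential and the cup product of
  such cochains are those of the functions \<open>c\<close> in the bar complex of the semigroup of natural numbers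
  with trivial action (\<open>diff_graded_cochain\<close>, \<open>cup_graded_cochain\<close>). What is left is arithmetic of
  functions on lists, where values at lists whose image has length \<open>\<ge> N\<close> may be ignored.

  Two functions generate everything: \<open>\<eta>(l, l')\<close>, which is \<open>1\<close> if \<open>l + l' \<ge> N\<close> and \<open>0\<close> otherwise, is the
  2-cocycle of the relation \<open>x\<^sup>N = 0\<close>, and \<open>\<xi>(l) = l\<close> is the Euler derivation. The class \<open>\<omega>\<^sub>n\<^sub>,\<^sub>j\<close> has the
  coefficient \<open>\<eta> \<union> \<dots> \<union> \<eta>\<close> for even \<open>n\<close> and \<open>\<xi> \<union> \<eta> \<union> \<dots> \<union> \<eta>\<close> for odd \<open>n\<close>, with the shift that sends
  loops of total length \<open>mN\<close>, resp. \<open>mN + 1\<close>, to \<open>x\<^sup>j\<close>. A product with an even class on the right has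
  the right coefficient on the nose. Moving \<open>\<xi>\<close> from the right of \<open>\<eta>\<^sup>m\<close> to its left changes the product
  by the coboundary of \<open>\<eta>\<^sup>m\<close> multiplied by the total length (\<open>diff_weighted\<close>). For two odd classes this
  leads to \<open>\<xi> \<union> \<xi>\<close>, which is the coboundary of \<open>-\<xi>\<^sup>2/2\<close> up to terms of output length \<open>\<ge> N\<close>. If
  \<open>j\<^sub>1 + j\<^sub>2 \<ge> N\<close>, every output is too long.

  That the classes are nonzero is detected by an evaluation that imitates the periodic resolution of
  \<open>k[x]/(x\<^sup>N)\<close>. The operator \<open>(R F)(ys) = \<Sum>\<^sub>i\<^sub><\<^sub>N F(ys, x\<^sup>i, x) x\<^sup>N\<^sup>-\<^sup>1\<^sup>-\<^sup>i\<close> commutes with the differential on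
  lists that end with \<open>x\<close> (\<open>diff_contract\<close>). In odd degree, iterating it turns a coboundary evaluated at
  \<open>x\<close> into a commutator with \<open>x\<close>, where \<open>x\<^sup>j\<close> has coefficient \<open>0\<close>; the class gives \<open>1\<close>. In even degree two
  numbers are compared, the coefficient of \<open>x\<^sup>j\<close> at the word \<open>x\<^sup>m\<^sup>N\<close> and that of \<open>a x\<^sup>j\<^sup>-\<^sup>1\<close> at \<open>a x\<^sup>m\<^sup>N\<^sup>-\<^sup>1\<close>: for
  a coboundary they are \<open>N c\<close> and \<open>(N - 1) c\<close> with the same \<open>c\<close>, while for the class both are
  \<open>1\<close>. In \<open>k[x]/(x\<^sup>N)\<close> alone \<open>x\<^sup>N\<^sup>-\<^sup>1\<close> would be a coboundary; the arrow \<open>a\<close> prevents that.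
\<close>


section \<open>The bar complex as a recursion on lists\<close>

text \<open>
  Arguments live in a set \<open>C\<close> with an associative operation and act, through \<open>\<psi>\<close>, on values in an
  abelian group with a product. Keeping the two apart lets all sums be sums in a type class, and it
  covers both instances needed: an algebra with its coordinate map \<open>\<psi>\<close>, and the natural numbers under
  addition acting trivially on scalars.
\<close>

locale bar_complex =
  fixes C :: "'a set" and opr :: "'a \<Rightarrow> 'a \<Rightarrow> 'a" (infixl "\<diamondop>" 70)
    and \<psi> :: "'a \<Rightarrow> 'm::ab_group_add" and mul :: "'m \<Rightarrow> 'm \<Rightarrow> 'm" (infixl "\<star>" 70)
  assumes mul_add_left: "(a + b) \<star> c = a \<star> c + b \<star> c"
    and mul_add_right: "a \<star> (b + c) = a \<star> b + a \<star> c"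
    and mul_assoc: "a \<star> b \<star> c = a \<star> (b \<star> c)"
    and opr_closed: "x \<in> C \<Longrightarrow> y \<in> C \<Longrightarrow> x \<diamondop> y \<in> C"
    and opr_assoc: "x \<in> C \<Longrightarrow> y \<in> C \<Longrightarrow> z \<in> C \<Longrightarrow> x \<diamondop> y \<diamondop> z = x \<diamondop> (y \<diamondop> z)"
    and \<psi>_opr: "x \<in> C \<Longrightarrow> y \<in> C \<Longrightarrow> \<psi> (x \<diamondop> y) = \<psi> x \<star> \<psi> y"
begin

text \<open>
  The bar differential without its first term, that is, for the trivial left action. The first
  argument is either absorbed into the second or stays in front; in the latter case all positions, and
  hence all signs, are shifted by one. This recursion is what makes the identities below inductions.
\<close>

primrec bar :: "'a list \<Rightarrow> ('a list \<Rightarrow> 'm) \<Rightarrow> 'm" where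
  "bar [] F = 0"
| "bar (x # xs) F = (case xs of [] \<Rightarrow> - (F [] \<star> \<psi> x)
     | y # r \<Rightarrow> - F (x \<diamondop> y # r) - bar xs (\<lambda>zs. F (x # zs)))"

text \<open>
  As a rewrite rule, the second equation would unfold without end under case splits.
\<close>

declare bar.simps(2) [simp del]

lemma bar_single [simp]: "bar [x] F = - (F [] \<star> \<psi> x)"
  and bar_Cons_Cons [simp]: "bar (x # y # r) F = - F (x \<diamondop> y # r) - bar (y # r) (\<lambda>zs. F (x # zs))"
  by (simp_all add: bar.simps(2))

definition diff :: "('a list \<Rightarrow> 'm) \<Rightarrow> 'a list \<Rightarrow> 'm" where
  "diff F xs = \<psi> (hd xs) \<star> F (tl xs) + bar xs F"

definition cup :: "nat \<Rightarrow> ('a list \<Rightarrow> 'm) \<Rightarrow> ('a list \<Rightarrow> 'm) \<Rightarrow> 'a list \<Rightarrow> 'm" where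
  "cup m F G zs = F (take m zs) \<star> G (drop m zs)"

lemma mul_zero_left [simp]: "0 \<star> a = 0"
  using mul_add_left[of 0 0 a] by simp
lemma mul_zero_right [simp]: "a \<star> 0 = 0"
  using mul_add_right[of a 0 0] by simp
lemma mul_minus_left: "(- a) \<star> b = - (a \<star> b)"
  using mul_add_left[of "-a" a b] by (simp add: eq_neg_iff_add_eq_0)
lemma mul_minus_right: "a \<star> (- b) = - (a \<star> b)"
  using mul_add_right[of a "-b" b] by (simp add: eq_neg_iff_add_eq_0)
lemma mul_diff_left: "(a - b) \<star> c = a \<star> c - b \<star> c"
  using mul_add_left[of a "-b" c] by (simp add: mul_minus_left)
lemma mul_diff_right: "a \<star> (b - c) = a \<star> b - a \<star> c"
  using mul_add_right[of a b "-c"] by (simp add: mul_minus_right)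
lemma mul_sum_left: "(\<Sum>i\<in>I. f i) \<star> c = (\<Sum>i\<in>I. f i \<star> c)"
  by (induction I rule: infinite_finite_induct) (simp_all add: mul_add_left)
lemma mul_sum_right: "c \<star> (\<Sum>i\<in>I. f i) = (\<Sum>i\<in>I. c \<star> f i)"
  by (induction I rule: infinite_finite_induct) (simp_all add: mul_add_right)
lemmas mul_simps = mul_add_left mul_add_right mul_minus_left mul_minus_right mul_diff_left mul_diff_right

lemma bar_cong:
  assumes "\<And>zs. Suc (length zs) = length xs \<Longrightarrow> set zs \<subseteq> C \<Longrightarrow> F zs = G zs" "set xs \<subseteq> C"
  shows "bar xs F = bar xs G"
  using assms
proof (induction xs arbitrary: F G)
  case (Cons x xs)
  show ?case
  proof (cases xs)
    case Nil
    then show ?thesis using Cons.prems(1)[of "[]"] by simp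
  next
    case (Cons y r)
    have "bar xs (\<lambda>zs. F (x # zs)) = bar xs (\<lambda>zs. G (x # zs))"
      by (rule Cons.IH) (use Cons.prems in auto)
    moreover have "F (x \<diamondop> y # r) = G (x \<diamondop> y # r)"
      by (rule Cons.prems(1)) (use Cons Cons.prems(2) opr_closed in auto)
    ultimately show ?thesis using Cons by simp
  qed
qed simp

lemma diff_cong:
  assumes "\<And>zs. Suc (length zs) = length xs \<Longrightarrow> set zs \<subseteq> C \<Longrightarrow> F zs = G zs" "set xs \<subseteq> C" "xs \<noteq> []"
  shows "diff F xs = diff G xs"
proof -
  have "bar xs F = bar xs G" by (rule bar_cong) (use assms in auto)
  moreover have "F (tl xs) = G (tl xs)"
    by (rule assms(1)) (use assms(2,3) in \<open>auto dest: list.set_sel(2)\<close>)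
  ultimately show ?thesis by (simp add: diff_def)
qed

lemma bar_zero: "bar xs (\<lambda>_. 0) = 0"
  by (induction xs rule: induct_list012) auto

lemma bar_add: "bar xs (\<lambda>zs. F zs + G zs) = bar xs F + bar xs G"
  by (induction xs arbitrary: F G rule: induct_list012) (auto simp: mul_simps)

lemma bar_map:
  assumes "\<And>a b. T (a + b) = T a + T b" "\<And>a b. T (a \<star> b) = T a \<star> b"
  shows "T (bar xs F) = bar xs (\<lambda>zs. T (F zs))"
proof -
  have T0: "T 0 = 0" using assms(1)[of 0 0] by simp
  have Tm: "T (- a) = - T a" for a using assms(1)[of "-a" a] T0 by (simp add: eq_neg_iff_add_eq_0)
  have Td: "T (a - b) = T a - T b" for a b using assms(1)[of a "-b"] Tm by simp
  show ?thesis
    by (induction xs arbitrary: F rule: induct_list012) (auto simp: T0 Tm Td assms)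
qed

lemma bar_minus: "bar xs (\<lambda>zs. - F zs) = - bar xs F"
  by (rule bar_map[symmetric]) (simp_all add: mul_simps)

lemma bar_diff: "bar xs (\<lambda>zs. F zs - G zs) = bar xs F - bar xs G"
  using bar_add[of xs F "\<lambda>zs. - G zs"] by (simp add: bar_minus)

lemma bar_mul: "bar xs (\<lambda>zs. a \<star> F zs) = a \<star> bar xs F"
  by (rule bar_map[symmetric]) (simp_all add: mul_simps mul_assoc)

lemma diff_add: "diff (\<lambda>zs. F zs + G zs) xs = diff F xs + diff G xs"
  by (simp add: diff_def bar_add mul_simps)
lemma diff_minus: "diff (\<lambda>zs. - F zs) xs = - diff F xs"
  by (simp add: diff_def bar_minus mul_simps)
text \<open>
  The absorbed argument commutes with the rest of the differential. On the empty list there is no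
  argument to absorb \<open>x\<close>, and it acts on the value instead; this is the reason for the case distinction.
\<close>

lemma bar_opr_head:
  assumes "set (x # y # r) \<subseteq> C"
  shows "bar (y # r) (\<lambda>zs. if zs = [] then F [] \<star> \<psi> x else F (x \<diamondop> hd zs # tl zs))
       = bar (x \<diamondop> y # r) F"
  using assms by (cases r) (auto simp: \<psi>_opr mul_assoc opr_assoc)

lemma bar_bar:
  assumes "set xs \<subseteq> C"
  shows "bar xs (\<lambda>zs. bar zs F) = 0"
  using assms
proof (induction xs arbitrary: F)
  case (Cons x xs)
  show ?case
  proof (cases xs)
    case (Cons y r)
    have "bar xs (\<lambda>zs. bar (x # zs) F) =
      bar xs (\<lambda>zs. - (if zs = [] then F [] \<star> \<psi> x else F (x \<diamondop> hd zs # tl zs))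
                   - bar zs (\<lambda>zs. F (x # zs)))"
      by (rule bar_cong) (use Cons.prems in \<open>auto simp: neq_Nil_conv\<close>)
    also have "\<dots> = - bar (x \<diamondop> y # r) F - bar xs (\<lambda>zs. bar zs (\<lambda>zs. F (x # zs)))"
      using Cons Cons.prems by (simp only: bar_diff bar_minus bar_opr_head)
    also have "\<dots> = - bar (x \<diamondop> y # r) F" using Cons.IH Cons.prems by simp
    finally show ?thesis using Cons by simp
  qed simp
qed simp

text \<open>
  The left action anticommutes with \<open>bar\<close> up to \<open>diff\<close> itself, and \<open>bar\<close> squares to zero.
\<close>

lemma diff_diff_zero:
  assumes "set xs \<subseteq> C" "length xs \<ge> 2"
  shows "diff (diff F) xs = 0"
proof -
  obtain x y r where xs: "xs = x # y # r"
    using assms(2) by (cases xs; cases "tl xs") auto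
  have "bar xs (\<lambda>zs. \<psi> (hd zs) \<star> F (tl zs)) = - (\<psi> x \<star> diff F (y # r))"
  proof -
    have "bar xs (\<lambda>zs. \<psi> (hd zs) \<star> F (tl zs)) =
      - (\<psi> (x \<diamondop> y) \<star> F r) - bar (y # r) (\<lambda>zs. \<psi> x \<star> F zs)"
      by (simp add: xs)
    then show ?thesis
      using assms by (simp add: bar_mul diff_def mul_simps mul_assoc \<psi>_opr xs del: bar_Cons_Cons)
  qed
  moreover have "bar xs (diff F) = bar xs (\<lambda>zs. \<psi> (hd zs) \<star> F (tl zs)) + bar xs (\<lambda>zs. bar zs F)"
    unfolding diff_def[abs_def] by (rule bar_add)
  ultimately show ?thesis
    using bar_bar[OF assms(1), of F] by (simp add: diff_def[of "diff F"] xs del: bar_Cons_Cons)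
qed

definition alt :: "nat \<Rightarrow> 'm \<Rightarrow> 'm" where "alt m y = (if even m then y else - y)"

lemma bar_cup:
  assumes "length xs > m"
  shows "bar xs (cup m F G) = bar (take (Suc m) xs) F \<star> G (drop (Suc m) xs)
       + alt m (F (take m xs) \<star> diff G (drop m xs))"
  using assms
proof (induction m arbitrary: F xs)
  case 0
  then obtain x r where xs: "xs = x # r" by (cases xs) auto
  have "bar xs (cup 0 F G) = F [] \<star> bar xs G"
    by (simp add: cup_def[abs_def] bar_mul)
  then show ?case by (simp add: xs diff_def alt_def mul_simps mul_assoc)
next
  case (Suc m)
  then obtain x y r where xs: "xs = x # y # r" by (cases xs; cases "tl xs") auto
  have "cup (Suc m) F G (x # zs) = cup m (\<lambda>zs. F (x # zs)) G zs" for zs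
    by (simp add: cup_def)
  then have "bar xs (cup (Suc m) F G) =
     - cup (Suc m) F G (x \<diamondop> y # r) - bar (y # r) (cup m (\<lambda>zs. F (x # zs)) G)"
    by (simp add: xs)
  then show ?case using Suc.prems
    by (simp add: xs Suc.IH cup_def[of "Suc m"] alt_def mul_simps)
qed

text \<open>
  The Leibniz rule. In \<open>bar_cup\<close>, the recursion feeds arguments to \<open>F\<close> until none is left for it;
  then the left action that \<open>bar\<close> omits is supplied by the last term of the differential of \<open>F\<close>.
\<close>

lemma diff_cup:
  assumes "length xs > m"
  shows "diff (cup m F G) xs = diff F (take (Suc m) xs) \<star> G (drop (Suc m) xs)
       + alt m (F (take m xs) \<star> diff G (drop m xs))"
proof (cases m)
  case 0
  then show ?thesis using assms
    by (cases xs) (auto simp: diff_def bar_cup cup_def alt_def mul_simps mul_assoc )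
next
  case (Suc k)
  then show ?thesis using assms
    by (cases xs) (auto simp: diff_def[of "cup (Suc k) F G"] diff_def[of F] bar_cup cup_def mul_simps mul_assoc )
qed

end

text \<open>
  The powers \<open>e i\<close> of one element, which vanish from exponent \<open>N\<close> on.
\<close>

locale bar_complex_power = bar_complex C opr \<psi> mul
  for C :: "'a set" and opr :: "'a \<Rightarrow> 'a \<Rightarrow> 'a" (infixl "\<diamondop>" 70)
    and \<psi> :: "'a \<Rightarrow> 'm::ab_group_add" and mul :: "'m \<Rightarrow> 'm \<Rightarrow> 'm" (infixl "\<star>" 70) +
  fixes e :: "nat \<Rightarrow> 'a" and N :: nat
  assumes e_in: "e i \<in> C" and e_opr: "e i \<diamondop> e j = e (i + j)" and \<psi>_e: "N \<le> i \<Longrightarrow> \<psi> (e i) = 0"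
begin

definition vanishing :: "('a list \<Rightarrow> 'm) \<Rightarrow> bool" where
  "vanishing F \<longleftrightarrow> (\<forall>zs i. N \<le> i \<longrightarrow> e i \<in> set zs \<longrightarrow> F zs = 0)"

text \<open>
  In the periodic resolution of \<open>k[x]/(x\<^sup>N)\<close> every second differential is
  \<open>\<Sum>\<^sub>i x\<^sup>i \<otimes> x\<^sup>N\<^sup>-\<^sup>1\<^sup>-\<^sup>i\<close>. Its comparison with the bar resolution raises the degree by two by appending
  \<open>x\<^sup>i, x\<close>; this is the dual operation on cochains.
\<close>

definition contract :: "('a list \<Rightarrow> 'm) \<Rightarrow> 'a list \<Rightarrow> 'm" where
  "contract F zs = (\<Sum>i<N. F (zs @ [e i, e (Suc 0)]) \<star> \<psi> (e (N - Suc i)))"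

lemma vanishingD: "vanishing F \<Longrightarrow> N \<le> i \<Longrightarrow> e i \<in> set zs \<Longrightarrow> F zs = 0"
  by (auto simp: vanishing_def)

lemma vanishing_contract: "vanishing F \<Longrightarrow> vanishing (contract F)"
  by (auto simp: vanishing_def contract_def intro!: sum.neutral)

lemma \<psi>_e_mult: "\<psi> (e i) \<star> \<psi> (e j) = \<psi> (e (i + j))"
  by (simp add: e_opr e_in flip: \<psi>_opr)

lemma vanishing_Cons: "vanishing F \<Longrightarrow> vanishing (\<lambda>zs. F (x # zs))"
  by (auto simp: vanishing_def)

lemma telescope:
  assumes "g M = 0"
  shows "(\<Sum>i<M. g (Suc i) \<star> \<psi> (e (M - Suc i))) - (\<Sum>i<M. g i \<star> \<psi> (e (M - i))) = - (g 0 \<star> \<psi> (e M))"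
proof (cases M)
  case 0 then show ?thesis using assms by simp
next
  case (Suc k)
  have "(\<Sum>i<M. g (Suc i) \<star> \<psi> (e (M - Suc i))) - (\<Sum>i<M. g i \<star> \<psi> (e (M - i)))
     = (\<Sum>i<M. g (Suc i) \<star> \<psi> (e (M - Suc i)) - g i \<star> \<psi> (e (M - i)))"
    by (simp add: sum_subtractf)
  also have "\<dots> = g M \<star> \<psi> (e (M - M)) - g 0 \<star> \<psi> (e (M - 0))"
    by (rule sum_lessThan_telescope)
  finally show ?thesis using assms by simp
qed

text \<open>
  All terms that touch the appended arguments telescope in \<open>i\<close>, since \<open>x\<^sup>i x = x x\<^sup>i = x\<^sup>i\<^sup>+\<^sup>1\<close>. This
  needs the argument before them to be \<open>x\<close> as well. The boundary terms contain \<open>x\<^sup>N = 0\<close>, as an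
  argument or as a factor.
\<close>

lemma bar_contract:
  assumes "vanishing F"
  shows "(\<Sum>i<N. bar (ys @ [e (Suc 0), e i, e (Suc 0)]) F \<star> \<psi> (e (N - Suc i))) = bar (ys @ [e (Suc 0)]) (contract F)"
  using assms
proof (induction ys arbitrary: F)
  case Nil
  have 1: "\<psi> (e (Suc 0)) \<star> \<psi> (e (N - Suc i)) = \<psi> (e (N - i))" if "i < N" for i
    using that by (simp add: \<psi>_e_mult Suc_diff_Suc)
  have 2: "\<psi> (e (N - Suc i)) \<star> \<psi> (e (Suc 0)) = \<psi> (e (N - i))" if "i < N" for i
    using that by (simp add: \<psi>_e_mult Suc_diff_Suc)
  define g where "g i = F [e (Suc 0), e i]" for i
  define h where "h i = F [e i, e (Suc 0)]" for i
  have g: "(\<Sum>i<N. g (Suc i) \<star> \<psi> (e (N - Suc i))) - (\<Sum>i<N. g i \<star> \<psi> (e (N - i))) = 0"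
    using Nil by (subst telescope) (auto simp: g_def \<psi>_e intro: vanishingD)
  have h: "(\<Sum>i<N. h (Suc i) \<star> \<psi> (e (N - Suc i))) - (\<Sum>i<N. h i \<star> \<psi> (e (N - i))) = 0"
    using Nil by (subst telescope) (auto simp: h_def \<psi>_e intro: vanishingD)
  have "(\<Sum>i<N. bar ([] @ [e (Suc 0), e i, e (Suc 0)]) F \<star> \<psi> (e (N - Suc i)))
    = (\<Sum>i<N. g (Suc i) \<star> \<psi> (e (N - Suc i)) - g i \<star> \<psi> (e (N - i)) - h (Suc i) \<star> \<psi> (e (N - Suc i)))"
    by (rule sum.cong) (simp_all add: e_opr g_def h_def mul_simps mul_assoc 1)
  also have "\<dots> = - (\<Sum>i<N. h (Suc i) \<star> \<psi> (e (N - Suc i)))"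
    using g by (simp add: sum_subtractf)
  also have "\<dots> = - (\<Sum>i<N. h i \<star> \<psi> (e (N - i)))"
    using h by simp
  also have "\<dots> = bar ([] @ [e (Suc 0)]) (contract F)"
    by (simp add: contract_def mul_sum_left mul_assoc 2 h_def)
  finally show ?case .
next
  case (Cons y ys)
  obtain z r where zr: "ys @ [e (Suc 0)] = z # r" by (cases ys) auto
  then have zr': "ys @ [e (Suc 0), e i, e (Suc 0)] = z # r @ [e i, e (Suc 0)]" for i
    by (metis append.assoc append_Cons append_Nil)
  have "(\<Sum>i<N. bar ((y # ys) @ [e (Suc 0), e i, e (Suc 0)]) F \<star> \<psi> (e (N - Suc i)))
    = - contract F (y \<diamondop> z # r) - (\<Sum>i<N. bar (ys @ [e (Suc 0), e i, e (Suc 0)]) (\<lambda>zs. F (y # zs)) \<star> \<psi> (e (N - Suc i)))"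
    by (simp add: zr' contract_def mul_simps sum_subtractf sum_negf)
  also have "\<dots> = - contract F (y \<diamondop> z # r) - bar (ys @ [e (Suc 0)]) (contract (\<lambda>zs. F (y # zs)))"
    by (simp only: Cons.IH[OF vanishing_Cons[OF Cons.prems]])
  also have "contract (\<lambda>zs. F (y # zs)) = (\<lambda>zs. contract F (y # zs))"
    by (auto simp: contract_def)
  finally show ?case by (simp add: zr)
qed

lemma diff_contract:
  assumes "vanishing F"
  shows "contract (diff F) (ys @ [e (Suc 0)]) = diff (contract F) (ys @ [e (Suc 0)])"
proof -
  have 1: "diff F (ys @ [e (Suc 0), e i, e (Suc 0)]) = \<psi> (hd (ys @ [e (Suc 0)])) \<star> F (tl (ys @ [e (Suc 0)]) @ [e i, e (Suc 0)]) + bar (ys @ [e (Suc 0), e i, e (Suc 0)]) F" for i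
    by (cases ys) (auto simp: diff_def )
  show ?thesis
    unfolding diff_def[of "contract F"] contract_def[of "diff F"]
    by (simp add: 1 mul_simps sum.distrib bar_contract[OF assms] mul_assoc)
       (simp add: contract_def mul_sum_right)
qed

lemma diff_contract_power:
  assumes "vanishing F"
  shows "(contract ^^ k) (diff F) (ys @ [e (Suc 0)]) = diff ((contract ^^ k) F) (ys @ [e (Suc 0)]) \<and> vanishing ((contract ^^ k) F)"
proof (induction k arbitrary: ys)
  case (Suc k)
  have "(contract ^^ Suc k) (diff F) (ys @ [e (Suc 0)]) = contract (diff ((contract ^^ k) F)) (ys @ [e (Suc 0)])"
    unfolding contract_def[of "diff _"] contract_def[of "(contract ^^ k) _"] funpow.simps o_apply
    using Suc[THEN conjunct1, of "ys @ [e (Suc 0), e i]" for i] by simp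
  then show ?case using Suc diff_contract vanishing_contract by auto
qed (use assms in simp)

text \<open>
  With nothing in front of the appended arguments, the left action does not cancel; what remains is
  the differential of the periodic resolution.
\<close>

lemma contract_diff_Nil:
  assumes "vanishing F"
  shows "contract (diff F) [] = (\<Sum>i<N. \<psi> (e i) \<star> F [e (Suc 0)] \<star> \<psi> (e (N - Suc i)))"
proof -
  have t: "(\<Sum>i<N. F [e (Suc i)] \<star> \<psi> (e (N - Suc i))) - (\<Sum>i<N. F [e i] \<star> \<psi> (e (N - i))) = 0"
    using vanishingD[OF assms, of N "[e N]"] telescope[of "\<lambda>i. F [e i]" N] by (simp add: \<psi>_e)
  have "contract (diff F) [] = (\<Sum>i<N. \<psi> (e i) \<star> F [e (Suc 0)] \<star> \<psi> (e (N - Suc i))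
     - (F [e (Suc i)] \<star> \<psi> (e (N - Suc i)) - F [e i] \<star> \<psi> (e (N - i))))"
    unfolding contract_def
    by (rule sum.cong) (simp_all add: diff_def e_opr mul_simps mul_assoc \<psi>_e_mult Suc_diff_Suc)
  then show ?thesis using t by (simp add: sum_subtractf)
qed

end

section \<open>Truncated path algebras in coordinates\<close>

text \<open>
  Paths are triples that should not be taken apart by the simplifier.
\<close>

declare split_paired_All [simp del] split_paired_Ex [simp del]

definition qlen :: "('v, 'e) qpath \<Rightarrow> nat" where "qlen p = length (fst (snd p))"

definition pcomp :: "('v, 'e) qpath \<Rightarrow> ('v, 'e) qpath \<Rightarrow> ('v, 'e) qpath" where
  "pcomp p q = (fst p, fst (snd p) @ fst (snd q), snd (snd q))"

lemma concats_to_iff: "concats_to p q r \<longleftrightarrow> snd (snd p) = fst q \<and> r = pcomp p q"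
  by (auto simp: concats_to_def pcomp_def split: prod.splits)

lemma fst_pcomp [simp]: "fst (pcomp p q) = fst p"
  and target_pcomp [simp]: "snd (snd (pcomp p q)) = snd (snd q)"
  and qlen_pcomp [simp]: "qlen (pcomp p q) = qlen p + qlen q"
  by (simp_all add: pcomp_def qlen_def)

abbreviation trunc :: "nat \<Rightarrow> (('v, 'e) qpath \<Rightarrow> 'k::zero) \<Rightarrow> ('v, 'e) qpath \<Rightarrow> 'k" where
  "trunc N f \<equiv> (\<lambda>p. if qlen p < N then f p else 0)"

definition (in pre_digraph) factorizations :: "('a, 'b) qpath \<Rightarrow> (('a, 'b) qpath \<times> ('a, 'b) qpath) set" where
  "factorizations r = {(p, q). p \<in> qpaths G \<and> q \<in> qpaths G \<and> concats_to p q r}"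

definition (in pre_digraph) conv ::
    "(('a, 'b) qpath \<Rightarrow> 'k::field) \<Rightarrow> (('a, 'b) qpath \<Rightarrow> 'k) \<Rightarrow> ('a, 'b) qpath \<Rightarrow> 'k" where
  "conv f g r = (\<Sum>(p, q) \<in> factorizations r. f p * g q)"

definition (in pre_digraph) short_paths :: "nat \<Rightarrow> ('a, 'b) qpath set" where
  "short_paths N = {p \<in> qpaths G. qlen p < N}"

definition (in pre_digraph) tconv ::
    "nat \<Rightarrow> (('a, 'b) qpath \<Rightarrow> 'k::field) \<Rightarrow> (('a, 'b) qpath \<Rightarrow> 'k) \<Rightarrow> ('a, 'b) qpath \<Rightarrow> 'k" where
  "tconv N f g = trunc N (conv f g)"

text \<open>
  The coordinates of a coset modulo \<open>I\<^sup>N\<close>: all its representatives agree on the paths of length less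
  than \<open>N\<close>, so any choice gives the same result.
\<close>

definition coords :: "nat \<Rightarrow> (('v, 'e) qpath \<Rightarrow> 'k::field) set \<Rightarrow> ('v, 'e) qpath \<Rightarrow> 'k" where
  "coords N X = trunc N (SOME f. f \<in> X)"

lemma path_algebra_simps:
  "carrier (path_algebra Q) = {f. finite {p. f p \<noteq> 0} \<and> {p. f p \<noteq> 0} \<subseteq> qpaths Q}"
  "f \<otimes>\<^bsub>path_algebra Q\<^esub> g = pre_digraph.conv Q f g"
  "f \<oplus>\<^bsub>path_algebra Q\<^esub> g = f + g"
  "\<zero>\<^bsub>path_algebra Q\<^esub> = 0"
  "\<one>\<^bsub>path_algebra Q\<^esub> = (\<lambda>r. if r \<in> {(v, [], v) | v. v \<in> verts Q} then 1 else 0)"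
  "c \<odot>\<^bsub>path_algebra Q\<^esub> f = (\<lambda>r. c * f r)"
  by (auto simp: path_algebra_def pre_digraph.conv_def pre_digraph.factorizations_def fun_eq_iff)

text \<open>
  A finitely supported function is a finite sum of multiples of paths; this is how an additive set
  is shown to contain it.
\<close>

lemma qpath_finite_support_induct:
  assumes fin: "finite {p. f p \<noteq> 0}"
    and "S 0" "\<And>g h. S g \<Longrightarrow> S h \<Longrightarrow> S (g + h)"
    and "\<And>p c. f p \<noteq> 0 \<Longrightarrow> S (\<lambda>r. c * path_vec p r)"
  shows "S (f :: _ \<Rightarrow> 'k::field)"
proof -
  have "S (\<lambda>r. if r \<in> X then f r else 0)" if "finite X" "X \<subseteq> {p. f p \<noteq> 0}" for X
    using that
  proof (induction X rule: finite_induct)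
    case empty
    then show ?case using assms(2) by (simp add: zero_fun_def)
  next
    case (insert p X)
    have "(\<lambda>r. if r \<in> insert p X then f r else 0)
        = (\<lambda>r. f p * path_vec p r) + (\<lambda>r. if r \<in> X then f r else 0)"
      using insert by (auto simp: fun_eq_iff path_vec_def)
    then show ?case using insert assms(3,4) by auto
  qed
  from this[OF fin] have "S (\<lambda>r. if r \<in> {p. f p \<noteq> 0} then f r else 0)" by blast
  also have "(\<lambda>r. if r \<in> {p. f p \<noteq> 0} then f r else 0) = f" by auto
  finally show ?thesis .
qed

context fin_digraph
begin

lemma qpaths_iff: "(u, es, v) \<in> qpaths G \<longleftrightarrow> awalk u es v"
  by (simp add: qpaths_def)

lemma pcomp_in_qpaths:
  assumes "p \<in> qpaths G" "q \<in> qpaths G" "snd (snd p) = fst q"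
  shows "pcomp p q \<in> qpaths G"
  using assms by (cases p; cases q) (auto simp: qpaths_iff pcomp_def awalk_append_iff awlast_if_cas awalk_def intro: awalk_appendI)

lemma qpaths_append:
  "(u, es, v) \<in> qpaths G \<Longrightarrow> (v, fs, w) \<in> qpaths G \<Longrightarrow> (u, es @ fs, w) \<in> qpaths G"
  using pcomp_in_qpaths[of "(u, es, v)" "(v, fs, w)"] by (simp add: pcomp_def)

lemma factorizations_iff:
  "(p, q) \<in> factorizations r \<longleftrightarrow> p \<in> qpaths G \<and> q \<in> qpaths G \<and> snd (snd p) = fst q \<and> r = pcomp p q"
  by (simp add: factorizations_def concats_to_iff)

lemma finite_factorizations [simp]: "finite (factorizations r)"
proof -
  obtain u es w where r: "r = (u, es, w)" by (cases r)
  let ?g = "\<lambda>(k, v). ((u, take k es, v), (v, drop k es, w))"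
  have "factorizations r \<subseteq> ?g ` ({..length es} \<times> verts G)"
  proof
    fix z assume "z \<in> factorizations r"
    then obtain p q where z: "z = (p, q)" "(p, q) \<in> factorizations r" by (cases z) auto
    then obtain fs v gs where "p = (u, fs, v)" "q = (v, gs, w)" "es = fs @ gs" "v \<in> verts G"
      by (cases p; cases q) (auto simp: factorizations_iff pcomp_def r qpaths_iff awalk_def)
    then have "z = ?g (length fs, v)" "(length fs, v) \<in> {..length es} \<times> verts G"
      using z by auto
    then show "z \<in> ?g ` ({..length es} \<times> verts G)" by (rule image_eqI)
  qed
  then show ?thesis by (rule finite_subset) simp
qed

text \<open>
  Both sides sum over the finitely many ways to cut a path into three.
\<close>

lemma conv_assoc: "conv (conv f g) h = conv f (conv g h)"
proof
  fix r
  have "conv (conv f g) h r = (\<Sum>x\<in>Sigma (factorizations r) (\<lambda>(t, s). factorizations t).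
      case x of ((t, s), (p, q)) \<Rightarrow> f p * g q * h s)"
    by (simp add: conv_def sum_distrib_right split_def sum.Sigma)
  also have "\<dots> = (\<Sum>x\<in>Sigma (factorizations r) (\<lambda>(p, t). factorizations t).
      case x of ((p, t), (q, s)) \<Rightarrow> f p * g q * h s)"
    by (rule sum.reindex_bij_witness[of _ "\<lambda>((p, t), (q, s)). ((pcomp p q, s), (p, q))"
          "\<lambda>((t, s), (p, q)). ((p, pcomp q s), (q, s))"])
       (auto simp: factorizations_iff pcomp_def intro: qpaths_append)
  also have "\<dots> = conv f (conv g h) r"
    by (simp add: conv_def sum_distrib_left split_def sum.Sigma mult.assoc)
  finally show "conv (conv f g) h r = conv f (conv g h) r" .
qed

lemma conv_add_left: "conv (f + g) h = conv f h + conv g h"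
  and conv_add_right: "conv f (g + h) = conv f g + conv f h"
  by (simp_all add: fun_eq_iff conv_def split_def sum.distrib distrib_left distrib_right)

lemma conv_smult_left: "conv (\<lambda>r. c * f r) g = (\<lambda>r. c * conv f g r)"
  and conv_smult_right: "conv f (\<lambda>r. c * g r) = (\<lambda>r. c * conv f g r)"
  by (simp_all add: fun_eq_iff conv_def split_def sum_distrib_left mult_ac)

lemma conv_nonzero: "conv f g r \<noteq> 0 \<Longrightarrow> \<exists>p q. (p, q) \<in> factorizations r \<and> f p \<noteq> 0 \<and> g q \<noteq> 0"
proof -
  assume "conv f g r \<noteq> 0"
  then obtain x where "x \<in> factorizations r" "(case x of (p, q) \<Rightarrow> f p * g q) \<noteq> 0"
    unfolding conv_def by (rule sum.not_neutral_contains_not_neutral)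
  then show ?thesis by (intro exI[of _ "fst x"] exI[of _ "snd x"]) (simp add: split_def)
qed

lemma conv_outside: "r \<notin> qpaths G \<Longrightarrow> conv f g r = 0"
proof (rule ccontr)
  assume r: "r \<notin> qpaths G" "conv f g r \<noteq> 0"
  then obtain p q where "(p, q) \<in> factorizations r" using conv_nonzero by blast
  then show False using r(1) pcomp_in_qpaths by (simp add: factorizations_iff)
qed

lemma conv_path_vec_left:
  assumes "p \<in> qpaths G" "q \<in> qpaths G" "snd (snd p) = fst q"
  shows "conv (path_vec p) g (pcomp p q) = g q"
proof -
  have "conv (path_vec p) g (pcomp p q) = (\<Sum>x\<in>{(p, q)}. path_vec p (fst x) * g (snd x))"
    unfolding conv_def split_def
    by (rule sum.mono_neutral_right)
       (use assms in \<open>auto simp: factorizations_iff path_vec_def pcomp_def prod_eq_iff\<close>)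
  then show ?thesis by (simp add: path_vec_def)
qed

lemma conv_path_vec_right:
  assumes "p \<in> qpaths G" "q \<in> qpaths G" "snd (snd p) = fst q"
  shows "conv g (path_vec q) (pcomp p q) = g p"
proof -
  have "conv g (path_vec q) (pcomp p q) = (\<Sum>x\<in>{(p, q)}. g (fst x) * path_vec q (snd x))"
    unfolding conv_def split_def
    by (rule sum.mono_neutral_right)
       (use assms in \<open>auto simp: factorizations_iff path_vec_def pcomp_def prod_eq_iff\<close>)
  then show ?thesis by (simp add: path_vec_def)
qed

lemma conv_path_vec_short:
  assumes "qlen r < qlen p"
  shows "conv (path_vec p) g r = 0" "conv g (path_vec p) r = 0"
proof -
  note l = assms
  show "conv (path_vec p) g r = 0"
  proof (rule ccontr)
    assume "conv (path_vec p) g r \<noteq> 0"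
    from conv_nonzero[OF this] show False using l by (auto simp: factorizations_iff path_vec_def split: if_splits)
  qed
  show "conv g (path_vec p) r = 0"
  proof (rule ccontr)
    assume "conv g (path_vec p) r \<noteq> 0"
    from conv_nonzero[OF this] show False using l by (auto simp: factorizations_iff path_vec_def split: if_splits)
  qed
qed

lemma conv_path_vec:
  assumes "p \<in> qpaths G" "q \<in> qpaths G"
  shows "conv (path_vec p) (path_vec q) = (if snd (snd p) = fst q then path_vec (pcomp p q) else 0)"
proof
  fix r
  show "conv (path_vec p) (path_vec q) r = (if snd (snd p) = fst q then path_vec (pcomp p q) else 0) r"
  proof (cases "r = pcomp p q \<and> snd (snd p) = fst q")
    case True
    then show ?thesis using assms by (simp add: conv_path_vec_left) (simp add: path_vec_def)
  next
    case False
    have "conv (path_vec p) (path_vec q) r = 0"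
    proof (rule ccontr)
      assume "conv (path_vec p) (path_vec q) r \<noteq> 0"
      from conv_nonzero[OF this] show False
        using False by (auto simp: path_vec_def factorizations_iff split: if_splits)
    qed
    then show ?thesis using False by (auto simp: path_vec_def)
  qed
qed

lemma path_algebra_ring: "ring (path_algebra G :: ('k::field, _) module)"
proof -
  let ?P = "path_algebra G :: ('k, _) module"
  have sub: "{p. (f + g) p \<noteq> 0} \<subseteq> {p. f p \<noteq> 0} \<union> {p. g p \<noteq> 0}" for f g :: "_ \<Rightarrow> 'k"
    by auto
  have add: "f + g \<in> carrier ?P" if "f \<in> carrier ?P" "g \<in> carrier ?P" for f g
  proof -
    have "finite {p. (f + g) p \<noteq> 0}"
      by (rule finite_subset[OF sub]) (use that in \<open>simp add: path_algebra_simps\<close>)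
    moreover have "{p. (f + g) p \<noteq> 0} \<subseteq> qpaths G"
      using that sub[of f g] unfolding path_algebra_simps by blast
    ultimately show ?thesis by (simp add: path_algebra_simps)
  qed
  have neg: "- f \<in> carrier ?P" if "f \<in> carrier ?P" for f
    using that by (simp add: path_algebra_simps)
  have mult: "conv f g \<in> carrier ?P" if "f \<in> carrier ?P" "g \<in> carrier ?P" for f g
  proof -
    have "{r. conv f g r \<noteq> 0} \<subseteq> (\<lambda>(p, q). pcomp p q) ` ({p. f p \<noteq> 0} \<times> {q. g q \<noteq> 0}) \<inter> qpaths G"
      using conv_nonzero[of f g] by (fastforce simp: factorizations_iff pcomp_in_qpaths)
    then show ?thesis using that finite_subset[of "{r. conv f g r \<noteq> 0}"]
      by (auto simp: path_algebra_simps)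
  qed
  define one where "one = (\<lambda>r :: ('a, 'b) qpath. if r \<in> {(v, [], v) | v. v \<in> verts G} then 1 else (0 :: 'k))"
  have one: "one \<in> carrier ?P"
  proof -
    have "{r. one r \<noteq> 0} = (\<lambda>v. (v, [], v)) ` verts G" by (auto simp: one_def)
    then show ?thesis by (auto simp: path_algebra_simps qpaths_iff awalk_def)
  qed
  have oneP: "\<one>\<^bsub>?P\<^esub> = one" by (simp only: path_algebra_simps(5) one_def)
  have onel: "conv one f = f" if "f \<in> carrier ?P" for f
  proof
    fix r :: "('a, 'b) qpath"
    obtain u es w where r: "r = (u, es, w)" by (cases r)
    show "conv one f r = f r"
    proof (cases "r \<in> qpaths G")
      case True
      then have u: "u \<in> verts G" using r by (auto simp: qpaths_iff awalk_def)
      have z: "one p * f q = 0" if pq: "(p, q) \<in> factorizations r" "(p, q) \<noteq> ((u, [], u), r)" for p q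
      proof (rule ccontr)
        assume "one p * f q \<noteq> 0"
        then obtain v where "p = (v, [], v)" by (auto simp: one_def split: if_splits)
        then show False using pq r by (cases q) (auto simp: factorizations_iff pcomp_def)
      qed
      have "((u, [], u), r) \<in> factorizations r"
        using True u r by (auto simp: factorizations_iff pcomp_def qpaths_iff awalk_Nil_iff)
      then have "conv one f r = (\<Sum>x\<in>{((u, [], u), r)}. one (fst x) * f (snd x))"
        unfolding conv_def split_def
        by (intro sum.mono_neutral_right ballI) (auto simp del: mult_eq_0_iff intro!: z)
      then show ?thesis using u by (simp add: one_def)
    next
      case False
      then show ?thesis
        using that by (auto simp: conv_outside path_algebra_simps(1))
    qed
  qed
  have oner: "conv f one = f" if "f \<in> carrier ?P" for f
  proof
    fix r :: "('a, 'b) qpath"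
    obtain u es w where r: "r = (u, es, w)" by (cases r)
    show "conv f one r = f r"
    proof (cases "r \<in> qpaths G")
      case True
      then have w: "w \<in> verts G" using r by (auto simp: qpaths_iff)
      have z: "f p * one q = 0" if pq: "(p, q) \<in> factorizations r" "(p, q) \<noteq> (r, (w, [], w))" for p q
      proof (rule ccontr)
        assume "f p * one q \<noteq> 0"
        then obtain v where "q = (v, [], v)" by (auto simp: one_def split: if_splits)
        then show False using pq r by (cases p) (auto simp: factorizations_iff pcomp_def)
      qed
      have "(r, (w, [], w)) \<in> factorizations r"
        using True w r by (auto simp: factorizations_iff pcomp_def qpaths_iff awalk_Nil_iff)
      then have "conv f one r = (\<Sum>x\<in>{(r, (w, [], w))}. f (fst x) * one (snd x))"
        unfolding conv_def split_def
        by (intro sum.mono_neutral_right ballI) (auto simp del: mult_eq_0_iff intro!: z)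
      then show ?thesis using w by (simp add: one_def)
    next
      case False
      then show ?thesis
        using that by (auto simp: conv_outside path_algebra_simps(1))
    qed
  qed
  show ?thesis
  proof (rule ringI)
    show "abelian_group ?P"
      by (rule abelian_groupI)
         (use add neg in \<open>auto simp: path_algebra_simps(2-6) add_ac intro!: bexI[of _ "- x" for x]\<close>,
          auto simp: path_algebra_simps(1))
    show "Group.monoid ?P"
      by (rule monoidI)
         (use mult one onel oner in \<open>auto simp: path_algebra_simps(2-4) oneP conv_assoc\<close>)
  qed (auto simp: path_algebra_simps(2-6) conv_add_left conv_add_right)
qed

definition long_ideal :: "nat \<Rightarrow> (('a, 'b) qpath \<Rightarrow> 'k::field) set" where
  "long_ideal N = {f \<in> carrier (path_algebra G). \<forall>p. f p \<noteq> 0 \<longrightarrow> N \<le> qlen p}"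

lemma scaled_path_vec_in_long_ideal:
  assumes "p \<in> qpaths G" "N \<le> qlen p"
  shows "(\<lambda>r. c * path_vec p r) \<in> long_ideal N"
proof -
  have sub: "{r. c * path_vec p r \<noteq> 0} \<subseteq> {p}" by (auto simp: path_vec_def)
  have "finite {r. c * path_vec p r \<noteq> 0}" by (rule finite_subset[OF sub]) simp
  then show ?thesis using assms by (auto simp: long_ideal_def path_algebra_simps path_vec_def)
qed

lemma long_ideal_ideal: "ideal (long_ideal N :: (_ \<Rightarrow> 'k::field) set) (path_algebra G)"
proof -
  let ?P = "path_algebra G :: ('k, _) module"
  interpret P: ring ?P by (rule path_algebra_ring)
  have neg: "\<ominus>\<^bsub>?P\<^esub> f = - f" if "f \<in> carrier ?P" for f
    by (rule P.minus_equality) (use that in \<open>auto simp: path_algebra_simps\<close>)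
  have addc: "f + g \<in> carrier ?P" if "f \<in> carrier ?P" "g \<in> carrier ?P" for f g
    using P.a_closed[OF that] by (simp add: path_algebra_simps)
  have mulc: "conv f g \<in> carrier ?P" if "f \<in> carrier ?P" "g \<in> carrier ?P" for f g
    using P.m_closed[OF that] by (simp add: path_algebra_simps)
  show ?thesis
  proof (rule idealI[OF path_algebra_ring])
    show "subgroup (long_ideal N) (add_monoid ?P)"
    proof (rule P.add.subgroupI)
      show "long_ideal N \<subseteq> carrier ?P" by (auto simp: long_ideal_def)
      have "0 \<in> (long_ideal N :: (_ \<Rightarrow> 'k) set)" by (auto simp: long_ideal_def path_algebra_simps)
      then show "(long_ideal N :: (_ \<Rightarrow> 'k) set) \<noteq> {}" by blast
      show "\<ominus>\<^bsub>?P\<^esub> f \<in> long_ideal N" if "f \<in> long_ideal N" for f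
        using that P.a_inv_closed[of f] by (auto simp: long_ideal_def neg)
      show "f \<oplus>\<^bsub>?P\<^esub> g \<in> long_ideal N" if "f \<in> long_ideal N" "g \<in> long_ideal N" for f g
        using that addc[of f g] by (force simp: long_ideal_def path_algebra_simps(3))
    qed
    show "x \<otimes>\<^bsub>?P\<^esub> f \<in> long_ideal N" if "f \<in> long_ideal N" "x \<in> carrier ?P" for f x
      using that mulc[of x f] conv_nonzero[of x f]
      by (fastforce simp: long_ideal_def path_algebra_simps(2) factorizations_iff)
    show "f \<otimes>\<^bsub>?P\<^esub> x \<in> long_ideal N" if "f \<in> long_ideal N" "x \<in> carrier ?P" for f x
      using that mulc[of f x] conv_nonzero[of f x]
      by (fastforce simp: long_ideal_def path_algebra_simps(2) factorizations_iff)
  qed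
qed

text \<open>
  A path of positive length is its first arrow times the rest.
\<close>

lemma arrow_ideal_eq: "arrow_ideal G = (long_ideal 1 :: (_ \<Rightarrow> 'k::field) set)"
proof -
  let ?P = "path_algebra G :: ('k, _) module"
  let ?S = "(\<lambda>e. path_vec (tail G e, [e], head G e)) ` arcs G :: (_ \<Rightarrow> 'k) set"
  interpret P: ring ?P by (rule path_algebra_ring)
  have arrow: "(tail G e, [e], head G e) \<in> qpaths G" if "e \<in> arcs G" for e
    using that by (auto simp: qpaths_iff intro: arc_implies_awalk)
  have S: "?S \<subseteq> long_ideal 1"
    using scaled_path_vec_in_long_ideal[OF arrow, of _ 1 1] by (auto simp: qlen_def)
  also have "\<dots> \<subseteq> carrier ?P" by (auto simp: long_ideal_def)
  finally have Sc: "?S \<subseteq> carrier ?P" .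
  interpret I: ideal "arrow_ideal G" ?P
    unfolding arrow_ideal_def by (rule P.genideal_ideal[OF Sc])
  show ?thesis
  proof
    show "arrow_ideal G \<subseteq> (long_ideal 1 :: (_ \<Rightarrow> 'k) set)"
      unfolding arrow_ideal_def by (rule P.genideal_minimal[OF long_ideal_ideal S])
    show "long_ideal 1 \<subseteq> (arrow_ideal G :: (_ \<Rightarrow> 'k) set)"
    proof
      fix f :: "_ \<Rightarrow> 'k" assume f: "f \<in> long_ideal 1"
      show "f \<in> arrow_ideal G"
      proof (rule qpath_finite_support_induct)
        show "finite {p. f p \<noteq> 0}" using f by (simp add: long_ideal_def path_algebra_simps)
        show "(0 :: _ \<Rightarrow> 'k) \<in> arrow_ideal G" using I.zero_closed by (simp add: path_algebra_simps)
        show "g + h \<in> arrow_ideal G" if "g \<in> arrow_ideal G" "h \<in> arrow_ideal G" for g h :: "_ \<Rightarrow> 'k"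
          using I.a_closed[OF that] by (simp add: path_algebra_simps)
        fix p and c :: 'k assume "f p \<noteq> 0"
        then have p: "p \<in> qpaths G" "1 \<le> qlen p" using f by (auto simp: long_ideal_def path_algebra_simps)
        then obtain e es v where pe: "p = (tail G e, e # es, v)" "e \<in> arcs G" "awalk (head G e) es v"
          by (cases p; cases "fst (snd p)") (auto simp: qlen_def qpaths_iff awalk_Cons_iff)
        let ?q = "(head G e, es, v)"
        have q: "?q \<in> qpaths G" using pe by (simp add: qpaths_iff)
        have "conv (path_vec (tail G e, [e], head G e)) (\<lambda>r. c * path_vec ?q r) = (\<lambda>r. c * path_vec p r)"
          using pe(1) by (simp add: conv_path_vec[OF arrow[OF pe(2)] q] conv_smult_right pcomp_def)
        moreover have "path_vec (tail G e, [e], head G e) \<in> (arrow_ideal G :: (_ \<Rightarrow> 'k) set)"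
          unfolding arrow_ideal_def using P.genideal_self[OF Sc] pe by blast
        moreover have "(\<lambda>r. c * path_vec ?q r) \<in> carrier ?P"
          using scaled_path_vec_in_long_ideal[OF q, of 0 c] by (simp add: long_ideal_def)
        ultimately show "(\<lambda>r. c * path_vec p r) \<in> arrow_ideal G"
          using I.I_r_closed by (metis path_algebra_simps(2))
      qed
    qed
  qed
qed

text \<open>
  A path of length greater than \<open>N\<close> splits after its first \<open>N\<close> arrows.
\<close>

lemma ideal_power_eq: "ideal_power (path_algebra G) (arrow_ideal G) N = (long_ideal N :: (_ \<Rightarrow> 'k::field) set)"
proof (induction N)
  case 0
  then show ?case by (simp add: long_ideal_def)
next
  case (Suc N)
  let ?P = "path_algebra G :: ('k, _) module"
  let ?I = "ideal_prod ?P (long_ideal N) (long_ideal 1)"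
  interpret P: ring ?P by (rule path_algebra_ring)
  interpret L: ideal "long_ideal (Suc N)" ?P by (rule long_ideal_ideal)
  interpret I: ideal ?I ?P
    by (rule P.ideal_prod_is_ideal[OF long_ideal_ideal long_ideal_ideal])
  have "?I = long_ideal (Suc N)"
  proof
    show "?I \<subseteq> long_ideal (Suc N)"
    proof
      fix f assume "f \<in> ?I"
      then show "f \<in> long_ideal (Suc N)"
      proof (induction rule: ideal_prod.induct)
        case (prod f g)
        then have fg: "f \<in> carrier ?P" "g \<in> carrier ?P"
          and len: "\<And>p. f p \<noteq> 0 \<Longrightarrow> N \<le> qlen p" "\<And>q. g q \<noteq> 0 \<Longrightarrow> 1 \<le> qlen q"
          unfolding long_ideal_def by blast+
        have "conv f g \<in> carrier ?P" using P.m_closed[OF fg] by (simp add: path_algebra_simps(2))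
        moreover have "Suc N \<le> qlen r" if r: "conv f g r \<noteq> 0" for r
        proof -
          obtain p q where "(p, q) \<in> factorizations r" "f p \<noteq> 0" "g q \<noteq> 0"
            using conv_nonzero[OF r] by blast
          then show ?thesis using len(1)[of p] len(2)[of q] by (simp add: factorizations_iff)
        qed
        ultimately show ?case unfolding long_ideal_def path_algebra_simps(2) by blast
      next
        case (sum f g)
        then show ?case by (intro L.a_closed)
      qed
    qed
    show "long_ideal (Suc N) \<subseteq> ?I"
    proof
      fix f :: "_ \<Rightarrow> 'k" assume f: "f \<in> long_ideal (Suc N)"
      show "f \<in> ?I"
      proof (rule qpath_finite_support_induct)
        show "finite {p. f p \<noteq> 0}" using f by (simp add: long_ideal_def path_algebra_simps)
        show "0 \<in> ?I" using I.zero_closed by (simp add: path_algebra_simps)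
        show "g + h \<in> ?I" if "g \<in> ?I" "h \<in> ?I" for g h :: "_ \<Rightarrow> 'k"
          using I.a_closed[OF that] by (simp add: path_algebra_simps)
        fix p and c :: 'k assume "f p \<noteq> 0"
        then have p: "p \<in> qpaths G" "Suc N \<le> qlen p" using f by (auto simp: long_ideal_def path_algebra_simps)
        obtain u es v where uev: "p = (u, es, v)" by (cases p)
        define w where "w = awlast u (take N es)"
        have "awalk u (take N es @ drop N es) v" using p uev by (simp add: qpaths_iff)
        then have "awalk u (take N es) w" "awalk w (drop N es) v"
          unfolding w_def awalk_append_iff by auto
        then have q: "(u, take N es, w) \<in> qpaths G" "(w, drop N es, v) \<in> qpaths G"
          by (simp_all add: qpaths_iff)
        have "conv (path_vec (u, take N es, w)) (\<lambda>r. c * path_vec (w, drop N es, v) r) = (\<lambda>r. c * path_vec p r)"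
          using uev by (simp add: conv_path_vec[OF q] conv_smult_right pcomp_def)
        moreover have "path_vec (u, take N es, w) \<in> (long_ideal N :: (_ \<Rightarrow> 'k) set)"
          using scaled_path_vec_in_long_ideal[OF q(1), of N 1] p uev by (simp add: qlen_def)
        moreover have "(\<lambda>r. c * path_vec (w, drop N es, v) r) \<in> (long_ideal 1 :: (_ \<Rightarrow> 'k) set)"
          using scaled_path_vec_in_long_ideal[OF q(2), of 1 c] p uev by (simp add: qlen_def)
        ultimately show "(\<lambda>r. c * path_vec p r) \<in> ?I"
          using ideal_prod.prod by (metis path_algebra_simps(2))
      qed
    qed
  qed
  then show ?case using Suc by (simp add: arrow_ideal_eq)
qed

lemma finite_short_paths [simp]: "finite (short_paths N)"
proof -
  have "short_paths N \<subseteq> verts G \<times> {es. set es \<subseteq> arcs G \<and> length es \<le> N} \<times> verts G"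
    by (auto simp: short_paths_def qpaths_iff qlen_def awalk_def) (metis awalkI_apath awalk_def awalk_last_in_verts)
  then show ?thesis by (rule finite_subset) (simp add: finite_lists_length_le)
qed

lemma coset_eq:
  assumes "f \<in> carrier (path_algebra G :: ('k::field, _) module)"
  shows "long_ideal N +>\<^bsub>path_algebra G\<^esub> f = {g \<in> carrier (path_algebra G). trunc N g = trunc N f}"
proof -
  let ?P = "path_algebra G :: ('k, _) module"
  interpret P: ring ?P by (rule path_algebra_ring)
  interpret I: ideal "long_ideal N" ?P by (rule long_ideal_ideal)
  have "g \<in> long_ideal N +>\<^bsub>?P\<^esub> f" if "g \<in> carrier ?P" "trunc N g = trunc N f" for g
  proof -
    obtain d where d: "d \<in> carrier ?P" "g = d + f"
    proof
      show "g \<ominus>\<^bsub>?P\<^esub> f \<in> carrier ?P" using \<open>g \<in> carrier ?P\<close> assms by simp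
      have "g = (g \<ominus>\<^bsub>?P\<^esub> f) \<oplus>\<^bsub>?P\<^esub> f"
        using \<open>g \<in> carrier ?P\<close> assms by (simp add: P.minus_eq P.a_assoc P.l_neg)
      then show "g = (g \<ominus>\<^bsub>?P\<^esub> f) + f" by (simp only: path_algebra_simps(3))
    qed
    have "d p = 0" if "\<not> N \<le> qlen p" for p
      using fun_cong[OF \<open>trunc N g = trunc N f\<close>, of p] d(2) that by simp
    then have "d \<in> long_ideal N" unfolding long_ideal_def using d(1) by blast
    then show ?thesis unfolding a_r_coset_def' path_algebra_simps(3) using d(2) by blast
  qed
  moreover have "g \<in> carrier ?P \<and> trunc N g = trunc N f" if g: "g \<in> long_ideal N +>\<^bsub>?P\<^esub> f" for g
  proof -
    obtain h where h: "h \<in> long_ideal N" "g = h + f"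
      using g by (auto simp: a_r_coset_def' path_algebra_simps(3))
    then have hc: "h \<in> carrier ?P" and "\<And>p. h p \<noteq> 0 \<Longrightarrow> N \<le> qlen p"
      unfolding long_ideal_def by blast+
    then have "h p = 0" if "qlen p < N" for p using that leD by blast
    then have "trunc N g = trunc N f" using h(2) by (simp add: fun_eq_iff)
    moreover have "g \<in> carrier ?P" using P.a_closed[OF hc assms] h(2) by (simp only: path_algebra_simps(3))
    ultimately show ?thesis by blast
  qed
  ultimately show ?thesis by blast
qed

lemma coords_coset:
  assumes "f \<in> carrier (path_algebra G :: ('k::field, _) module)"
  shows "coords N (long_ideal N +>\<^bsub>path_algebra G\<^esub> f) = trunc N f"
proof -
  have "f \<in> long_ideal N +>\<^bsub>path_algebra G\<^esub> f" using assms by (simp add: coset_eq)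
  then have "(SOME g. g \<in> long_ideal N +>\<^bsub>path_algebra G\<^esub> f) \<in> long_ideal N +>\<^bsub>path_algebra G\<^esub> f"
    by (rule someI[of "\<lambda>g. g \<in> long_ideal N +>\<^bsub>path_algebra G\<^esub> f"])
  moreover have "trunc N g = trunc N f" if "g \<in> long_ideal N +>\<^bsub>path_algebra G\<^esub> f" for g
    using that unfolding coset_eq[OF assms] by blast
  ultimately show ?thesis unfolding coords_def by blast
qed

lemma trunc_conv_trunc: "trunc N (conv (trunc N f) (trunc N g)) = trunc N (conv f g)"
proof
  fix r :: "('a, 'b) qpath"
  have "conv (trunc N f) (trunc N g) r = conv f g r" if "qlen r < N"
    unfolding conv_def by (rule sum.cong) (use that in \<open>auto simp: factorizations_iff\<close>)
  then show "trunc N (conv (trunc N f) (trunc N g)) r = trunc N (conv f g) r" by simp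
qed

lemma tconv_assoc: "tconv N (tconv N f g) h = tconv N f (tconv N g h)"
proof -
  have "tconv N (tconv N f g) h = trunc N (conv (trunc N (trunc N (conv f g))) (trunc N h))"
    unfolding tconv_def by (rule trunc_conv_trunc[symmetric])
  also have "trunc N (trunc N (conv f g)) = trunc N (conv f g)" by auto
  also have "trunc N (conv (trunc N (conv f g)) (trunc N h)) = trunc N (conv (conv f g) h)"
    by (rule trunc_conv_trunc)
  also have "\<dots> = trunc N (conv f (conv g h))" by (subst conv_assoc) (rule refl)
  also have "\<dots> = trunc N (conv (trunc N f) (trunc N (conv g h)))"
    by (rule trunc_conv_trunc[symmetric])
  also have "\<dots> = trunc N (conv (trunc N f) (trunc N (trunc N (conv g h))))"
    by (rule arg_cong[where f="\<lambda>x. trunc N (conv (trunc N f) x)"]) auto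
  also have "\<dots> = tconv N f (tconv N g h)"
    unfolding tconv_def by (rule trunc_conv_trunc)
  finally show ?thesis .
qed

lemma tconv_add_left: "tconv N (f + g) h = tconv N f h + tconv N g h"
  and tconv_add_right: "tconv N f (g + h) = tconv N f g + tconv N f h"
  by (auto simp: tconv_def conv_add_left conv_add_right fun_eq_iff)

lemma tconv_smult_left: "tconv N (\<lambda>r. c * f r) g = (\<lambda>r. c * tconv N f g r)"
  and tconv_smult_right: "tconv N f (\<lambda>r. c * g r) = (\<lambda>r. c * tconv N f g r)"
  by (auto simp: tconv_def conv_smult_left conv_smult_right fun_eq_iff)

lemma tconv_path_vec:
  assumes "p \<in> qpaths G" "q \<in> qpaths G"
  shows "tconv N (path_vec p) (path_vec q)
    = (if snd (snd p) = fst q \<and> qlen p + qlen q < N then path_vec (pcomp p q) else 0)"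
  using assms by (auto simp: tconv_def conv_path_vec fun_eq_iff) (auto simp: path_vec_def)

text \<open>
  The quotient is the algebra with the paths of length less than \<open>N\<close> as a basis, multiplied by
  truncated concatenation. From here on cosets enter only through these facts.
\<close>

lemma truncated_quiver_algebra_coords:
  fixes A :: "('k::field, _) module"
  assumes A_eq: "A = truncated_quiver_algebra G N"
  shows "abelian_group A"
    and "x \<in> carrier A \<Longrightarrow> y \<in> carrier A \<Longrightarrow> x \<otimes>\<^bsub>A\<^esub> y \<in> carrier A"
    and "x \<in> carrier A \<Longrightarrow> c \<odot>\<^bsub>A\<^esub> x \<in> carrier A"
    and "bij_betw (coords N) (carrier A) {g. \<forall>p. p \<notin> short_paths N \<longrightarrow> g p = 0}"
    and "x \<in> carrier A \<Longrightarrow> y \<in> carrier A \<Longrightarrow> coords N (x \<oplus>\<^bsub>A\<^esub> y) = coords N x + coords N y"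
    and "x \<in> carrier A \<Longrightarrow> y \<in> carrier A \<Longrightarrow> coords N (x \<otimes>\<^bsub>A\<^esub> y) = tconv N (coords N x) (coords N y)"
    and "x \<in> carrier A \<Longrightarrow> coords N (c \<odot>\<^bsub>A\<^esub> x) = (\<lambda>p. c * coords N x p)"
proof -
  let ?P = "path_algebra G :: ('k, _) module"
  let ?J = "long_ideal N :: (_ \<Rightarrow> 'k) set"
  interpret P: ring ?P by (rule path_algebra_ring)
  interpret I: ideal ?J ?P by (rule long_ideal_ideal)
  interpret Q: ring "?P Quot ?J" by (rule I.quotient_is_ring)
  have A: "A = quotient_algebra ?P ?J"
    by (simp add: A_eq truncated_quiver_algebra_def ideal_power_eq)
  have carA: "carrier A = (\<lambda>f. ?J +>\<^bsub>?P\<^esub> f) ` carrier ?P"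
    by (auto simp: A quotient_algebra_def FactRing_def A_RCOSETS_def')
  have carQ: "carrier A = carrier (?P Quot ?J)" and addQ: "add A = add (?P Quot ?J)"
    and zeroQ: "\<zero>\<^bsub>A\<^esub> = \<zero>\<^bsub>?P Quot ?J\<^esub>" and mulQ: "monoid.mult A = monoid.mult (?P Quot ?J)"
    by (simp_all add: A quotient_algebra_def)
  show "abelian_group A"
  proof (rule abelian_groupI, unfold carQ addQ zeroQ)
    fix x assume "x \<in> carrier (?P Quot ?J)"
    then show "\<exists>y\<in>carrier (?P Quot ?J). y \<oplus>\<^bsub>?P Quot ?J\<^esub> x = \<zero>\<^bsub>?P Quot ?J\<^esub>"
      by (intro bexI[of _ "\<ominus>\<^bsub>?P Quot ?J\<^esub> x"]) (simp_all add: Q.l_neg)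
  qed (simp_all add: Q.a_ac)
  have smc: "(\<lambda>r. c * f r) \<in> carrier ?P" if "f \<in> carrier ?P" for f c
  proof -
    have sub: "{r. c * f r \<noteq> 0} \<subseteq> {r. f r \<noteq> 0}" by auto
    then show ?thesis using that finite_subset[OF sub] by (auto simp: path_algebra_simps)
  qed
  have addP: "(?J +>\<^bsub>?P\<^esub> f) \<oplus>\<^bsub>A\<^esub> (?J +>\<^bsub>?P\<^esub> g) = ?J +>\<^bsub>?P\<^esub> (f + g)"
    if "f \<in> carrier ?P" "g \<in> carrier ?P" for f g
    using I.a_rcos_sum[OF that] by (simp add: addQ FactRing_def path_algebra_simps(3))
  have mulP: "(?J +>\<^bsub>?P\<^esub> f) \<otimes>\<^bsub>A\<^esub> (?J +>\<^bsub>?P\<^esub> g) = ?J +>\<^bsub>?P\<^esub> (conv f g)"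
    if "f \<in> carrier ?P" "g \<in> carrier ?P" for f g
    using I.rcoset_mult_add[OF that] by (simp add: mulQ FactRing_def path_algebra_simps(2))
  have smP: "c \<odot>\<^bsub>A\<^esub> (?J +>\<^bsub>?P\<^esub> f) = ?J +>\<^bsub>?P\<^esub> (\<lambda>r. c * f r)"
    if f: "f \<in> carrier ?P" for f c
  proof -
    have "?J +>\<^bsub>?P\<^esub> (c \<odot>\<^bsub>?P\<^esub> g) = ?J +>\<^bsub>?P\<^esub> (\<lambda>r. c * f r)" if "g \<in> ?J +>\<^bsub>?P\<^esub> f" for g
    proof -
      have g: "g \<in> carrier ?P" "trunc N g = trunc N f" using that f by (auto simp: coset_eq)
      have "g p = f p" if "qlen p < N" for p using fun_cong[OF g(2), of p] that by simp
      then have "trunc N (\<lambda>r. c * g r) = trunc N (\<lambda>r. c * f r)"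
        by (simp add: fun_eq_iff)
      then show ?thesis using g f smc by (simp add: path_algebra_simps(6) coset_eq)
    qed
    moreover have "f \<in> ?J +>\<^bsub>?P\<^esub> f" using f by (simp add: coset_eq)
    ultimately show ?thesis by (auto simp: A quotient_algebra_def)
  qed
  have addc: "f + g \<in> carrier ?P" if "f \<in> carrier ?P" "g \<in> carrier ?P" for f g
    using P.a_closed[OF that] by (simp add: path_algebra_simps(3))
  have mulc: "conv f g \<in> carrier ?P" if "f \<in> carrier ?P" "g \<in> carrier ?P" for f g
    using P.m_closed[OF that] by (simp add: path_algebra_simps(2))
  show "x \<otimes>\<^bsub>A\<^esub> y \<in> carrier A" if "x \<in> carrier A" "y \<in> carrier A"
    using that by (auto simp: carQ mulQ)
  show "c \<odot>\<^bsub>A\<^esub> x \<in> carrier A" if "x \<in> carrier A"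
    using that smc by (auto simp: carA smP)
  show "coords N (x \<oplus>\<^bsub>A\<^esub> y) = coords N x + coords N y" if "x \<in> carrier A" "y \<in> carrier A"
    using that addc by (auto simp: carA addP coords_coset fun_eq_iff)
  show "coords N (x \<otimes>\<^bsub>A\<^esub> y) = tconv N (coords N x) (coords N y)" if xy: "x \<in> carrier A" "y \<in> carrier A"
  proof -
    obtain f g where fg: "f \<in> carrier ?P" "g \<in> carrier ?P" "x = ?J +>\<^bsub>?P\<^esub> f" "y = ?J +>\<^bsub>?P\<^esub> g"
      using xy unfolding carA by blast
    have "coords N (x \<otimes>\<^bsub>A\<^esub> y) = trunc N (conv f g)"
      by (simp only: fg(3,4) mulP[OF fg(1,2)] coords_coset[OF mulc[OF fg(1,2)]])
    also have "\<dots> = trunc N (conv (trunc N f) (trunc N g))" by (rule trunc_conv_trunc[symmetric])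
    also have "\<dots> = tconv N (coords N x) (coords N y)"
      by (simp only: tconv_def fg(3,4) coords_coset[OF fg(1)] coords_coset[OF fg(2)])
    finally show ?thesis .
  qed
  show "coords N (c \<odot>\<^bsub>A\<^esub> x) = (\<lambda>p. c * coords N x p)" if "x \<in> carrier A"
    using that smc by (auto simp: carA smP coords_coset fun_eq_iff)
  show "bij_betw (coords N) (carrier A) {g. \<forall>p. p \<notin> short_paths N \<longrightarrow> g p = 0}"
  proof (rule bij_betw_imageI)
    show "inj_on (coords N) (carrier A)"
      by (auto simp: inj_on_def carA coords_coset) (simp_all add: coset_eq)
    have "g \<in> carrier ?P" "trunc N g = g" if "\<And>p. p \<notin> short_paths N \<Longrightarrow> g p = 0" for g
    proof -
      have sub: "{p. g p \<noteq> 0} \<subseteq> short_paths N" using that by blast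
      have "finite {p. g p \<noteq> 0}" by (rule finite_subset[OF sub finite_short_paths])
      then show "g \<in> carrier ?P" using sub by (auto simp: path_algebra_simps(1) short_paths_def)
      show "trunc N g = g" using that by (auto simp: fun_eq_iff short_paths_def)
    qed
    then have "g \<in> coords N ` carrier A" if "\<And>p. p \<notin> short_paths N \<Longrightarrow> g p = 0" for g
      using that coords_coset[of g N] by (auto simp: carA image_image intro!: image_eqI[of _ _ g])
    moreover have "coords N x p = 0" if "x \<in> carrier A" "p \<notin> short_paths N" for x p
      using that by (auto simp: carA coords_coset path_algebra_simps(1) short_paths_def)
    ultimately show "coords N ` carrier A = {g. \<forall>p. p \<notin> short_paths N \<longrightarrow> g p = 0}" by blast
  qed
qed

end

section \<open>Multilinear maps on an algebra with a finite basis\<close>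

lemma tuples_0 [simp]: "tuples A 0 = {[]}"
  by (auto simp: tuples_def)

lemma tuples_Suc: "xs \<in> tuples A (Suc n) \<longleftrightarrow> (\<exists>x ys. xs = x # ys \<and> x \<in> carrier A \<and> ys \<in> tuples A n)"
  by (cases xs) (auto simp: tuples_def)

lemma Cons_in_tuples [simp]: "x # ys \<in> tuples A (Suc n) \<longleftrightarrow> x \<in> carrier A \<and> ys \<in> tuples A n"
  by (auto simp: tuples_def)

lemma tuples_take_drop:
  "xs \<in> tuples A (m + n) \<Longrightarrow> take m xs \<in> tuples A m \<and> drop m xs \<in> tuples A n"
  by (auto simp: tuples_def dest: in_set_takeD in_set_dropD)

definition scale :: "'k::field \<Rightarrow> ('b \<Rightarrow> 'k) \<Rightarrow> 'b \<Rightarrow> 'k" where "scale c f = (\<lambda>p. c * f p)"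

lemma scale_simps [simp]: "scale 0 f = 0" "scale c 0 = 0" "scale 1 f = f" "scale (- c) f = - scale c f"
  "scale c (- f) = - scale c f"
  by (auto simp: scale_def)
lemma scale_add: "scale c (f + g) = scale c f + scale c g" "scale (c + d) f = scale c f + scale d f"
  by (auto simp: scale_def fun_eq_iff algebra_simps)
lemma scale_scale: "scale c (scale d f) = scale (c * d) f"
  by (auto simp: scale_def fun_eq_iff algebra_simps)
lemma scale_diff: "scale c (f - g) = scale c f - scale c g"
  by (auto simp: scale_def fun_eq_iff algebra_simps)
lemma sum_fun_apply: "(\<Sum>i\<in>I. f i) x = (\<Sum>i\<in>I. f i x)"
  by (induction I rule: infinite_finite_induct) simp_all
lemma scale_sum: "scale c (\<Sum>i\<in>I. f i) = (\<Sum>i\<in>I. scale c (f i))"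
  by (simp add: scale_def fun_eq_iff sum_fun_apply sum_distrib_left)

text \<open>
  An algebra with a finite basis \<open>B\<close>, given by a coordinate map \<open>\<psi>\<close>. The product \<open>\<star>\<close> of coordinate
  functions is associative and bilinear on all functions, so that no closure conditions arise on the
  side of the values.
\<close>

locale coordinate_algebra =
  fixes A :: "('k::field, 'a) module" (structure)
    and \<psi> :: "'a \<Rightarrow> 'b \<Rightarrow> 'k" and mul :: "('b \<Rightarrow> 'k) \<Rightarrow> ('b \<Rightarrow> 'k) \<Rightarrow> 'b \<Rightarrow> 'k" (infixl "\<star>" 70)
    and B :: "'b set"
  assumes abelian: "abelian_group A"
    and mult_closed: "x \<in> carrier A \<Longrightarrow> y \<in> carrier A \<Longrightarrow> x \<otimes> y \<in> carrier A"
    and smult_closed: "x \<in> carrier A \<Longrightarrow> k \<odot> x \<in> carrier A"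
    and finite_B: "finite B"
    and \<psi>_bij: "bij_betw \<psi> (carrier A) {g. \<forall>b. b \<notin> B \<longrightarrow> g b = 0}"
    and \<psi>_add: "x \<in> carrier A \<Longrightarrow> y \<in> carrier A \<Longrightarrow> \<psi> (x \<oplus> y) = \<psi> x + \<psi> y"
    and \<psi>_mult: "x \<in> carrier A \<Longrightarrow> y \<in> carrier A \<Longrightarrow> \<psi> (x \<otimes> y) = \<psi> x \<star> \<psi> y"
    and \<psi>_smult: "x \<in> carrier A \<Longrightarrow> \<psi> (k \<odot> x) = scale k (\<psi> x)"
    and add_left: "(a + b) \<star> c = a \<star> c + b \<star> c"
    and add_right: "a \<star> (b + c) = a \<star> b + a \<star> c"
    and assoc: "a \<star> b \<star> c = a \<star> (b \<star> c)"
    and scale_left: "scale k a \<star> b = scale k (a \<star> b)"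
    and scale_right: "a \<star> scale k b = scale k (a \<star> b)"
begin

sublocale abelian_group A by (rule abelian)

lemma \<psi>_inj: "x \<in> carrier A \<Longrightarrow> y \<in> carrier A \<Longrightarrow> \<psi> x = \<psi> y \<Longrightarrow> x = y"
  using \<psi>_bij by (auto simp: bij_betw_def inj_on_def)

sublocale bar_complex "carrier A" "(\<otimes>)" \<psi> mul
  by unfold_locales (auto intro: add_left add_right assoc mult_closed \<psi>_mult intro!: \<psi>_inj simp: mult_closed \<psi>_mult assoc)

definition supported :: "('b \<Rightarrow> 'k) \<Rightarrow> bool" where "supported g \<longleftrightarrow> (\<forall>b. b \<notin> B \<longrightarrow> g b = 0)"

lemma supported_\<psi>: "x \<in> carrier A \<Longrightarrow> supported (\<psi> x)"
  using \<psi>_bij by (auto simp: bij_betw_def supported_def)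

definition of_coords :: "('b \<Rightarrow> 'k) \<Rightarrow> 'a" where "of_coords g = inv_into (carrier A) \<psi> g"

lemma of_coords: assumes "supported g" shows "of_coords g \<in> carrier A" "\<psi> (of_coords g) = g"
proof -
  have "g \<in> \<psi> ` carrier A" using \<psi>_bij assms by (auto simp: bij_betw_def supported_def)
  then show "of_coords g \<in> carrier A" "\<psi> (of_coords g) = g" by (auto simp: of_coords_def inv_into_into f_inv_into_f)
qed

lemma of_coords_\<psi>: "x \<in> carrier A \<Longrightarrow> of_coords (\<psi> x) = x"
  using of_coords[OF supported_\<psi>] \<psi>_inj by metis

lemma \<psi>_zero [simp]: "\<psi> \<zero> = 0"
  using \<psi>_add[of \<zero> \<zero>] by simp

lemma \<psi>_finsum:
  "finite I \<Longrightarrow> (\<And>i. i \<in> I \<Longrightarrow> f i \<in> carrier A) \<Longrightarrow> \<psi> (\<Oplus>i\<in>I. f i) = (\<Sum>i\<in>I. \<psi> (f i))"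
  by (induction I rule: finite_induct) (auto simp: \<psi>_add finsum_insert Pi_def)

lemma supported_add: "supported f \<Longrightarrow> supported g \<Longrightarrow> supported (f + g)"
  and supported_scale: "supported f \<Longrightarrow> supported (scale c f)"
  and supported_minus: "supported f \<Longrightarrow> supported (- f)"
  and supported_zero [simp]: "supported 0"
  by (auto simp: supported_def scale_def)

lemma supported_mul: "supported f \<Longrightarrow> supported g \<Longrightarrow> supported (f \<star> g)"
  using supported_\<psi>[OF mult_closed[OF of_coords(1) of_coords(1)], of f g] by (simp add: \<psi>_mult of_coords)

lemma supported_sum: "(\<And>i. i \<in> I \<Longrightarrow> supported (f i)) \<Longrightarrow> supported (\<Sum>i\<in>I. f i)"
  by (induction I rule: infinite_finite_induct) (auto intro: supported_add)

definition lin :: "('a \<Rightarrow> 'b \<Rightarrow> 'k) \<Rightarrow> bool" where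
  "lin h \<longleftrightarrow> (\<forall>x\<in>carrier A. \<forall>y\<in>carrier A. h (x \<oplus> y) = h x + h y) \<and>
             (\<forall>x\<in>carrier A. \<forall>c. h (c \<odot> x) = scale c (h x))"

lemma lin_cong: "(\<And>x. x \<in> carrier A \<Longrightarrow> h x = h' x) \<Longrightarrow> lin h \<longleftrightarrow> lin h'"
  by (auto simp: lin_def smult_closed)

lemma lin_add: "lin h \<Longrightarrow> lin h' \<Longrightarrow> lin (\<lambda>x. h x + h' x)"
  and lin_minus: "lin h \<Longrightarrow> lin (\<lambda>x. - h x)"
  and lin_diff: "lin h \<Longrightarrow> lin h' \<Longrightarrow> lin (\<lambda>x. h x - h' x)"
  by (auto simp: lin_def scale_add scale_diff)

lemma lin_mul: "lin h \<Longrightarrow> lin (\<lambda>x. h x \<star> a)" "lin h \<Longrightarrow> lin (\<lambda>x. a \<star> h x)"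
  by (auto simp: lin_def mul_simps scale_left scale_right)

lemma lin_\<psi>: "lin \<psi>"
  by (auto simp: lin_def \<psi>_add \<psi>_smult)

text \<open>
  Linearity in the first argument and multilinearity in the others, a form adapted to the recursion
  for \<open>bar\<close>; \<open>multilinear_iff_index\<close> relates it to linearity in each position.
\<close>

primrec multilinear :: "nat \<Rightarrow> ('a list \<Rightarrow> 'b \<Rightarrow> 'k) \<Rightarrow> bool" where
  "multilinear 0 F \<longleftrightarrow> True"
| "multilinear (Suc n) F \<longleftrightarrow> (\<forall>x\<in>carrier A. multilinear n (\<lambda>zs. F (x # zs))) \<and>
     (\<forall>zs\<in>tuples A n. lin (\<lambda>x. F (x # zs)))"

lemma multilinear_cong:
  "(\<And>xs. xs \<in> tuples A n \<Longrightarrow> F xs = G xs) \<Longrightarrow> multilinear n F \<longleftrightarrow> multilinear n G"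
proof (induction n arbitrary: F G)
  case (Suc n)
  have "multilinear n (\<lambda>zs. F (x # zs)) \<longleftrightarrow> multilinear n (\<lambda>zs. G (x # zs))" if "x \<in> carrier A" for x
    by (rule Suc.IH) (use that Suc.prems in auto)
  moreover have "lin (\<lambda>x. F (x # zs)) \<longleftrightarrow> lin (\<lambda>x. G (x # zs))" if "zs \<in> tuples A n" for zs
    by (rule lin_cong) (use that Suc.prems in auto)
  ultimately show ?case by auto
qed simp

lemma multilinear_add: "multilinear n F \<Longrightarrow> multilinear n G \<Longrightarrow> multilinear n (\<lambda>xs. F xs + G xs)"
  by (induction n arbitrary: F G) (auto intro: lin_add)
lemma multilinear_minus: "multilinear n F \<Longrightarrow> multilinear n (\<lambda>xs. - F xs)"
  by (induction n arbitrary: F) (auto intro: lin_minus)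
lemma multilinear_diff: "multilinear n F \<Longrightarrow> multilinear n G \<Longrightarrow> multilinear n (\<lambda>xs. F xs - G xs)"
  by (induction n arbitrary: F G) (auto intro: lin_diff)
lemma multilinear_zero: "multilinear n (\<lambda>xs. 0)"
  by (induction n) (auto simp: lin_def fun_eq_iff scale_def)
lemma multilinear_mul:
  "multilinear n F \<Longrightarrow> multilinear n (\<lambda>xs. F xs \<star> a)" "multilinear n F \<Longrightarrow> multilinear n (\<lambda>xs. a \<star> F xs)"
  by (induction n arbitrary: F) (auto intro: lin_mul)

lemma distrib_A:
  assumes "x \<in> carrier A" "y \<in> carrier A" "z \<in> carrier A"
  shows "x \<otimes> (y \<oplus> z) = x \<otimes> y \<oplus> x \<otimes> z" "(y \<oplus> z) \<otimes> x = y \<otimes> x \<oplus> z \<otimes> x"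
    "x \<otimes> (c \<odot> y) = c \<odot> (x \<otimes> y)" "(c \<odot> y) \<otimes> x = c \<odot> (y \<otimes> x)"
  using assms by (auto intro!: \<psi>_inj simp: mult_closed smult_closed \<psi>_mult \<psi>_add \<psi>_smult mul_simps scale_left scale_right)

lemma multilinear_bar: "multilinear n F \<Longrightarrow> multilinear (Suc n) (\<lambda>xs. bar xs F)"
proof (induction n arbitrary: F)
  case 0
  show ?case by (simp add: lin_minus lin_mul lin_\<psi>)
next
  case (Suc n)
  have "multilinear (Suc n) (\<lambda>zs. bar (x # zs) F)" if x: "x \<in> carrier A" for x
  proof -
    have "multilinear (Suc n) (\<lambda>zs. F (x \<otimes> hd zs # tl zs))"
      using Suc.prems x by (auto simp: mult_closed lin_def distrib_A)
    moreover have "multilinear (Suc n) (\<lambda>zs. bar zs (\<lambda>zs. F (x # zs)))"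
      using Suc x by simp
    ultimately have "multilinear (Suc n) (\<lambda>zs. - F (x \<otimes> hd zs # tl zs) - bar zs (\<lambda>zs. F (x # zs)))"
      by (intro multilinear_diff multilinear_minus)
    then show ?thesis
      by (subst multilinear_cong) (auto simp: tuples_Suc)
  qed
  moreover have "lin (\<lambda>x. bar (x # zs) F)" if zs: "zs \<in> tuples A (Suc n)" for zs
  proof -
    obtain y r where yr: "zs = y # r" "y \<in> carrier A" "r \<in> tuples A n" using zs by (auto simp: tuples_Suc)
    have C: "bar zs (\<lambda>us. F ((x \<oplus> x') # us)) = bar zs (\<lambda>us. F (x # us) + F (x' # us))"
      if "x \<in> carrier A" "x' \<in> carrier A" for x x'
      by (rule bar_cong) (use Suc.prems that zs in \<open>auto simp: lin_def tuples_def\<close>)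
    have D: "bar zs (\<lambda>us. F (c \<odot> x # us)) = bar zs (\<lambda>us. scale c (F (x # us)))"
      if "x \<in> carrier A" for x c
      by (rule bar_cong) (use Suc.prems that zs in \<open>auto simp: lin_def tuples_def\<close>)
    have E: "bar zs (\<lambda>us. scale c (F (x # us))) = scale c (bar zs (\<lambda>us. F (x # us)))" for c x
      by (rule bar_map[of "scale c", symmetric]) (simp_all add: scale_add scale_left)
    have "lin (\<lambda>x. bar zs (\<lambda>us. F (x # us)))"
      by (simp add: lin_def C D E bar_add)
    moreover have "lin (\<lambda>x. F (x \<otimes> y # r))"
      using Suc.prems yr by (auto simp: lin_def mult_closed distrib_A)
    ultimately show ?thesis by (simp add: yr lin_diff lin_minus)
  qed
  ultimately show ?case by auto
qed

lemma multilinear_bdiff: "multilinear n F \<Longrightarrow> multilinear (Suc n) (diff F)"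
  unfolding diff_def[abs_def]
  by (rule multilinear_add) (auto intro: multilinear_bar multilinear_mul lin_mul lin_\<psi> simp del: multilinear.simps(2) simp: multilinear.simps(2)[of n "\<lambda>xs. \<psi> (hd xs) \<star> F (tl xs)"])

lemma multilinear_cup: "multilinear m F \<Longrightarrow> multilinear n G \<Longrightarrow> multilinear (m + n) (cup m F G)"
proof (induction m arbitrary: F)
  case 0
  then show ?case by (simp add: cup_def[abs_def] multilinear_mul)
next
  case (Suc m)
  have "cup (Suc m) F G (x # zs) = cup m (\<lambda>zs. F (x # zs)) G zs" for x zs
    by (simp add: cup_def)
  moreover have "lin (\<lambda>x. cup (Suc m) F G (x # zs))" if "zs \<in> tuples A (m + n)" for zs
    using Suc.prems tuples_take_drop[OF that] by (auto simp: cup_def intro: lin_mul)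
  ultimately show ?case using Suc by simp
qed

lemma lin_zero: "lin h \<Longrightarrow> h \<zero> = 0"
proof -
  assume h: "lin h"
  then have "h (\<zero> \<oplus> \<zero>) = h \<zero> + h \<zero>" unfolding lin_def by blast
  then show ?thesis by simp
qed

lemma multilinear_zero_arg:
  "multilinear n F \<Longrightarrow> xs \<in> tuples A n \<Longrightarrow> \<zero> \<in> set xs \<Longrightarrow> F xs = 0"
proof (induction n arbitrary: F xs)
  case (Suc n)
  from Suc.prems(2) obtain x ys where xs: "xs = x # ys" "x \<in> carrier A" "ys \<in> tuples A n"
    unfolding tuples_Suc by blast
  show ?case
  proof (cases "x = \<zero>")
    case True
    have "lin (\<lambda>x. F (x # ys))" using Suc.prems(1) xs(3) by simp
    from lin_zero[OF this] show ?thesis using True xs(1) by simp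
  next
    case False
    have "F (x # ys) = 0"
    proof (rule Suc.IH[of "\<lambda>zs. F (x # zs)" ys])
      show "multilinear n (\<lambda>zs. F (x # zs))" using Suc.prems(1) xs(2) by simp
      show "ys \<in> tuples A n" by (rule xs(3))
      show "\<zero> \<in> set ys" using Suc.prems(3) xs(1) False by simp
    qed
    then show ?thesis using xs(1) by simp
  qed
qed simp

lemma multilinear_iff_index:
  "multilinear n F \<longleftrightarrow> (\<forall>xs \<in> tuples A n. \<forall>i<n. \<forall>y \<in> carrier A. \<forall>c.
          F (xs[i := xs ! i \<oplus> y]) = F xs + F (xs[i := y]) \<and>
          F (xs[i := c \<odot> xs ! i]) = scale c (F xs))"
proof (induction n arbitrary: F)
  case (Suc n)
  let ?I = "\<lambda>n F. \<forall>xs \<in> tuples A n. \<forall>i<n. \<forall>y \<in> carrier A. \<forall>c.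
          F (xs[i := xs ! i \<oplus> y]) = F xs + F (xs[i := y]) \<and>
          F (xs[i := c \<odot> xs ! i]) = scale c (F xs)"
  have "?I (Suc n) F \<longleftrightarrow> (\<forall>x\<in>carrier A. ?I n (\<lambda>zs. F (x # zs))) \<and> (\<forall>zs\<in>tuples A n. lin (\<lambda>x. F (x # zs)))"
  proof
    assume I: "?I (Suc n) F"
    have "?I n (\<lambda>zs. F (x # zs))" if x: "x \<in> carrier A" for x
    proof (intro ballI allI impI)
      fix xs i y c assume "xs \<in> tuples A n" "i < n" "y \<in> carrier A"
      then show "F (x # xs[i := xs ! i \<oplus> y]) = F (x # xs) + F (x # xs[i := y]) \<and>
          F (x # xs[i := c \<odot> xs ! i]) = scale c (F (x # xs))"
        using I[rule_format, of "x # xs" "Suc i" y c] x by simp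
    qed
    moreover have "lin (\<lambda>x. F (x # zs))" if zs: "zs \<in> tuples A n" for zs
    proof -
      have "F ((x \<oplus> y) # zs) = F (x # zs) + F (y # zs) \<and> F (c \<odot> x # zs) = scale c (F (x # zs))"
        if "x \<in> carrier A" "y \<in> carrier A" for x y c
        using I[rule_format, of "x # zs" 0 y c] that zs by simp
      then show ?thesis unfolding lin_def by blast
    qed
    ultimately show "(\<forall>x\<in>carrier A. ?I n (\<lambda>zs. F (x # zs))) \<and> (\<forall>zs\<in>tuples A n. lin (\<lambda>x. F (x # zs)))"
      by blast
  next
    assume I: "(\<forall>x\<in>carrier A. ?I n (\<lambda>zs. F (x # zs))) \<and> (\<forall>zs\<in>tuples A n. lin (\<lambda>x. F (x # zs)))"
    show "?I (Suc n) F"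
    proof (rule ballI)
      fix xs assume "xs \<in> tuples A (Suc n)"
    then obtain x ys where xs: "xs = x # ys" "x \<in> carrier A" "ys \<in> tuples A n" by (auto simp: tuples_Suc)
    show "\<forall>i<Suc n. \<forall>y \<in> carrier A. \<forall>c.
          F (xs[i := xs ! i \<oplus> y]) = F xs + F (xs[i := y]) \<and>
          F (xs[i := c \<odot> xs ! i]) = scale c (F xs)"
    proof (intro allI impI ballI)
      fix i y c assume i: "i < Suc n" and y: "y \<in> carrier A"
      show "F (xs[i := xs ! i \<oplus> y]) = F xs + F (xs[i := y]) \<and> F (xs[i := c \<odot> xs ! i]) = scale c (F xs)"
      proof (cases i)
        case 0
        then show ?thesis using conjunct2[OF I, rule_format, OF xs(3)] xs y by (simp add: lin_def)
      next
        case (Suc j)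
        then show ?thesis using conjunct1[OF I, rule_format, OF xs(2,3), of j y c] xs y i by simp
      qed
    qed
    qed
  qed
  then show ?case by (simp only: multilinear.simps Suc.IH)
qed simp

definition basis_elem :: "'b \<Rightarrow> 'a" where "basis_elem b = of_coords (\<lambda>q. if q = b then 1 else 0)"

lemma basis_elem: "b \<in> B \<Longrightarrow> basis_elem b \<in> carrier A" "b \<in> B \<Longrightarrow> \<psi> (basis_elem b) = (\<lambda>q. if q = b then 1 else 0)"
  unfolding basis_elem_def by (intro of_coords; auto simp: supported_def)+

lemma basis_in_tuples: "set bs \<subseteq> B \<Longrightarrow> length bs = n \<Longrightarrow> map basis_elem bs \<in> tuples A n"
  by (auto simp: tuples_def basis_elem)

lemma lin_expand:
  assumes h: "lin h" and x: "x \<in> carrier A"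
  shows "h x = (\<Sum>b\<in>B. scale (\<psi> x b) (h (basis_elem b)))"
proof -
  have "h (of_coords (\<lambda>b. if b \<in> S then \<psi> x b else 0)) = (\<Sum>b\<in>S. scale (\<psi> x b) (h (basis_elem b)))"
    if "finite S" "S \<subseteq> B" for S
    using that
  proof (induction S rule: finite_induct)
    case empty
    have "of_coords (\<lambda>b. 0) = \<zero>" using of_coords_\<psi>[of \<zero>] by (simp add: zero_fun_def)
    then show ?case using lin_zero[OF h] by simp
  next
    case (insert b S)
    let ?y = "of_coords (\<lambda>b. if b \<in> S then \<psi> x b else 0)"
    have sup: "supported (\<lambda>b. if b \<in> S then \<psi> x b else 0)" "supported (\<lambda>c. if c \<in> insert b S then \<psi> x c else 0)"
      using insert by (auto simp: supported_def)
    have b: "b \<in> B" using insert by simp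
    have "of_coords (\<lambda>c. if c \<in> insert b S then \<psi> x c else 0) = (\<psi> x b \<odot> basis_elem b) \<oplus> ?y"
      by (rule \<psi>_inj)
         (use insert basis_elem[OF b] of_coords[OF sup(1)] of_coords[OF sup(2)] in \<open>auto simp: smult_closed \<psi>_add \<psi>_smult scale_def fun_eq_iff\<close>)
    then show ?case
      using insert h basis_elem[OF b] of_coords[OF sup(1)] by (simp add: lin_def smult_closed)
  qed
  from this[OF finite_B subset_refl]
  have "h (of_coords (\<lambda>b. if b \<in> B then \<psi> x b else 0)) = (\<Sum>b\<in>B. scale (\<psi> x b) (h (basis_elem b)))" .
  moreover have "(\<lambda>b. if b \<in> B then \<psi> x b else 0) = \<psi> x"
    using supported_\<psi>[OF x] by (auto simp: supported_def)
  ultimately show ?thesis by (simp add: of_coords_\<psi>[OF x])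
qed

lemma multilinear_eqI:
  assumes "multilinear n F" "multilinear n G"
    and "\<And>bs. length bs = n \<Longrightarrow> set bs \<subseteq> B \<Longrightarrow> F (map basis_elem bs) = G (map basis_elem bs)"
    and "xs \<in> tuples A n"
  shows "F xs = G xs"
  using assms
proof (induction n arbitrary: F G xs)
  case (Suc n)
  from Suc.prems(4) obtain x ys where xs: "xs = x # ys" "x \<in> carrier A" "ys \<in> tuples A n"
    unfolding tuples_Suc by blast
  have e: "F (basis_elem b # ys) = G (basis_elem b # ys)" if "b \<in> B" for b
  proof (rule Suc.IH[of "\<lambda>zs. F (basis_elem b # zs)" "\<lambda>zs. G (basis_elem b # zs)" ys])
    show "F (basis_elem b # map basis_elem bs) = G (basis_elem b # map basis_elem bs)" if "length bs = n" "set bs \<subseteq> B" for bs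
      using Suc.prems(3)[of "b # bs"] that \<open>b \<in> B\<close> by simp
  qed (use Suc.prems(1,2) that xs in \<open>simp_all add: basis_elem\<close>)
  have "F (x # ys) = (\<Sum>b\<in>B. scale (\<psi> x b) (F (basis_elem b # ys)))"
    by (rule lin_expand) (use Suc.prems(1) xs in simp_all)
  also have "\<dots> = (\<Sum>b\<in>B. scale (\<psi> x b) (G (basis_elem b # ys)))" using e by simp
  also have "\<dots> = G (x # ys)"
    by (rule lin_expand[symmetric]) (use Suc.prems(2) xs in simp_all)
  finally show ?case by (simp add: xs)
qed simp

text \<open>
  The multilinear map with prescribed values on tuples of basis elements.
\<close>

primrec extend :: "'a list \<Rightarrow> ('b list \<Rightarrow> 'b \<Rightarrow> 'k) \<Rightarrow> 'b \<Rightarrow> 'k" where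
  "extend [] \<phi> = \<phi> []"
| "extend (x # xs) \<phi> = (\<Sum>b\<in>B. scale (\<psi> x b) (extend xs (\<lambda>bs. \<phi> (b # bs))))"

lemma extend_basis: "set bs \<subseteq> B \<Longrightarrow> extend (map basis_elem bs) \<phi> = \<phi> bs"
proof (induction bs arbitrary: \<phi>)
  case (Cons b bs)
  then have "extend (map basis_elem (b # bs)) \<phi> = (\<Sum>c\<in>B. if c = b then \<phi> (b # bs) else 0)"
    by (auto simp: basis_elem intro!: sum.cong)
  then show ?case using Cons.prems finite_B by simp
qed simp

lemma multilinear_extend: "multilinear n (\<lambda>xs. extend xs \<phi>)"
proof (induction n arbitrary: \<phi>)
  case (Suc n)
  have "multilinear n (\<lambda>zs. \<Sum>b\<in>I. scale (c b) (extend zs (\<lambda>bs. \<phi> (b # bs))))" if "finite I" for I c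
    using that
  proof (induction I rule: finite_induct)
    case (insert b I)
    have ms: "multilinear n (\<lambda>xs. scale (c b) (F xs))" if "multilinear n F" for F
      using that by (induction n arbitrary: F) (auto simp: lin_def scale_add scale_scale mult.commute)
    show ?case unfolding sum.insert[OF insert(1,2)] by (intro multilinear_add ms Suc insert.IH)
  next
    case empty
    show ?case unfolding sum.empty by (rule multilinear_zero)
  qed
  moreover have "lin (\<lambda>x. extend (x # zs) \<phi>)" for zs
    by (auto simp: lin_def \<psi>_add \<psi>_smult scale_add sum.distrib scale_sum scale_scale scale_def[of _ "\<psi> _"] intro!: sum.cong)
  ultimately show ?case using finite_B by simp
qed simp

lemma supported_extend:
  "(\<And>bs. length bs = length xs \<Longrightarrow> supported (\<phi> bs)) \<Longrightarrow> supported (extend xs \<phi>)"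
  by (induction xs arbitrary: \<phi>) (auto intro!: supported_sum supported_scale)

section \<open>Hochschild cohomology in coordinates\<close>

lemma tuples_update: "xs \<in> tuples A n \<Longrightarrow> y \<in> carrier A \<Longrightarrow> xs[i := y] \<in> tuples A n"
  using set_update_subset_insert[of xs i y] by (auto simp: tuples_def)

lemma hcochains_iff:
  "f \<in> hcochains A n \<longleftrightarrow> f \<in> tuples A n \<rightarrow>\<^sub>E carrier A \<and> multilinear n (\<lambda>xs. \<psi> (f xs))"
proof (cases "f \<in> tuples A n \<rightarrow>\<^sub>E carrier A")
  case True
  have "(f (xs[i := xs ! i \<oplus> y]) = f xs \<oplus> f (xs[i := y]) \<and> f (xs[i := c \<odot> xs ! i]) = c \<odot> f xs) \<longleftrightarrow>
     (\<psi> (f (xs[i := xs ! i \<oplus> y])) = \<psi> (f xs) + \<psi> (f (xs[i := y])) \<and>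
      \<psi> (f (xs[i := c \<odot> xs ! i])) = scale c (\<psi> (f xs)))"
    if "xs \<in> tuples A n" "i < n" "y \<in> carrier A" for xs i y c
  proof -
    have x: "xs ! i \<in> carrier A" using that by (auto simp: tuples_def)
    have t: "xs \<in> tuples A n" "xs[i := xs ! i \<oplus> y] \<in> tuples A n" "xs[i := y] \<in> tuples A n"
      "xs[i := c \<odot> xs ! i] \<in> tuples A n"
      using that x by (auto intro!: tuples_update smult_closed)
    then have "f xs \<in> carrier A" "f (xs[i := xs ! i \<oplus> y]) \<in> carrier A" "f (xs[i := y]) \<in> carrier A"
      "f (xs[i := c \<odot> xs ! i]) \<in> carrier A"
      using True by auto
    then show ?thesis
      by (metis \<psi>_inj \<psi>_add \<psi>_smult smult_closed a_closed)
  qed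
  then show ?thesis using True unfolding hcochains_def multilinear_iff_index by auto
qed (simp add: hcochains_def)

definition cochain :: "nat \<Rightarrow> ('a list \<Rightarrow> 'b \<Rightarrow> 'k) \<Rightarrow> 'a list \<Rightarrow> 'a" where
  "cochain n F = (\<lambda>xs \<in> tuples A n. of_coords (F xs))"

text \<open>
  These are the coordinate forms of the elements of \<open>hcochains A n\<close>. Only the values on
  \<open>tuples A n\<close> matter, and \<open>cochain n\<close> translates back.
\<close>

definition is_cochain :: "nat \<Rightarrow> ('a list \<Rightarrow> 'b \<Rightarrow> 'k) \<Rightarrow> bool" where
  "is_cochain n F \<longleftrightarrow> multilinear n F \<and> (\<forall>xs \<in> tuples A n. supported (F xs))"

lemma cochain_cong: "(\<And>xs. xs \<in> tuples A n \<Longrightarrow> F xs = G xs) \<Longrightarrow> cochain n F = cochain n G"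
  by (auto simp: cochain_def restrict_def)

lemma \<psi>_cochain: "is_cochain n F \<Longrightarrow> xs \<in> tuples A n \<Longrightarrow> \<psi> (cochain n F xs) = F xs"
  by (simp add: cochain_def is_cochain_def of_coords)

lemma cochain_in_hcochains: "is_cochain n F \<Longrightarrow> cochain n F \<in> hcochains A n"
  unfolding hcochains_iff
  by (subst multilinear_cong[where G = F]) (auto simp: \<psi>_cochain, auto simp: cochain_def is_cochain_def of_coords)

lemma cochain_inject:
  assumes "is_cochain n F" "is_cochain n G" "cochain n F = cochain n G" "xs \<in> tuples A n"
  shows "F xs = G xs"
  using assms \<psi>_cochain by metis

lemma hcochainsE:
  assumes "f \<in> hcochains A n"
  obtains F where "is_cochain n F" "f = cochain n F"
proof
  have f: "f \<in> tuples A n \<rightarrow>\<^sub>E carrier A" "multilinear n (\<lambda>xs. \<psi> (f xs))" using assms by (auto simp: hcochains_iff)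
  then show "is_cochain n (\<lambda>xs. \<psi> (f xs))" by (auto simp: is_cochain_def intro!: supported_\<psi>)
  show "f = cochain n (\<lambda>xs. \<psi> (f xs))"
  proof
    fix xs show "f xs = cochain n (\<lambda>xs. \<psi> (f xs)) xs"
      using PiE_mem[OF f(1), of xs] PiE_arb[OF f(1), of xs]
      by (cases "xs \<in> tuples A n") (simp_all add: cochain_def of_coords_\<psi>)
  qed
qed

lemma is_cochain_add: "is_cochain n F \<Longrightarrow> is_cochain n G \<Longrightarrow> is_cochain n (\<lambda>xs. F xs + G xs)"
  and is_cochain_minus: "is_cochain n F \<Longrightarrow> is_cochain n (\<lambda>xs. - F xs)"
  and is_cochain_zero: "is_cochain n (\<lambda>xs. 0)"
  unfolding is_cochain_def
  by (auto intro!: multilinear_add multilinear_minus multilinear_zero supported_add supported_minus supported_zero)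

lemma is_cochain_cup: "is_cochain m F \<Longrightarrow> is_cochain n G \<Longrightarrow> is_cochain (m + n) (cup m F G)"
  unfolding is_cochain_def
  by (auto intro!: multilinear_cup) (auto simp: cup_def dest: tuples_take_drop intro!: supported_mul)

lemma supported_bar:
  assumes "\<And>xs. xs \<in> tuples A n \<Longrightarrow> supported (F xs)" "xs \<in> tuples A (Suc n)"
  shows "supported (bar xs F)"
  using assms
proof (induction n arbitrary: F xs)
  case 0
  then obtain x where "xs = [x]" "x \<in> carrier A" by (auto simp: tuples_Suc)
  then have "supported (- (F [] \<star> \<psi> x))" using 0(1)[of "[]"] by (intro supported_minus supported_mul supported_\<psi>) simp_all
  then show ?case using \<open>xs = [x]\<close> by (simp only: bar_single)
next
  case (Suc n)
  from Suc.prems(2) obtain x y r where xs: "xs = x # y # r" "x \<in> carrier A" "y \<in> carrier A" "r \<in> tuples A n"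
    unfolding tuples_Suc by blast
  have 1: "supported (bar (y # r) (\<lambda>zs. F (x # zs)))"
    by (rule Suc.IH) (use Suc.prems(1) xs in simp_all)
  have 2: "supported (F (x \<otimes> y # r))"
    by (rule Suc.prems(1)) (use xs in \<open>simp add: mult_closed\<close>)
  show ?case using 1 2 unfolding xs(1) bar_Cons_Cons by (simp add: supported_def)
qed

lemma is_cochain_diff: "is_cochain n F \<Longrightarrow> is_cochain (Suc n) (diff F)"
  unfolding is_cochain_def diff_def[abs_def]
  by (auto simp: tuples_Suc simp del: multilinear.simps bar.simps intro!: supported_add supported_mul supported_\<psi> supported_bar
      multilinear_bdiff[unfolded diff_def[abs_def]])

text \<open>
  The recursion unrolls to the alternating sum in the definition of the Hochschild differential.
\<close>

lemma bar_eq_sum: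
  assumes "length xs = Suc n"
  shows "bar xs F = (\<Sum>i\<in>{1..n}. scale ((-1) ^ i)
        (F (take (i - 1) xs @ (xs ! (i - 1) \<otimes> xs ! i) # drop (i + 1) xs))) +
        scale ((-1) ^ (n + 1)) (F (butlast xs) \<star> \<psi> (last xs))"
  using assms
proof (induction n arbitrary: xs F)
  case 0
  then obtain x where "xs = [x]" by (cases xs) auto
  then show ?case by simp
next
  case (Suc n)
  then obtain x y r where xs: "xs = x # y # r" "length r = n" by (cases xs; cases "tl xs") auto
  let ?t = "\<lambda>F xs i. scale ((-1) ^ i) (F (take (i - 1) xs @ (xs ! (i - 1) \<otimes> xs ! i) # drop (i + 1) xs))"
  have shift: "(\<Sum>i\<in>{1..Suc n}. t i) = t 1 + (\<Sum>i\<in>{1..n}. t (Suc i))" for t :: "nat \<Rightarrow> 'b \<Rightarrow> 'k"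
    using sum.atLeast_Suc_atMost[of 1 "Suc n" t] sum.shift_bounds_cl_Suc_ivl[of t 1 n] by simp
  have "(\<Sum>i\<in>{1..Suc n}. ?t F xs i) = ?t F xs 1 + (\<Sum>i\<in>{1..n}. ?t F xs (Suc i))"
    by (rule shift)
  also have "(\<Sum>i\<in>{1..n}. ?t F xs (Suc i)) = (\<Sum>i\<in>{1..n}. - ?t (\<lambda>zs. F (x # zs)) (y # r) i)"
  proof (rule sum.cong[OF refl])
    fix i assume "i \<in> {1..n}"
    then obtain j where "i = Suc j" by (cases i) auto
    then show "?t F xs (Suc i) = - ?t (\<lambda>zs. F (x # zs)) (y # r) i" by (simp add: xs)
  qed
  also have "\<dots> = - (\<Sum>i\<in>{1..n}. ?t (\<lambda>zs. F (x # zs)) (y # r) i)" by (rule sum_negf)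
  also have "?t F xs 1 = - F (x \<otimes> y # r)" by (simp add: xs)
  finally have sum: "(\<Sum>i\<in>{1..Suc n}. ?t F xs i)
    = - F (x \<otimes> y # r) + - (\<Sum>i\<in>{1..n}. ?t (\<lambda>zs. F (x # zs)) (y # r) i)" .
  have last: "scale ((-1) ^ (Suc n + 1)) (F (butlast xs) \<star> \<psi> (last xs))
    = - scale ((-1) ^ (n + 1)) (F (x # butlast (y # r)) \<star> \<psi> (last (y # r)))"
    by (simp add: xs)
  have IH: "bar (y # r) (\<lambda>zs. F (x # zs)) = (\<Sum>i\<in>{1..n}. ?t (\<lambda>zs. F (x # zs)) (y # r) i)
    + scale ((-1) ^ (n + 1)) (F (x # butlast (y # r)) \<star> \<psi> (last (y # r)))"
    by (rule Suc.IH) (simp add: xs)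
  have "- a - (b + c) = - a + - b + - c" for a b c :: "'b \<Rightarrow> 'k"
    by (simp add: algebra_simps)
  then show ?case unfolding sum last using IH by (simp only: xs(1) bar_Cons_Cons)
qed

lemma hdiff_cochain:
  assumes "is_cochain n F"
  shows "hdiff A n (cochain n F) = cochain (Suc n) (diff F)"
proof
  fix xs
  show "hdiff A n (cochain n F) xs = cochain (Suc n) (diff F) xs"
  proof (cases "xs \<in> tuples A (Suc n)")
    case True
    let ?f = "cochain n F"
    have f: "?f zs \<in> carrier A" if "zs \<in> tuples A n" for zs
      using cochain_in_hcochains[OF assms] that by (auto simp: hcochains_iff)
    have xs: "set xs \<subseteq> carrier A" "length xs = Suc n" using True by (auto simp: tuples_def)
    have ne: "xs \<noteq> []" using xs by auto
    have hd: "hd xs \<in> carrier A" "last xs \<in> carrier A" using xs ne by auto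
    have tl: "tl xs \<in> tuples A n" "butlast xs \<in> tuples A n"
      using xs ne by (auto simp: tuples_def dest: in_set_butlastD list.set_sel(2))
    let ?m = "\<lambda>i. take (i - 1) xs @ (xs ! (i - 1) \<otimes> xs ! i) # drop (i + 1) xs"
    have m: "?m i \<in> tuples A n" if "i \<in> {1..n}" for i
    proof -
      have "xs ! (i - 1) \<in> carrier A" "xs ! i \<in> carrier A" using that xs by (auto intro!: subsetD[OF xs(1)] nth_mem)
      then show ?thesis using that xs(2) set_take_subset[of "i - 1" xs] set_drop_subset[of "i + 1" xs] xs(1)
        by (auto simp: tuples_def mult_closed)
    qed
    have s: "(\<Oplus>i\<in>{1..n}. (-1) ^ i \<odot> ?f (?m i)) \<in> carrier A"
      by (rule finsum_closed) (use f m in \<open>auto intro!: smult_closed\<close>)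
    have "\<psi> (hdiff A n ?f xs) = \<psi> (hd xs) \<star> \<psi> (?f (tl xs))
       + \<psi> (\<Oplus>i\<in>{1..n}. (-1) ^ i \<odot> ?f (?m i)) + scale ((-1) ^ (n + 1)) (\<psi> (?f (butlast xs)) \<star> \<psi> (last xs))"
      unfolding hdiff_def using True hd tl f s
      by (simp add: \<psi>_add \<psi>_mult \<psi>_smult mult_closed smult_closed)
    also have "\<psi> (\<Oplus>i\<in>{1..n}. (-1) ^ i \<odot> ?f (?m i)) = (\<Sum>i\<in>{1..n}. \<psi> ((-1) ^ i \<odot> ?f (?m i)))"
      by (rule \<psi>_finsum) (use f m in \<open>auto intro!: smult_closed\<close>)
    also have "\<dots> = (\<Sum>i\<in>{1..n}. scale ((-1) ^ i) (F (?m i)))"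
      by (rule sum.cong[OF refl]) (simp only: \<psi>_smult[OF f[OF m]] \<psi>_cochain[OF assms m])
    also have "\<psi> (hd xs) \<star> \<psi> (?f (tl xs)) + \<dots> + scale ((-1) ^ (n + 1)) (\<psi> (?f (butlast xs)) \<star> \<psi> (last xs)) = diff F xs"
      unfolding diff_def bar_eq_sum[OF xs(2)] using tl by (simp only: \<psi>_cochain[OF assms] add.assoc)
    finally have "\<psi> (hdiff A n ?f xs) = diff F xs" .
    then have "\<psi> (hdiff A n ?f xs) = \<psi> (cochain (Suc n) (diff F) xs)"
      using True is_cochain_diff[OF assms] by (simp add: \<psi>_cochain)
    moreover have "hdiff A n ?f xs \<in> carrier A"
      unfolding hdiff_def using True hd tl f s by (simp add: mult_closed smult_closed)
    moreover have "cochain (Suc n) (diff F) xs \<in> carrier A"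
      using cochain_in_hcochains[OF is_cochain_diff[OF assms]] True by (auto simp: hcochains_iff)
    ultimately show ?thesis using \<psi>_inj by blast
  qed (simp add: hdiff_def cochain_def)
qed

lemma cochain_add:
  assumes "is_cochain n F" "is_cochain n G"
  shows "cochain n F \<otimes>\<^bsub>hcochain_group A n\<^esub> cochain n G = cochain n (\<lambda>xs. F xs + G xs)"
proof -
  have "of_coords (F xs) \<oplus> of_coords (G xs) = of_coords (F xs + G xs)" if "xs \<in> tuples A n" for xs
    using that assms by (intro \<psi>_inj) (auto simp: is_cochain_def of_coords \<psi>_add supported_add)
  then show ?thesis by (auto simp: hcochain_group_def cochain_def restrict_def)
qed

lemma one_hcochain_group: "\<one>\<^bsub>hcochain_group A n\<^esub> = cochain n (\<lambda>xs. 0)"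
  using of_coords_\<psi>[OF zero_closed] by (simp add: hcochain_group_def cochain_def restrict_def)

lemma hcoboundaries_Suc: "hcoboundaries A (Suc n) = {cochain (Suc n) (diff H) | H. is_cochain n H}"
  by (auto simp: hdiff_cochain cochain_in_hcochains image_iff elim!: hcochainsE intro!: exI) 
     (metis cochain_in_hcochains hdiff_cochain)

definition cocycle :: "nat \<Rightarrow> ('a list \<Rightarrow> 'b \<Rightarrow> 'k) \<Rightarrow> bool" where
  "cocycle n F \<longleftrightarrow> is_cochain n F \<and> (\<forall>xs \<in> tuples A (Suc n). diff F xs = 0)"

lemma cocycle_cochain: "cocycle n F \<Longrightarrow> cochain n F \<in> hcocycles A n"
  unfolding hcocycles_def kernel_def cocycle_def
  by (auto simp: hdiff_cochain one_hcochain_group cochain_in_hcochains intro!: cochain_cong)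
     (simp add: hcochain_group_def cochain_in_hcochains)

definition coh_class :: "nat \<Rightarrow> ('a list \<Rightarrow> 'b \<Rightarrow> 'k) \<Rightarrow> ('a list \<Rightarrow> 'a) set" where
  "coh_class n F = hcoboundaries A n #>\<^bsub>hcochain_group A n\<^esub> cochain n F"

lemma coh_class_in_HH: "cocycle n F \<Longrightarrow> coh_class n F \<in> carrier (HH A n)"
  using cocycle_cochain by (auto simp: HH_def carrier_FactGroup coh_class_def)

lemma coh_class_eq:
  assumes "is_cochain (Suc n) F"
  shows "coh_class (Suc n) F = {cochain (Suc n) (\<lambda>xs. diff H xs + F xs) | H. is_cochain n H}"
  unfolding coh_class_def r_coset_def hcoboundaries_Suc
  by (auto simp: cochain_add is_cochain_diff assms)

lemma one_HH: "\<one>\<^bsub>HH A (Suc n)\<^esub> = {cochain (Suc n) (diff H) | H. is_cochain n H}"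
  unfolding HH_def one_FactGroup by (rule hcoboundaries_Suc)

text \<open>
  Both classes are sets of translates \<open>dK + F\<close> and \<open>dK + G\<close>, and adding \<open>dH\<close> permutes the
  coboundaries \<open>dK\<close>.
\<close>

lemma coh_class_eqI:
  assumes "is_cochain (Suc n) F" "is_cochain (Suc n) G" "is_cochain n H"
    and "\<And>xs. xs \<in> tuples A (Suc n) \<Longrightarrow> F xs = G xs + diff H xs"
  shows "coh_class (Suc n) F = coh_class (Suc n) G"
proof -
  have *: "coh_class (Suc n) F \<subseteq> coh_class (Suc n) G"
    if F: "is_cochain (Suc n) F" and G: "is_cochain (Suc n) G" and H: "is_cochain n H"
      and E: "\<And>xs. xs \<in> tuples A (Suc n) \<Longrightarrow> F xs = G xs + diff H xs" for F G H
  proof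
    fix f assume "f \<in> coh_class (Suc n) F"
    then obtain K where K: "is_cochain n K" "f = cochain (Suc n) (\<lambda>xs. diff K xs + F xs)"
      unfolding coh_class_eq[OF F] by blast
    have "f = cochain (Suc n) (\<lambda>xs. diff (\<lambda>xs. K xs + H xs) xs + G xs)"
      unfolding K(2) by (rule cochain_cong) (simp add: E diff_add add_ac)
    then show "f \<in> coh_class (Suc n) G"
      unfolding coh_class_eq[OF G] using is_cochain_add[OF K(1) H] by blast
  qed
  have "coh_class (Suc n) G \<subseteq> coh_class (Suc n) F"
    by (rule *[of G F "\<lambda>xs. - H xs"]) (use assms in \<open>auto intro: is_cochain_minus simp: diff_minus\<close>)
  with *[OF assms] show ?thesis by blast
qed

lemma coh_class_eq_oneI:
  assumes "is_cochain (Suc n) F" "is_cochain n H"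
    and "\<And>xs. xs \<in> tuples A (Suc n) \<Longrightarrow> F xs = diff H xs"
  shows "coh_class (Suc n) F = \<one>\<^bsub>HH A (Suc n)\<^esub>"
proof -
  have "coh_class (Suc n) F = coh_class (Suc n) (\<lambda>xs. 0)"
    by (rule coh_class_eqI) (use assms is_cochain_zero in auto)
  then show ?thesis by (simp add: coh_class_eq is_cochain_zero one_HH)
qed

lemma coh_class_eq_oneD:
  assumes "is_cochain (Suc n) F" "coh_class (Suc n) F = \<one>\<^bsub>HH A (Suc n)\<^esub>"
  obtains H where "is_cochain n H" "\<And>xs. xs \<in> tuples A (Suc n) \<Longrightarrow> F xs = diff H xs"
proof -
  have "diff (\<lambda>xs. 0) xs = 0" for xs by (simp add: diff_def bar_zero)
  then have "cochain (Suc n) F \<in> coh_class (Suc n) F"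
    using assms(1) is_cochain_zero by (auto simp: coh_class_eq intro!: exI[of _ "\<lambda>xs. 0"] cochain_cong)
  then obtain H where "is_cochain n H" "cochain (Suc n) F = cochain (Suc n) (diff H)"
    using assms(2) by (auto simp: one_HH)
  then show ?thesis using that cochain_inject[OF assms(1) is_cochain_diff] by blast
qed

lemma cochain_cup_cochain:
  assumes "is_cochain m F" "is_cochain n G"
  shows "cochain_cup A m n (cochain m F) (cochain n G) = cochain (m + n) (cup m F G)"
proof -
  have "cochain m F (take m xs) \<otimes> cochain n G (drop m xs) = of_coords (cup m F G xs)"
    if "xs \<in> tuples A (m + n)" for xs
    using tuples_take_drop[OF that] assms is_cochain_cup[OF assms] that
    by (intro \<psi>_inj) (auto simp: \<psi>_mult mult_closed cochain_def is_cochain_def of_coords cup_def supported_mul)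
  then show ?thesis by (auto simp: cochain_cup_def cochain_def[of "m + n"] restrict_def)
qed

text \<open>
  The product of classes joins the cosets of the products of all representatives, so these have to
  coincide. With \<open>F' = dU + F\<close> and \<open>G' = dV + G\<close>, the product \<open>F' \<union> G'\<close> differs from \<open>F \<union> G\<close> by the
  coboundary of \<open>U \<union> G' \<plusminus> F \<union> V\<close>; that \<open>dV\<close> is a cocycle enters through \<open>dG' = 0\<close>.
\<close>

lemma hcup_coh_class:
  assumes "cocycle (Suc m) F" "cocycle (Suc n) G"
  shows "hcup A (Suc m) (Suc n) (coh_class (Suc m) F) (coh_class (Suc n) G)
       = coh_class (Suc m + Suc n) (cup (Suc m) F G)"
proof -
  have F: "is_cochain (Suc m) F" and G: "is_cochain (Suc n) G" using assms by (auto simp: cocycle_def)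
  have *: "coh_class (Suc m + Suc n) (cup (Suc m) (\<lambda>xs. diff U xs + F xs) (\<lambda>xs. diff V xs + G xs))
     = coh_class (Suc m + Suc n) (cup (Suc m) F G)" if U: "is_cochain m U" and V: "is_cochain n V" for U V
  proof -
    let ?F' = "\<lambda>xs. diff U xs + F xs" and ?G' = "\<lambda>xs. diff V xs + G xs"
    \<comment> \<open>A primitive of the difference: the two summands account for the change of \<open>F\<close> and of \<open>G\<close>.\<close>
    let ?W = "\<lambda>xs. cup m U ?G' xs + alt (Suc m) (cup (Suc m) F V xs)"
    have G': "is_cochain (Suc n) ?G'" using is_cochain_add[OF is_cochain_diff[OF V] G] .
    have F': "is_cochain (Suc m) ?F'" using is_cochain_add[OF is_cochain_diff[OF U] F] .
    have alt: "is_cochain k (\<lambda>xs. alt (Suc m) (K xs))" if "is_cochain k K" for k K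
      using that by (cases "even m") (simp_all add: alt_def is_cochain_minus)
    have "is_cochain (m + Suc n) (\<lambda>xs. alt (Suc m) (cup (Suc m) F V xs))"
      using alt[OF is_cochain_cup[OF F V]] by (simp only: add_Suc add_Suc_right)
    then have W: "is_cochain (m + Suc n) ?W" by (rule is_cochain_add[OF is_cochain_cup[OF U G']])
    have dalt: "diff (\<lambda>xs. alt (Suc m) (K xs)) xs = alt (Suc m) (diff K xs)" for K xs
      by (simp add: alt_def diff_minus)
    have "cup (Suc m) ?F' ?G' xs = cup (Suc m) F G xs + diff ?W xs" if xs: "xs \<in> tuples A (Suc (m + Suc n))" for xs
    proof -
      have t: "take (Suc m) xs \<in> tuples A (Suc m)" "drop (Suc m) xs \<in> tuples A (Suc n)"
        "take (Suc (Suc m)) xs \<in> tuples A (Suc (Suc m))" "drop (Suc (Suc m)) xs \<in> tuples A n"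
        "drop m xs \<in> tuples A (Suc (Suc n))"
        using tuples_take_drop[of xs A "Suc m" "Suc n"] tuples_take_drop[of xs A "Suc (Suc m)" "n"]
          tuples_take_drop[of xs A "m" "Suc (Suc n)"] xs by simp_all
      have 1: "diff ?G' (drop m xs) = 0"
        unfolding diff_add using t(5) assms(2) diff_diff_zero[of "drop m xs" V]
        by (simp add: cocycle_def tuples_def)
      have 2: "diff F (take (Suc (Suc m)) xs) = 0" using t(3) assms(1) by (simp add: cocycle_def)
      have l: "length xs > m" "length xs > Suc m" using xs by (auto simp: tuples_def)
      have "diff ?W xs = diff U (take (Suc m) xs) \<star> ?G' (drop (Suc m) xs)
          + alt (Suc m) (alt (Suc m) (F (take (Suc m) xs) \<star> diff V (drop (Suc m) xs)))"
        unfolding diff_add[of "cup m U ?G'"] dalt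
        unfolding diff_cup[OF l(1)] diff_cup[OF l(2)] 1 2 by (simp add: alt_def)
      also have "\<dots> = diff U (take (Suc m) xs) \<star> ?G' (drop (Suc m) xs)
          + F (take (Suc m) xs) \<star> diff V (drop (Suc m) xs)" by (simp add: alt_def)
      finally show ?thesis unfolding cup_def by (simp only: mul_simps add_ac)
    qed
    from coh_class_eqI[OF _ _ W this] show ?thesis
      using is_cochain_cup[OF F' G'] is_cochain_cup[OF F G] by simp
  qed
  have "hcup A (Suc m) (Suc n) (coh_class (Suc m) F) (coh_class (Suc n) G) =
     (\<Union>f\<in>coh_class (Suc m) F. \<Union>g\<in>coh_class (Suc n) G. coh_class (Suc m + Suc n) (cup (Suc m) F G))"
    unfolding hcup_def
  proof (intro SUP_cong[OF refl])
    fix f g assume "f \<in> coh_class (Suc m) F" "g \<in> coh_class (Suc n) G"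
    then obtain U V where UV: "is_cochain m U" "is_cochain n V"
      "f = cochain (Suc m) (\<lambda>xs. diff U xs + F xs)" "g = cochain (Suc n) (\<lambda>xs. diff V xs + G xs)"
      by (auto simp: coh_class_eq F G)
    show "hcoboundaries A (Suc m + Suc n) #>\<^bsub>hcochain_group A (Suc m + Suc n)\<^esub> cochain_cup A (Suc m) (Suc n) f g
       = coh_class (Suc m + Suc n) (cup (Suc m) F G)"
      unfolding UV(3,4) cochain_cup_cochain[OF is_cochain_add[OF is_cochain_diff[OF UV(1)] F] is_cochain_add[OF is_cochain_diff[OF UV(2)] G]]
      unfolding coh_class_def[symmetric] by (rule *[OF UV(1,2)])
  qed
  moreover have "coh_class (Suc m) F \<noteq> {}" "coh_class (Suc n) G \<noteq> {}"
    using F G is_cochain_zero by (auto simp: coh_class_eq)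
  ultimately show ?thesis by auto
qed

end

section \<open>Cochains on lists of lengths\<close>

interpretation scalar: bar_complex UNIV "(+) :: nat \<Rightarrow> nat \<Rightarrow> nat" "\<lambda>_. 1 :: 'k::field" "(*)"
  by unfold_locales (simp_all add: algebra_simps)

text \<open>
  On lists of length \<open>2m\<close>, the \<open>m\<close>-fold cup product of the 2-cocycle \<open>[l + l' \<ge> N]\<close>. It is zero on
  lists with an entry \<open>\<ge> N\<close>: such an entry stands for a path that vanishes in \<open>A\<close>, so a sum \<open>l + l' \<ge> N\<close>
  that arises in the differential contributes nothing. The same convention holds for \<open>xi\<close> and \<open>xi_sq\<close>.
\<close>

fun eta :: "nat \<Rightarrow> nat list \<Rightarrow> 'k::field" where
  "eta N [] = 1"
| "eta N [l] = 0"
| "eta N (l # l' # r) = (if l < N \<and> l' < N \<and> N \<le> l + l' then eta N r else 0)"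

definition xi :: "nat \<Rightarrow> nat list \<Rightarrow> 'k::field" where
  "xi N ls = (if hd ls < N then of_nat (hd ls) else 0)"

text \<open>
  Half the square of \<open>xi\<close>; its coboundary is \<open>-\<xi> \<union> \<xi>\<close> at pairs with sum less than \<open>N\<close>.
\<close>

definition xi_sq :: "nat \<Rightarrow> nat list \<Rightarrow> 'k::field" where
  "xi_sq N ls = (if hd ls < N then of_nat (hd ls) ^ 2 / 2 else 0)"

definition omega_coeff :: "nat \<Rightarrow> nat list \<Rightarrow> 'k::field" where
  "omega_coeff N ls = (if even (length ls) then eta N ls else xi N ls * eta N (tl ls))"

text \<open>
  The contraction with the Euler derivation, that is, the sum over all positions of the cochain with
  the derivation applied to that argument.
\<close>

definition weighted :: "(nat list \<Rightarrow> 'k::field) \<Rightarrow> nat list \<Rightarrow> 'k" where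
  "weighted c ls = of_nat (sum_list ls) * c ls"

lemma eta_append: "even (length as) \<Longrightarrow> eta N (as @ bs) = eta N as * eta N bs"
  by (induction N as rule: eta.induct) auto

lemma omega_coeff_append: "even (length bs) \<Longrightarrow> omega_coeff N (as @ bs) = omega_coeff N as * eta N bs"
proof (cases as)
  case (Cons a as')
  assume "even (length bs)"
  then show ?thesis
    using eta_append[of as N bs] eta_append[of as' N bs] Cons by (auto simp: omega_coeff_def xi_def)
qed (simp add: omega_coeff_def)

lemma eta_support:
  "eta N ls \<noteq> (0 :: 'k::field) \<Longrightarrow> (\<forall>l\<in>set ls. l < N) \<and> (length ls div 2) * N \<le> sum_list ls \<and> even (length ls)"
proof (induction N ls rule: eta.induct)
  case (3 N l l' r)
  have l: "l < N" "l' < N" "N \<le> l + l'" "eta N r \<noteq> (0 :: 'k)"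
    using 3(2) unfolding eta.simps by (auto split: if_splits)
  have IH: "(\<forall>l\<in>set r. l < N) \<and> length r div 2 * N \<le> sum_list r \<and> even (length r)"
    by (rule 3(1)) (use l in blast)+
  have "length (l # l' # r) div 2 * N = N + length r div 2 * N" by simp
  moreover have "sum_list (l # l' # r) = (l + l') + sum_list r" by simp
  ultimately have "length (l # l' # r) div 2 * N \<le> sum_list (l # l' # r)"
    using add_mono[OF l(3) conjunct1[OF conjunct2[OF IH]]] by (simp only:)
  then show ?case using IH l by simp
qed simp_all

text \<open>
  For three arguments, the outer terms and the merged ones cancel whether or not the total is at
  least \<open>N\<close>; the general case follows by the Leibniz rule.
\<close>

lemma diff_eta:
  assumes "odd (length ls)" "\<forall>l\<in>set ls. l < N"
  shows "scalar.diff (eta N) ls = (0 :: 'k::field)"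
  using assms
proof (induction "length ls" arbitrary: ls rule: less_induct)
  case less
  have three: "scalar.diff (eta N) [p, q, r] = (0 :: 'k)" if "p < N" "q < N" "r < N" for p q r
    using that by (auto simp: scalar.diff_def)
  show ?case
  proof (cases "length ls = 1")
    case True
    then obtain l where "ls = [l]" by (cases ls) auto
    then show ?thesis by (simp add: scalar.diff_def)
  next
    case False
    then obtain p q r rs where ls: "ls = p # q # r # rs"
      using less.prems by (cases ls; cases "tl ls"; cases "tl (tl ls)") auto
    have "scalar.diff (eta N) ls = scalar.diff (scalar.cup 2 (eta N) (eta N :: _ \<Rightarrow> 'k)) ls"
    proof (rule scalar.diff_cong)
      fix zs :: "nat list" assume "Suc (length zs) = length ls"
      then obtain a b c where "zs = a # b # c" using ls by (cases zs; cases "tl zs") auto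
      then show "eta N zs = scalar.cup 2 (eta N) (eta N :: _ \<Rightarrow> 'k) zs"
        by (simp add: scalar.cup_def)
    qed (simp_all add: ls)
    also have "\<dots> = 0"
      using less.prems less.hyps[of "r # rs"]
      by (subst scalar.diff_cup) (simp_all add: ls three scalar.alt_def numeral_3_eq_3)
    finally show ?thesis .
  qed
qed

lemma bar_weighted:
  assumes "ls \<noteq> []"
  shows "scalar.bar ls (\<lambda>zs. (t + of_nat (sum_list zs)) * c zs)
    = (t + of_nat (sum_list ls)) * scalar.bar ls c
      - (-1) ^ length ls * (c (butlast ls) * of_nat (last ls) :: 'k::field)"
  using assms
proof (induction ls arbitrary: t c rule: induct_list012)
  case (3 l m r)
  have "(\<lambda>zs. (t + of_nat (sum_list (l # zs))) * c (l # zs))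
      = (\<lambda>zs. ((t + of_nat l) + of_nat (sum_list zs)) * c (l # zs))"
    by (simp add: add.assoc)
  then show ?case using 3(2)[of "t + of_nat l" "\<lambda>zs. c (l # zs)"] by (simp add: algebra_simps)
qed (simp_all add: algebra_simps)

text \<open>
  Merging arguments does not change the total length. So the weight factors out of the inner terms
  of the differential, and the two outer terms, which drop an argument, leave its length behind.
\<close>

lemma diff_weighted:
  assumes "ls \<noteq> []"
  shows "scalar.diff (weighted c) ls = of_nat (sum_list ls) * scalar.diff c ls - of_nat (hd ls) * c (tl ls)
     - (-1) ^ length ls * (c (butlast ls) * of_nat (last ls) :: 'k::field)"
  using bar_weighted[OF assms, of 0 c] assms
  by (cases ls) (simp_all add: scalar.diff_def weighted_def[abs_def] algebra_simps)

lemma diff_xi: "p < N \<Longrightarrow> q < N \<Longrightarrow> scalar.diff (xi N) [p, q] = (if p + q < N then 0 else of_nat (p + q) :: 'k::field)"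
  by (auto simp: scalar.diff_def xi_def)

lemma diff_xi_sq:
  "p < N \<Longrightarrow> q < N \<Longrightarrow> scalar.diff (xi_sq N) [p, q]
    = (if p + q < N then 0 else of_nat (p + q) ^ 2 / 2) - (of_nat p * of_nat q :: 'k::field_char_0)"
  by (auto simp: scalar.diff_def xi_sq_def field_simps power2_eq_square)

section \<open>Paths in the quiver\<close>

interpretation Delta: fin_digraph \<Delta>
  by unfold_locales (auto simp: \<Delta>_def split: arrow.splits)

text \<open>
  The lengths of the paths from \<open>u\<close> to \<open>v\<close>. Integers are used because shifted lengths may be negative.
\<close>

definition feasible :: "vertex \<Rightarrow> vertex \<Rightarrow> int \<Rightarrow> bool" where
  "feasible u v L \<longleftrightarrow> u = v \<and> L = 0 \<or> u = v2 \<and> v = v2 \<and> 0 \<le> L \<or> u = v1 \<and> v = v2 \<and> 1 \<le> L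
     \<or> u = v2 \<and> v = v3 \<and> 1 \<le> L \<or> u = v1 \<and> v = v3 \<and> 2 \<le> L"

definition route :: "vertex \<Rightarrow> vertex \<Rightarrow> nat \<Rightarrow> arrow list" where
  "route u v l = (if u = v1 \<and> v = v2 then arr_a # replicate (l - 1) arr_x
     else if u = v1 \<and> v = v3 then arr_a # replicate (l - 2) arr_x @ [arr_b]
     else if u = v2 \<and> v = v2 then replicate l arr_x
     else if u = v2 \<and> v = v3 then replicate (l - 1) arr_x @ [arr_b] else [])"

lemma tail_Delta: "tail \<Delta> e = (case e of arr_a \<Rightarrow> v1 | arr_x \<Rightarrow> v2 | arr_b \<Rightarrow> v2)"
  and head_Delta: "head \<Delta> e = (case e of arr_a \<Rightarrow> v2 | arr_x \<Rightarrow> v2 | arr_b \<Rightarrow> v3)"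
  by (simp_all add: \<Delta>_def)

lemma cas_v3: "Delta.cas v3 es v \<longleftrightarrow> es = [] \<and> v = v3"
  by (cases es) (auto simp: tail_Delta split: arrow.splits)

lemma cas_v2: "Delta.cas v2 es v \<longleftrightarrow>
    v = v2 \<and> es = replicate (length es) arr_x \<or> v = v3 \<and> es \<noteq> [] \<and> es = replicate (length es - 1) arr_x @ [arr_b]"
proof (induction es)
  case (Cons e es)
  then show ?case
    by (cases e; cases es) (auto simp: tail_Delta head_Delta cas_v3 split: arrow.splits)
qed auto

lemma cas_v1: "Delta.cas v1 es v \<longleftrightarrow> es = [] \<and> v = v1 \<or> (\<exists>fs. es = arr_a # fs \<and> Delta.cas v2 fs v)"
  by (cases es) (auto simp: tail_Delta head_Delta split: arrow.splits)

lemma qpaths_Delta: "(u, es, v) \<in> qpaths \<Delta> \<longleftrightarrow> feasible u v (int (length es)) \<and> es = route u v (length es)"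
proof -
  have "u \<in> verts \<Delta>" "set es \<subseteq> arcs \<Delta>"
    using vertex.exhaust[of u] arrow.exhaust by (auto simp: \<Delta>_def)
  then have "(u, es, v) \<in> qpaths \<Delta> \<longleftrightarrow> Delta.cas u es v"
    by (simp add: Delta.qpaths_iff Delta.awalk_def)
  also have "\<dots> \<longleftrightarrow> feasible u v (int (length es)) \<and> es = route u v (length es)"
  proof (cases u)
    case v1
    show ?thesis
    proof (cases es)
      case (Cons e fs)
      then show ?thesis unfolding v1 cas_v1 cas_v2
        by (cases v; cases fs) (auto simp: feasible_def route_def)
    qed (auto simp: v1 cas_v1 feasible_def route_def)
  next
    case v2
    then show ?thesis unfolding v2 cas_v2
      by (cases v; cases es) (auto simp: feasible_def route_def)
  next
    case v3
    then show ?thesis by (cases v) (auto simp: cas_v3 feasible_def route_def)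
  qed
  finally show ?thesis .
qed

lemma length_route: "feasible u v L \<Longrightarrow> length (route u v (nat L)) = nat L"
  by (auto simp: feasible_def route_def)

lemma feasible_nonneg: "feasible u v L \<Longrightarrow> 0 \<le> L"
  by (auto simp: feasible_def)

lemma route_in_qpaths: "feasible u v L \<Longrightarrow> (u, route u v (nat L), v) \<in> qpaths \<Delta>"
  unfolding qpaths_Delta using feasible_nonneg[of u v L] by (simp add: length_route)

lemma qpath_Delta_eq:
  assumes "p \<in> qpaths \<Delta>"
  shows "feasible (fst p) (snd (snd p)) (int (qlen p))" "p = (fst p, route (fst p) (snd (snd p)) (qlen p), snd (snd p))"
  using assms qpaths_Delta[of "fst p" "fst (snd p)" "snd (snd p)"] by (simp_all add: qlen_def prod_eq_iff)

lemma feasible_add: "feasible u v L \<Longrightarrow> feasible v w M \<Longrightarrow> feasible u w (L + M)"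
  by (auto simp: feasible_def)

text \<open>
  Shifting the lengths of composable paths creates no path for the composite unless the factors
  exist too. The only obstructions are the vertex \<open>v1\<close> and \<open>v3\<close>, where no loop is available, and the
  path \<open>ab\<close> of minimal length; positivity of the lengths before and after the shift excludes both.
\<close>

lemma feasible_cancel:
  assumes "feasible u v M" "feasible v w M'" "feasible u w (L + L')"
  shows "1 \<le> M \<Longrightarrow> 1 \<le> M' \<Longrightarrow> 1 \<le> L \<Longrightarrow> 1 \<le> L' \<Longrightarrow> feasible u v L \<and> feasible v w L'"
    and "1 \<le> M' \<Longrightarrow> 1 \<le> L' \<Longrightarrow> L = M \<Longrightarrow> feasible v w L'"
    and "1 \<le> M \<Longrightarrow> 1 \<le> L \<Longrightarrow> L' = M' \<Longrightarrow> feasible u v L"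
  using assms by (auto simp: feasible_def)

text \<open>
  The basis element of the path from \<open>u\<close> to \<open>v\<close> of length \<open>L\<close>, or zero.
\<close>

definition route_vec :: "nat \<Rightarrow> vertex \<Rightarrow> vertex \<Rightarrow> int \<Rightarrow> (vertex, arrow) qpath \<Rightarrow> 'k::field" where
  "route_vec N u v L = (if feasible u v L \<and> L < int N then path_vec (u, route u v (nat L), v) else 0)"

lemma path_vec_eq_route_vec: "p \<in> Delta.short_paths N \<Longrightarrow> path_vec p = route_vec N (fst p) (snd (snd p)) (int (qlen p))"
  using qpath_Delta_eq[of p] by (simp add: Delta.short_paths_def route_vec_def)

lemma route_vec_outside: "p \<notin> Delta.short_paths N \<Longrightarrow> route_vec N u v L p = 0"
  using route_in_qpaths[of u v L] length_route[of u v L] feasible_nonneg[of u v L]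
  by (auto simp: route_vec_def path_vec_def Delta.short_paths_def qlen_def)

lemma Delta_tconv_zero [simp]: "Delta.tconv N 0 g = 0" "Delta.tconv N g 0 = 0"
  using Delta.tconv_add_left[of N 0 0 g] Delta.tconv_add_right[of N g 0 0] by simp_all

lemma route_vec_mult:
  "Delta.tconv N (route_vec N u v L) (route_vec N v' w M) =
     (if v = v' \<and> feasible u v L \<and> feasible v w M then route_vec N u w (L + M) else (0 :: _ \<Rightarrow> 'k::field))"
proof (cases "feasible u v L \<and> feasible v' w M \<and> L < int N \<and> M < int N")
  case True
  let ?p = "(u, route u v (nat L), v)" and ?q = "(v', route v' w (nat M), w)"
  have p: "?p \<in> qpaths \<Delta>" "?q \<in> qpaths \<Delta>" using True by (auto intro: route_in_qpaths)
  have l: "qlen ?p = nat L" "qlen ?q = nat M" using True by (simp_all add: qlen_def length_route)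
  have n: "0 \<le> L" "0 \<le> M" using True feasible_nonneg by auto
  have "pcomp ?p ?q = (u, route u w (nat (L + M)), w)" if "v = v'"
    using qpath_Delta_eq(2)[OF Delta.pcomp_in_qpaths[OF p]] that l n by (simp add: nat_add_distrib)
  then show ?thesis
    using True n l feasible_add[of u v L w M]
    by (auto simp: route_vec_def Delta.tconv_path_vec[OF p] nat_less_iff)
next
  case False
  moreover have "\<not> L + M < int N" if "feasible u v L" "feasible v w M" "v = v'"
    using that False feasible_nonneg[of u v L] feasible_nonneg[of v w M] by auto
  ultimately show ?thesis by (auto simp: route_vec_def)
qed

fun chain :: "(vertex, arrow) qpath list \<Rightarrow> bool" where
  "chain (p # q # r) \<longleftrightarrow> snd (snd p) = fst q \<and> chain (q # r)"
| "chain _ \<longleftrightarrow> True"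

definition tlen :: "(vertex, arrow) qpath list \<Rightarrow> nat" where "tlen ps = sum_list (map qlen ps)"

text \<open>
  The composite of the paths in \<open>ps\<close> with \<open>s\<close> loops removed.
\<close>

definition shifted_path :: "nat \<Rightarrow> int \<Rightarrow> (vertex, arrow) qpath list \<Rightarrow> (vertex, arrow) qpath \<Rightarrow> 'k::field" where
  "shifted_path N s ps = (if chain ps then route_vec N (fst (hd ps)) (snd (snd (last ps))) (int (tlen ps) - s) else 0)"

lemma tlen_simps [simp]: "tlen [] = 0" "tlen (p # ps) = qlen p + tlen ps" "tlen (ps @ qs) = tlen ps + tlen qs"
  by (simp_all add: tlen_def)

lemma chain_append:
  "chain (ps @ qs) \<longleftrightarrow> chain ps \<and> chain qs \<and> (ps \<noteq> [] \<longrightarrow> qs \<noteq> [] \<longrightarrow> snd (snd (last ps)) = fst (hd qs))"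
proof (induction ps rule: chain.induct)
  case ("2_2" p)
  then show ?case by (cases qs) auto
qed auto

lemma chain_feasible:
  "chain ps \<Longrightarrow> ps \<noteq> [] \<Longrightarrow> set ps \<subseteq> qpaths \<Delta> \<Longrightarrow> feasible (fst (hd ps)) (snd (snd (last ps))) (int (tlen ps))"
proof (induction ps rule: chain.induct)
  case (1 p q r)
  then show ?case using feasible_add[OF qpath_Delta_eq(1)[of p]] by fastforce
qed (auto simp: qpath_Delta_eq)

lemma shifted_path_merge:
  "shifted_path N s (ps @ p # q # qs) = (if snd (snd p) = fst q then shifted_path N s (ps @ pcomp p q # qs) else 0)"
proof -
  have c: "chain (ps @ p # q # qs) \<longleftrightarrow> snd (snd p) = fst q \<and> chain (ps @ pcomp p q # qs)"
    by (cases qs) (auto simp: chain_append)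
  show ?thesis unfolding shifted_path_def c by (cases ps; cases qs) (auto simp: add.assoc)
qed

lemma shifted_path_zero: "int N \<le> int (tlen ps) - s \<Longrightarrow> shifted_path N s ps = 0"
  by (auto simp: shifted_path_def route_vec_def)

text \<open>
  Removing loops from the factors separately is the same as removing them from the composite.
\<close>

lemma shifted_path_append:
  assumes "ps \<noteq> []" "qs \<noteq> []" "set ps \<subseteq> qpaths \<Delta>" "set qs \<subseteq> qpaths \<Delta>"
    and "1 \<le> tlen ps" "1 \<le> tlen qs" "1 \<le> int (tlen ps) - s" "1 \<le> int (tlen qs) - t"
  shows "Delta.tconv N (shifted_path N s ps) (shifted_path N t qs) = (shifted_path N (s + t) (ps @ qs) :: _ \<Rightarrow> 'k::field)"
proof (cases "chain (ps @ qs)")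
  case True
  then have c: "chain ps" "chain qs" "snd (snd (last ps)) = fst (hd qs)"
    using assms by (auto simp: chain_append)
  let ?u = "fst (hd ps)" and ?v = "snd (snd (last ps))" and ?w = "snd (snd (last qs))"
  have f: "feasible ?u ?v (int (tlen ps))" "feasible ?v ?w (int (tlen qs))"
    using chain_feasible[OF c(1)] chain_feasible[OF c(2)] assms c(3) by auto
  have "route_vec N ?u ?w ((int (tlen ps) - s) + (int (tlen qs) - t)) = (0 :: _ \<Rightarrow> 'k)"
    if "\<not> (feasible ?u ?v (int (tlen ps) - s) \<and> feasible ?v ?w (int (tlen qs) - t))"
    using feasible_cancel(1)[OF f] assms that unfolding route_vec_def by auto
  then have "Delta.tconv N (shifted_path N s ps) (shifted_path N t qs) =
     (route_vec N ?u ?w ((int (tlen ps) - s) + (int (tlen qs) - t)) :: _ \<Rightarrow> 'k)"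
    unfolding shifted_path_def using c by (simp add: route_vec_mult)
  then show ?thesis using True assms by (simp add: shifted_path_def algebra_simps)
next
  case False
  then show ?thesis using assms by (auto simp: shifted_path_def chain_append route_vec_mult)
qed

lemma shifted_path_Cons:
  assumes "p \<in> Delta.short_paths N" "qs \<noteq> []" "set qs \<subseteq> qpaths \<Delta>"
    and "1 \<le> tlen qs" "1 \<le> int (tlen qs) - t"
  shows "Delta.tconv N (path_vec p) (shifted_path N t qs) = (shifted_path N t (p # qs) :: _ \<Rightarrow> 'k::field)"
proof (cases "chain ([p] @ qs)")
  case True
  then have c: "chain qs" "snd (snd p) = fst (hd qs)"
    using assms unfolding chain_append by auto
  let ?u = "fst p" and ?v = "snd (snd p)" and ?w = "snd (snd (last qs))"
  have f: "feasible ?u ?v (int (qlen p))" "feasible ?v ?w (int (tlen qs))"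
    using qpath_Delta_eq(1)[of p] chain_feasible[OF c(1)] assms c(2) by (auto simp: Delta.short_paths_def)
  have "route_vec N ?u ?w (int (qlen p) + (int (tlen qs) - t)) = (0 :: _ \<Rightarrow> 'k)"
    if "\<not> feasible ?v ?w (int (tlen qs) - t)"
    using feasible_cancel(2)[OF f] assms that unfolding route_vec_def by auto
  then have "Delta.tconv N (path_vec p) (shifted_path N t qs) =
     (route_vec N ?u ?w (int (qlen p) + (int (tlen qs) - t)) :: _ \<Rightarrow> 'k)"
    unfolding shifted_path_def path_vec_eq_route_vec[OF assms(1)] using c f by (simp add: route_vec_mult)
  then show ?thesis using True assms by (simp add: shifted_path_def algebra_simps)
next
  case False
  then show ?thesis using assms chain_append[of "[p]" qs]
    by (auto simp: shifted_path_def path_vec_eq_route_vec[OF assms(1)] route_vec_mult)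
qed

lemma shifted_path_snoc:
  assumes "p \<in> Delta.short_paths N" "ps \<noteq> []" "set ps \<subseteq> qpaths \<Delta>"
    and "1 \<le> tlen ps" "1 \<le> int (tlen ps) - s"
  shows "Delta.tconv N (shifted_path N s ps) (path_vec p) = (shifted_path N s (ps @ [p]) :: _ \<Rightarrow> 'k::field)"
proof (cases "chain (ps @ [p])")
  case True
  then have c: "chain ps" "snd (snd (last ps)) = fst p"
    using assms by (auto simp: chain_append)
  let ?u = "fst (hd ps)" and ?v = "snd (snd (last ps))" and ?w = "snd (snd p)"
  have f: "feasible ?u ?v (int (tlen ps))" "feasible ?v ?w (int (qlen p))"
    using qpath_Delta_eq(1)[of p] chain_feasible[OF c(1)] assms c(2) by (auto simp: Delta.short_paths_def)
  have "route_vec N ?u ?w ((int (tlen ps) - s) + int (qlen p)) = (0 :: _ \<Rightarrow> 'k)"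
    if "\<not> feasible ?u ?v (int (tlen ps) - s)"
    using feasible_cancel(3)[OF f] assms that unfolding route_vec_def by auto
  then have "Delta.tconv N (shifted_path N s ps) (path_vec p) =
     (route_vec N ?u ?w ((int (tlen ps) - s) + int (qlen p)) :: _ \<Rightarrow> 'k)"
    unfolding shifted_path_def path_vec_eq_route_vec[OF assms(1)] using c f by (simp add: route_vec_mult)
  then show ?thesis using True assms by (simp add: shifted_path_def algebra_simps)
next
  case False
  then show ?thesis using assms chain_append[of ps "[p]"]
    by (auto simp: shifted_path_def path_vec_eq_route_vec[OF assms(1)] route_vec_mult)
qed

definition xpath :: "nat \<Rightarrow> (vertex, arrow) qpath" where "xpath i = (v2, replicate i arr_x, v2)"
definition apath :: "nat \<Rightarrow> (vertex, arrow) qpath" where "apath i = (v1, arr_a # replicate i arr_x, v2)"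

lemma xpath_simps [simp]: "fst (xpath i) = v2" "snd (snd (xpath i)) = v2" "qlen (xpath i) = i"
  "xpath i \<in> qpaths \<Delta>" "pcomp (xpath i) (xpath j) = xpath (i + j)"
  and apath_simps [simp]: "fst (apath i) = v1" "snd (snd (apath i)) = v2" "qlen (apath i) = Suc i"
  "apath i \<in> qpaths \<Delta>" "pcomp (apath i) (xpath j) = apath (i + j)"
  by (simp_all add: xpath_def apath_def qlen_def qpaths_Delta feasible_def route_def pcomp_def replicate_add)

lemma xpath_short [simp]: "xpath i \<in> Delta.short_paths N \<longleftrightarrow> i < N"
  and apath_short [simp]: "apath i \<in> Delta.short_paths N \<longleftrightarrow> Suc i < N"
  by (simp_all add: Delta.short_paths_def)

lemma tconv_coeff:
  shows "j < N \<Longrightarrow> Delta.tconv N (path_vec (xpath i)) g (xpath j) = (if i \<le> j then g (xpath (j - i)) else 0)"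
    and "j < N \<Longrightarrow> Delta.tconv N g (path_vec (xpath i)) (xpath j) = (if i \<le> j then g (xpath (j - i)) else 0)"
    and "Suc j < N \<Longrightarrow> Delta.tconv N (path_vec (apath i)) g (apath j) = (if i \<le> j then g (xpath (j - i)) else 0)"
    and "Suc j < N \<Longrightarrow> Delta.tconv N g (path_vec (xpath i)) (apath j) = (if i \<le> j then g (apath (j - i)) else 0)"
  subgoal
    using Delta.conv_path_vec_left[of "xpath i" "xpath (j - i)" g]
    by (auto simp: Delta.tconv_def Delta.conv_path_vec_short)
  subgoal
    using Delta.conv_path_vec_right[of "xpath (j - i)" "xpath i" g]
    by (auto simp: Delta.tconv_def Delta.conv_path_vec_short)
  subgoal
    using Delta.conv_path_vec_left[of "apath i" "xpath (j - i)" g]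
    by (auto simp: Delta.tconv_def Delta.conv_path_vec_short)
  subgoal
  proof (cases "i \<le> j")
    case False
    have "Delta.conv g (path_vec (xpath i)) (apath j) = 0"
    proof (rule ccontr)
      assume "Delta.conv g (path_vec (xpath i)) (apath j) \<noteq> 0"
      then obtain p q where "(p, q) \<in> Delta.factorizations (apath j)" "path_vec (xpath i) q \<noteq> (0 :: 'a)"
        using Delta.conv_nonzero by blast
      then have p: "p \<in> qpaths \<Delta>" "snd (snd p) = v2" "apath j = pcomp p (xpath i)"
        by (auto simp: Delta.factorizations_iff path_vec_def split: if_splits)
      have "fst p = v1" using arg_cong[OF p(3), of fst] by simp
      moreover have "qlen p = 0" using arg_cong[OF p(3), of qlen] False by simp
      ultimately show False using qpath_Delta_eq(1)[OF p(1)] p(2) by (simp add: feasible_def)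
    qed
    then show ?thesis using False by (simp add: Delta.tconv_def)
  qed (use Delta.conv_path_vec_right[of "apath (j - i)" "xpath i" g] in \<open>simp add: Delta.tconv_def\<close>)
  done

lemma route_vec_apply: "feasible v2 v2 (int j) \<Longrightarrow> j < N \<Longrightarrow> route_vec N v2 v2 (int j) (xpath j) = 1"
  "1 \<le> j \<Longrightarrow> j < N \<Longrightarrow> route_vec N v1 v2 (int j) (apath (j - 1)) = 1"
  by (simp_all add: route_vec_def path_vec_def xpath_def apath_def feasible_def route_def)

section \<open>Cochains given by a coefficient and a shift\<close>

locale truncated_delta =
  fixes N :: nat and A :: "('k::field_char_0, ((vertex, arrow) qpath \<Rightarrow> 'k) set) module" (structure)
  assumes N_ge: "3 \<le> N" and A_eq: "A = truncated_quiver_algebra \<Delta> N"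
begin

sublocale coordinate_algebra A "coords N" "Delta.tconv N" "Delta.short_paths N"
  by (rule coordinate_algebra.intro)
     (simp_all add: Delta.truncated_quiver_algebra_coords[OF A_eq] scale_def Delta.tconv_add_left
       Delta.tconv_add_right Delta.tconv_assoc Delta.tconv_smult_left Delta.tconv_smult_right)

abbreviation times_A :: "((vertex, arrow) qpath \<Rightarrow> 'k) \<Rightarrow> ((vertex, arrow) qpath \<Rightarrow> 'k) \<Rightarrow> (vertex, arrow) qpath \<Rightarrow> 'k"
  (infixl "\<star>" 70) where "f \<star> g \<equiv> Delta.tconv N f g"

lemma coords_basis_elem: "p \<in> Delta.short_paths N \<Longrightarrow> coords N (basis_elem p) = path_vec p"
  using basis_elem(2)[of p] by (simp add: path_vec_def)

lemma basis_elem_mult: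
  assumes "p \<in> Delta.short_paths N" "q \<in> Delta.short_paths N"
  shows "basis_elem p \<otimes> basis_elem q = (if snd (snd p) = fst q \<and> qlen p + qlen q < N then basis_elem (pcomp p q) else \<zero>)"
    and "snd (snd p) = fst q \<Longrightarrow> qlen p + qlen q < N \<Longrightarrow> pcomp p q \<in> Delta.short_paths N"
proof -
  have q: "p \<in> qpaths \<Delta>" "q \<in> qpaths \<Delta>" using assms by (auto simp: Delta.short_paths_def)
  show s: "pcomp p q \<in> Delta.short_paths N" if "snd (snd p) = fst q" "qlen p + qlen q < N"
    using that Delta.pcomp_in_qpaths[OF q] by (simp add: Delta.short_paths_def)
  show "basis_elem p \<otimes> basis_elem q = (if snd (snd p) = fst q \<and> qlen p + qlen q < N then basis_elem (pcomp p q) else \<zero>)"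
    by (rule \<psi>_inj)
       (use assms s in \<open>auto simp: mult_closed basis_elem(1) \<psi>_mult coords_basis_elem Delta.tconv_path_vec[OF q]\<close>)
qed

definition graded_cochain :: "(nat list \<Rightarrow> 'k) \<Rightarrow> int \<Rightarrow> ((vertex, arrow) qpath \<Rightarrow> 'k) set list \<Rightarrow> (vertex, arrow) qpath \<Rightarrow> 'k" where
  "graded_cochain c s xs = extend xs (\<lambda>ps. scale (c (map qlen ps)) (shifted_path N s ps))"

lemma supported_shifted_path: "supported (shifted_path N s ps)"
  by (auto simp: supported_def shifted_path_def route_vec_outside)

lemma is_cochain_graded_cochain: "is_cochain n (graded_cochain c s)"
  unfolding is_cochain_def graded_cochain_def[abs_def]
  by (auto intro!: multilinear_extend supported_extend supported_scale supported_shifted_path)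

lemma graded_cochain_basis_elem: "set ps \<subseteq> Delta.short_paths N \<Longrightarrow> graded_cochain c s (map basis_elem ps) = scale (c (map qlen ps)) (shifted_path N s ps)"
  by (simp add: graded_cochain_def extend_basis)

text \<open>
  Under this condition on \<open>c\<close> and \<open>s\<close>, the outer terms of the differential and cup products respect
  shifted paths, by \<open>feasible_cancel\<close>.
\<close>

definition admissible :: "nat \<Rightarrow> (nat list \<Rightarrow> 'k) \<Rightarrow> int \<Rightarrow> bool" where
  "admissible n c s \<longleftrightarrow> (\<forall>ls. length ls = n \<longrightarrow> c ls \<noteq> 0 \<longrightarrow>
     (\<forall>l\<in>set ls. l < N) \<and> 1 \<le> sum_list ls \<and> 1 \<le> int (sum_list ls) - s)"

text \<open>
  The induction moves the first path into the prefix \<open>pre\<close>, which is why the statement carries one.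
  A product of consecutive paths vanishes if they do not compose, where the composite of the
  tuple vanishes too, or if it is too long, where \<open>c\<close> vanishes.
\<close>

lemma bar_on_basis:
  assumes "multilinear n F"
    and "\<And>qs. length qs = n \<Longrightarrow> set qs \<subseteq> Delta.short_paths N \<Longrightarrow>
      F (map basis_elem qs) = scale (c (map qlen qs)) (shifted_path N s (pre @ qs))"
    and "\<And>ls. length ls = n \<Longrightarrow> c ls \<noteq> 0 \<Longrightarrow> \<forall>l\<in>set ls. l < N"
    and "\<And>qs p. length qs = n \<Longrightarrow> set qs \<subseteq> Delta.short_paths N \<Longrightarrow> p \<in> Delta.short_paths N \<Longrightarrow>
      c (map qlen qs) \<noteq> 0 \<Longrightarrow> shifted_path N s (pre @ qs) \<star> path_vec p = shifted_path N s (pre @ qs @ [p])"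
    and "length qs = Suc n" "set qs \<subseteq> Delta.short_paths N"
  shows "bar (map basis_elem qs) F = scale (scalar.bar (map qlen qs) c) (shifted_path N s (pre @ qs))"
  using assms
proof (induction n arbitrary: F c pre qs)
  case 0
  then obtain p where p: "qs = [p]" "p \<in> Delta.short_paths N" by (cases qs) auto
  have "F [] = scale (c []) (shifted_path N s pre)" using 0(2)[of "[]"] by simp
  moreover have "scale (c []) (shifted_path N s pre) \<star> path_vec p = scale (c []) (shifted_path N s (pre @ [p]))"
    using 0(4)[of "[]" p] p by (cases "c [] = 0") (simp_all add: scale_left)
  ultimately show ?case using p by (simp add: coords_basis_elem)
next
  case (Suc n)
  then obtain p q r where qs: "qs = p # q # r" by (cases qs; cases "tl qs") auto
  have pq: "p \<in> Delta.short_paths N" "q \<in> Delta.short_paths N" "set r \<subseteq> Delta.short_paths N" "length r = n"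
    using Suc.prems(5,6) qs by auto
  have rt: "map basis_elem r \<in> tuples A n" using pq by (intro basis_in_tuples)
  have 1: "F (basis_elem p \<otimes> basis_elem q # map basis_elem r) = scale (c ((qlen p + qlen q) # map qlen r)) (shifted_path N s (pre @ qs))"
  proof (cases "snd (snd p) = fst q \<and> qlen p + qlen q < N")
    case True
    then have "F (map basis_elem (pcomp p q # r)) = scale (c (map qlen (pcomp p q # r))) (shifted_path N s (pre @ pcomp p q # r))"
      using pq basis_elem_mult(2)[OF pq(1,2)] by (intro Suc.prems(2)) auto
    then show ?thesis using True basis_elem_mult(1)[OF pq(1,2)] by (simp add: qs shifted_path_merge)
  next
    case False
    have "F (\<zero> # map basis_elem r) = 0"
      by (rule multilinear_zero_arg[OF Suc.prems(1)]) (use rt in simp_all)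
    moreover have "scale (c ((qlen p + qlen q) # map qlen r)) (shifted_path N s (pre @ qs)) = 0"
    proof (cases "snd (snd p) = fst q")
      case True
      then have "c ((qlen p + qlen q) # map qlen r) = 0"
        using False Suc.prems(3)[of "(qlen p + qlen q) # map qlen r"] pq(4) by force
      then show ?thesis by simp
    qed (simp add: qs shifted_path_merge)
    ultimately show ?thesis using False basis_elem_mult(1)[OF pq(1,2)] by auto
  qed
  have 2: "bar (map basis_elem (q # r)) (\<lambda>zs. F (basis_elem p # zs))
      = scale (scalar.bar (map qlen (q # r)) (\<lambda>ls. c (qlen p # ls))) (shifted_path N s ((pre @ [p]) @ (q # r)))"
  proof (rule Suc.IH)
    show "multilinear n (\<lambda>zs. F (basis_elem p # zs))" using Suc.prems(1) basis_elem(1)[OF pq(1)] by simp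
    show "F (basis_elem p # map basis_elem us) = scale (c (qlen p # map qlen us)) (shifted_path N s ((pre @ [p]) @ us))"
      if "length us = n" "set us \<subseteq> Delta.short_paths N" for us
      using Suc.prems(2)[of "p # us"] that pq by simp
    show "\<forall>l\<in>set ls. l < N" if "length ls = n" "c (qlen p # ls) \<noteq> 0" for ls
      using Suc.prems(3)[of "qlen p # ls"] that by simp
    show "shifted_path N s ((pre @ [p]) @ us) \<star> path_vec p' = shifted_path N s ((pre @ [p]) @ us @ [p'])"
      if "length us = n" "set us \<subseteq> Delta.short_paths N" "p' \<in> Delta.short_paths N" "c (qlen p # map qlen us) \<noteq> 0" for us p'
      using Suc.prems(4)[of "p # us" p'] that pq by simp
  qed (use pq in auto)
  show ?case using 1 2 by (simp add: qs scale_add)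
       (simp add: scale_def fun_eq_iff algebra_simps)
qed

lemma diff_graded_cochain:
  assumes "admissible n c s" "n \<ge> 1" "length qs = Suc n" "set qs \<subseteq> Delta.short_paths N"
  shows "diff (graded_cochain c s) (map basis_elem qs) = scale (scalar.diff c (map qlen qs)) (shifted_path N s qs)"
proof -
  obtain p r where qs: "qs = p # r" "p \<in> Delta.short_paths N" "length r = n" "set r \<subseteq> Delta.short_paths N"
    using assms(3,4) by (cases qs) auto
  have sq: "set us \<subseteq> qpaths \<Delta>" if "set us \<subseteq> Delta.short_paths N" for us
    using that by (auto simp: Delta.short_paths_def)
  have sup: "1 \<le> tlen us" "1 \<le> int (tlen us) - s" "us \<noteq> []" if "length us = n" "c (map qlen us) \<noteq> 0" for us
    using assms(1,2) that by (auto simp: admissible_def tlen_def)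
  have 1: "bar (map basis_elem qs) (graded_cochain c s) = scale (scalar.bar (map qlen qs) c) (shifted_path N s ([] @ qs))"
  proof (rule bar_on_basis)
    show "multilinear n (graded_cochain c s)" using is_cochain_graded_cochain by (simp add: is_cochain_def)
    show "\<forall>l\<in>set ls. l < N" if "length ls = n" "c ls \<noteq> 0" for ls
      using assms(1) that by (auto simp: admissible_def)
    show "shifted_path N s ([] @ us) \<star> path_vec p = shifted_path N s ([] @ us @ [p])"
      if "length us = n" "set us \<subseteq> Delta.short_paths N" "p \<in> Delta.short_paths N" "c (map qlen us) \<noteq> 0" for us p
      using shifted_path_snoc[OF that(3) sup(3)[OF that(1,4)] sq[OF that(2)] sup(1,2)[OF that(1,4)]] by simp
  qed (use assms in \<open>auto simp: graded_cochain_basis_elem\<close>)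
  have 2: "path_vec p \<star> graded_cochain c s (map basis_elem r) = scale (c (map qlen r)) (shifted_path N s qs)"
    by (cases "c (map qlen r) = 0")
       (simp_all add: graded_cochain_basis_elem[OF qs(4)] scale_right qs(1) shifted_path_Cons[OF qs(2) sup(3)[OF qs(3)] sq[OF qs(4)] sup(1,2)[OF qs(3)]])
  show ?thesis unfolding diff_def scalar.diff_def 1 using 2
    by (simp add: qs coords_basis_elem scale_add del: bar.simps bar_Cons_Cons)
qed

lemma cup_graded_cochain:
  assumes "admissible m c s" "admissible n d t" "m \<ge> 1" "n \<ge> 1" "length qs = m + n" "set qs \<subseteq> Delta.short_paths N"
  shows "cup m (graded_cochain c s) (graded_cochain d t) (map basis_elem qs) = scale (scalar.cup m c d (map qlen qs)) (shifted_path N (s + t) qs)"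
proof -
  let ?u = "take m qs" and ?v = "drop m qs"
  have uv: "set ?u \<subseteq> Delta.short_paths N" "set ?v \<subseteq> Delta.short_paths N" "length ?u = m" "length ?v = n"
    using assms(5,6) by (auto dest: in_set_takeD in_set_dropD)
  then have q: "set ?u \<subseteq> qpaths \<Delta>" "set ?v \<subseteq> qpaths \<Delta>" by (auto simp: Delta.short_paths_def)
  have "cup m (graded_cochain c s) (graded_cochain d t) (map basis_elem qs)
      = scale (c (map qlen ?u) * d (map qlen ?v)) (shifted_path N s ?u \<star> shifted_path N t ?v)"
    unfolding cup_def take_map drop_map graded_cochain_basis_elem[OF uv(1)] graded_cochain_basis_elem[OF uv(2)]
    by (simp add: scale_left scale_right scale_scale mult.commute)
  also have "\<dots> = scale (c (map qlen ?u) * d (map qlen ?v)) (shifted_path N (s + t) qs)"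
  proof (cases "c (map qlen ?u) = 0 \<or> d (map qlen ?v) = 0")
    case False
    then have "1 \<le> tlen ?u" "1 \<le> int (tlen ?u) - s" "1 \<le> tlen ?v" "1 \<le> int (tlen ?v) - t"
      using assms(1,2) uv(3,4) by (auto simp: admissible_def tlen_def)
    moreover have "?u \<noteq> []" "?v \<noteq> []" using uv assms(3,4) by auto
    ultimately show ?thesis using q by (simp add: shifted_path_append)
  qed auto
  finally show ?thesis by (simp add: scalar.cup_def take_map drop_map)
qed

text \<open>
  The scalar identity is only required at lists whose shifted total is less than \<open>N\<close>; at all others
  the shifted path is zero.
\<close>

lemma coh_class_graded_cochain_eqI:
  assumes "is_cochain (Suc n) F" "admissible n h s" "n \<ge> 1"
    and "\<And>ps. length ps = Suc n \<Longrightarrow> set ps \<subseteq> Delta.short_paths N \<Longrightarrow>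
      F (map basis_elem ps) = scale (c (map qlen ps)) (shifted_path N s ps)"
    and "\<And>ls. length ls = Suc n \<Longrightarrow> \<forall>l\<in>set ls. l < N \<Longrightarrow> int (sum_list ls) - s < int N \<Longrightarrow> c ls = d ls + scalar.diff h ls"
  shows "coh_class (Suc n) F = coh_class (Suc n) (graded_cochain d s)"
proof (rule coh_class_eqI[OF assms(1) is_cochain_graded_cochain is_cochain_graded_cochain])
  fix xs assume xs: "xs \<in> tuples A (Suc n)"
  show "F xs = graded_cochain d s xs + diff (graded_cochain h s) xs"
  proof (rule multilinear_eqI[OF _ _ _ xs])
    show "multilinear (Suc n) F" using assms(1) by (simp add: is_cochain_def)
    show "multilinear (Suc n) (\<lambda>xs. graded_cochain d s xs + diff (graded_cochain h s) xs)"
      using is_cochain_add[OF is_cochain_graded_cochain is_cochain_diff[OF is_cochain_graded_cochain]] by (simp add: is_cochain_def)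
    fix ps assume ps: "length ps = Suc n" "set ps \<subseteq> Delta.short_paths N"
    have "scale (c (map qlen ps)) (shifted_path N s ps) = scale (d (map qlen ps) + scalar.diff h (map qlen ps)) (shifted_path N s ps)"
    proof (cases "int (tlen ps) - s < int N")
      case True
      have "c (map qlen ps) = d (map qlen ps) + scalar.diff h (map qlen ps)"
        by (rule assms(5)) (use True ps in \<open>auto simp: tlen_def Delta.short_paths_def\<close>)
      then show ?thesis by simp
    next
      case False
      then have "shifted_path N s ps = (0 :: _ \<Rightarrow> 'k)" by (intro shifted_path_zero) simp
      then show ?thesis by simp
    qed
    then show "F (map basis_elem ps) = graded_cochain d s (map basis_elem ps) + diff (graded_cochain h s) (map basis_elem ps)"
      using assms(4)[OF ps] graded_cochain_basis_elem[OF ps(2)] diff_graded_cochain[OF assms(2,3) ps] by (simp add: scale_add)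
  qed
qed

lemma coh_class_graded_cochain_eq_one:
  assumes "\<And>ls. length ls = Suc n \<Longrightarrow> c ls \<noteq> 0 \<Longrightarrow> int N \<le> int (sum_list ls) - s"
  shows "coh_class (Suc n) (graded_cochain c s) = \<one>\<^bsub>HH A (Suc n)\<^esub>"
proof (rule coh_class_eq_oneI[OF is_cochain_graded_cochain is_cochain_zero])
  fix xs assume xs: "xs \<in> tuples A (Suc n)"
  have "graded_cochain c s xs = 0"
  proof (rule multilinear_eqI[OF _ multilinear_zero _ xs])
    show "multilinear (Suc n) (graded_cochain c s)" using is_cochain_graded_cochain by (simp add: is_cochain_def)
    fix ps assume ps: "length ps = Suc n" "set ps \<subseteq> Delta.short_paths N"
    show "graded_cochain c s (map basis_elem ps) = 0"
      using assms[of "map qlen ps"] ps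
      by (cases "c (map qlen ps) = 0") (auto simp: graded_cochain_basis_elem tlen_def shifted_path_zero)
  qed
  then show "graded_cochain c s xs = diff (\<lambda>xs. 0) xs" by (simp add: diff_def bar_zero)
qed

section \<open>The classes and their products\<close>

text \<open>
  Chosen so that a tuple of loops of total length \<open>mN\<close> for \<open>n = 2m\<close>, or \<open>mN + 1\<close> for \<open>n = 2m + 1\<close>,
  goes to \<open>x\<^sup>j\<close>.
\<close>

definition omega_shift :: "nat \<Rightarrow> nat \<Rightarrow> int" where
  "omega_shift n j = int (n div 2 * N + n mod 2) - int j"

definition omega :: "nat \<Rightarrow> nat \<Rightarrow> (((vertex, arrow) qpath \<Rightarrow> 'k) set list \<Rightarrow> ((vertex, arrow) qpath \<Rightarrow> 'k) set) set" where
  "omega n j = coh_class n (graded_cochain (omega_coeff N) (omega_shift n j))"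

lemma omega_coeff_support:
  assumes "omega_coeff N ls \<noteq> (0 :: 'k)" "length ls = n" "n \<ge> 1"
  shows "(\<forall>l\<in>set ls. l < N) \<and> 1 \<le> sum_list ls \<and> int j \<le> int (sum_list ls) - omega_shift n j"
proof (cases "even n")
  case True
  then have e: "(\<forall>l\<in>set ls. l < N) \<and> n div 2 * N \<le> sum_list ls"
    using assms eta_support[of N ls] by (auto simp: omega_coeff_def)
  have "1 * N \<le> n div 2 * N" using True assms(3) by (intro mult_le_mono1) presburger
  then have "1 \<le> sum_list ls" using e N_ge by linarith
  moreover have "n mod 2 = 0" using True by presburger
  ultimately have "n div 2 * N + n mod 2 \<le> sum_list ls" using e by simp
  then have "int (n div 2 * N + n mod 2) \<le> int (sum_list ls)" by (simp only: of_nat_le_iff)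
  then show ?thesis using e \<open>1 \<le> sum_list ls\<close> unfolding omega_shift_def by auto
next
  case False
  then obtain l r where ls: "ls = l # r" "length r = n - 1" using assms(2,3) by (cases ls) auto
  then have e: "l < N" "l \<noteq> 0" "eta N r \<noteq> (0 :: 'k)"
    using assms False by (auto simp: omega_coeff_def xi_def split: if_splits)
  have "(n - 1) div 2 = n div 2" "n mod 2 = 1" using False by presburger+
  then have "n div 2 * N + n mod 2 \<le> sum_list ls" using eta_support[OF e(3)] e(2) ls by simp
  then have "int (n div 2 * N + n mod 2) \<le> int (sum_list ls)" by (simp only: of_nat_le_iff)
  then show ?thesis using eta_support[OF e(3)] e ls unfolding omega_shift_def by auto
qed

lemma admissible_omega_coeff: "n \<ge> 1 \<Longrightarrow> j \<ge> 1 \<Longrightarrow> admissible n (omega_coeff N) (omega_shift n j)"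
  unfolding admissible_def using omega_coeff_support[of _ n j] by fastforce

text \<open>
  In odd degree the Euler derivation fails to be a cocycle only at \<open>p + q \<ge> N\<close>; together with
  the remaining pairs, the total is then too long.
\<close>

lemma diff_omega_coeff:
  assumes "length ls = Suc n" "\<forall>l\<in>set ls. l < N" "n \<ge> 1" "j \<ge> 1" "int (sum_list ls) - omega_shift n j < int N"
  shows "scalar.diff (omega_coeff N) ls = (0 :: 'k)"
proof (cases "even n")
  case True
  have "scalar.diff (omega_coeff N) ls = scalar.diff (eta N :: _ \<Rightarrow> 'k) ls"
    by (rule scalar.diff_cong) (use assms(1) True in \<open>auto simp: omega_coeff_def\<close>)
  then show ?thesis using diff_eta[of ls N] assms(1,2) True by simp
next
  case False
  obtain p q r where ls: "ls = p # q # r" "length r = n - 1"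
    using assms(1,3) by (cases ls; cases "tl ls") auto
  have "scalar.diff (omega_coeff N) ls = scalar.diff (scalar.cup 1 (xi N) (eta N :: _ \<Rightarrow> 'k)) ls"
  proof (rule scalar.diff_cong)
    fix zs :: "nat list" assume "Suc (length zs) = length ls"
    then show "omega_coeff N zs = scalar.cup 1 (xi N) (eta N :: _ \<Rightarrow> 'k) zs"
      using False assms(1,3) by (cases zs) (auto simp: omega_coeff_def scalar.cup_def xi_def)
  qed (simp_all add: ls)
  also have "\<dots> = scalar.diff (xi N) [p, q] * eta N r + - (xi N [p] * scalar.diff (eta N :: _ \<Rightarrow> 'k) (q # r))"
    by (subst scalar.diff_cup) (simp_all add: ls scalar.alt_def numeral_2_eq_2)
  also have "scalar.diff (eta N :: _ \<Rightarrow> 'k) (q # r) = 0"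
    by (rule diff_eta) (use assms(1,2) ls False in auto)
  also have "scalar.diff (xi N) [p, q] * eta N r = (0 :: 'k)"
  proof (cases "p + q < N \<or> eta N r = (0 :: 'k)")
    case True
    then show ?thesis using assms(2) ls by (auto simp: diff_xi)
  next
    case f: False
    have "(n - 1) div 2 = n div 2" "n mod 2 = 1" using False by presburger+
    moreover have "eta N r \<noteq> (0 :: 'k)" using f by blast
    note eta_support[OF this]
    ultimately have "N + n div 2 * N \<le> sum_list ls"
      using f ls by auto
    then have "int (N + n div 2 * N) \<le> int (sum_list ls)" by (simp only: of_nat_le_iff)
    then show ?thesis using assms(4,5) \<open>n mod 2 = 1\<close> unfolding omega_shift_def by simp
  qed
  finally show ?thesis by simp
qed

lemma cocycle_omega_coeff:
  assumes "n \<ge> 1" "j \<ge> 1"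
  shows "cocycle n (graded_cochain (omega_coeff N) (omega_shift n j))"
  unfolding cocycle_def
proof (intro conjI ballI is_cochain_graded_cochain)
  fix xs assume xs: "xs \<in> tuples A (Suc n)"
  show "diff (graded_cochain (omega_coeff N) (omega_shift n j)) xs = 0"
  proof (rule multilinear_eqI[OF _ multilinear_zero _ xs])
    show "multilinear (Suc n) (diff (graded_cochain (omega_coeff N) (omega_shift n j)))"
      using is_cochain_diff[OF is_cochain_graded_cochain] by (simp add: is_cochain_def)
    fix ps assume ps: "length ps = Suc n" "set ps \<subseteq> Delta.short_paths N"
    show "diff (graded_cochain (omega_coeff N) (omega_shift n j)) (map basis_elem ps) = 0"
    proof (cases "int (tlen ps) - omega_shift n j < int N")
      case True
      then have "scalar.diff (omega_coeff N) (map qlen ps) = (0 :: 'k)"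
        using ps assms by (intro diff_omega_coeff[of _ n j]) (auto simp: tlen_def Delta.short_paths_def)
      then show ?thesis using diff_graded_cochain[OF admissible_omega_coeff[OF assms] assms(1) ps] by simp
    next
      case False
      then show ?thesis using diff_graded_cochain[OF admissible_omega_coeff[OF assms] assms(1) ps] by (simp add: shifted_path_zero)
    qed
  qed
qed

lemma hcup_omega:
  assumes "n1 \<ge> 1" "n2 \<ge> 1" "j1 \<ge> 1" "j2 \<ge> 1"
  shows "hcup A n1 n2 (omega n1 j1) (omega n2 j2)
    = coh_class (n1 + n2) (cup n1 (graded_cochain (omega_coeff N) (omega_shift n1 j1)) (graded_cochain (omega_coeff N) (omega_shift n2 j2)))"
proof -
  obtain m1 m2 where "n1 = Suc m1" "n2 = Suc m2" using assms by (cases n1; cases n2) auto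
  then show ?thesis using hcup_coh_class[of m1 _ m2] cocycle_omega_coeff assms by (simp add: omega_def)
qed

lemma coh_class_cup_eqI:
  assumes "n1 \<ge> 1" "n2 \<ge> 1" "j1 \<ge> 1" "j2 \<ge> 1"
    and "admissible (n1 + n2 - 1) h (omega_shift n1 j1 + omega_shift n2 j2)"
    and "\<And>ls. length ls = n1 + n2 \<Longrightarrow> \<forall>l\<in>set ls. l < N \<Longrightarrow>
      int (sum_list ls) - (omega_shift n1 j1 + omega_shift n2 j2) < int N \<Longrightarrow>
      scalar.cup n1 (omega_coeff N) (omega_coeff N) ls = d ls + scalar.diff h ls"
  shows "hcup A n1 n2 (omega n1 j1) (omega n2 j2) = coh_class (n1 + n2) (graded_cochain d (omega_shift n1 j1 + omega_shift n2 j2))"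
proof -
  obtain n where n: "n1 + n2 = Suc n" "n \<ge> 1" using assms(1,2) by (cases "n1 + n2") auto
  show ?thesis unfolding hcup_omega[OF assms(1-4)] n(1)
  proof (rule coh_class_graded_cochain_eqI[OF _ _ n(2)])
    show "is_cochain (Suc n) (cup n1 (graded_cochain (omega_coeff N) (omega_shift n1 j1)) (graded_cochain (omega_coeff N) (omega_shift n2 j2)))"
      using is_cochain_cup[OF is_cochain_graded_cochain is_cochain_graded_cochain, of n1 n2] n(1) by simp
    show "admissible n h (omega_shift n1 j1 + omega_shift n2 j2)" using assms(5) n(1) by simp
    show "cup n1 (graded_cochain (omega_coeff N) (omega_shift n1 j1)) (graded_cochain (omega_coeff N) (omega_shift n2 j2)) (map basis_elem ps)
      = scale (scalar.cup n1 (omega_coeff N) (omega_coeff N) (map qlen ps)) (shifted_path N (omega_shift n1 j1 + omega_shift n2 j2) ps)"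
      if "length ps = Suc n" "set ps \<subseteq> Delta.short_paths N" for ps
      by (rule cup_graded_cochain[OF admissible_omega_coeff[OF assms(1,3)] admissible_omega_coeff[OF assms(2,4)] assms(1,2)])
         (use that n in simp_all)
  qed (use assms(6) n in auto)
qed

lemma omega_zero:
  assumes "N \<le> j" "n \<ge> 1"
  shows "omega n j = \<one>\<^bsub>HH A n\<^esub>"
proof -
  obtain m where m: "n = Suc m" using assms(2) by (cases n) auto
  show ?thesis unfolding omega_def m
  proof (rule coh_class_graded_cochain_eq_one)
    fix ls :: "nat list" assume "length ls = Suc m" "omega_coeff N ls \<noteq> (0 :: 'k)"
    then show "int N \<le> int (sum_list ls) - omega_shift (Suc m) j"
      using omega_coeff_support[of ls "Suc m" j] assms(1) by auto
  qed
qed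

lemma omega_shift_add: "even n1 \<or> even n2 \<Longrightarrow> omega_shift n1 j1 + omega_shift n2 j2 = omega_shift (n1 + n2) (j1 + j2)"
proof -
  assume e: "even n1 \<or> even n2"
  have "(n1 + n2) div 2 = n1 div 2 + n2 div 2" "(n1 + n2) mod 2 = n1 mod 2 + n2 mod 2"
    using e by presburger+
  then show ?thesis unfolding omega_shift_def by (simp add: distrib_right)
qed

lemma hcup_even_right:
  assumes "n1 \<ge> 1" "n2 \<ge> 1" "j1 \<ge> 1" "j2 \<ge> 1" "even n2"
  shows "hcup A n1 n2 (omega n1 j1) (omega n2 j2) = omega (n1 + n2) (j1 + j2)"
  unfolding omega_def[of "n1 + n2"] omega_shift_add[OF disjI2[OF assms(5)], symmetric]
proof (rule coh_class_cup_eqI[OF assms(1-4), where h = "\<lambda>_. 0"])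
  show "admissible (n1 + n2 - 1) (\<lambda>_. 0) (omega_shift n1 j1 + omega_shift n2 j2)" by (simp add: admissible_def)
  show "scalar.cup n1 (omega_coeff N) (omega_coeff N) ls = omega_coeff N ls + (scalar.diff (\<lambda>_. 0) ls :: 'k)" if "length ls = n1 + n2" for ls
  proof -
    have "omega_coeff N (take n1 ls @ drop n1 ls) = omega_coeff N (take n1 ls) * (eta N (drop n1 ls) :: 'k)"
      by (rule omega_coeff_append) (use that assms(5) in simp)
    then show ?thesis using that assms(5)
      by (simp add: scalar.cup_def scalar.diff_def scalar.bar_zero omega_coeff_def[of N "drop n1 ls"])
  qed
qed

text \<open>
  The homotopy is the weighted power of \<open>eta\<close> times the remaining power. By \<open>diff_weighted\<close> its
  differential is \<open>(\<eta>\<^sup>m \<union> \<xi> - \<xi> \<union> \<eta>\<^sup>m) \<union> \<eta>\<^sup>m'\<close>.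
\<close>

lemma hcup_even_left:
  assumes "n1 \<ge> 1" "n2 \<ge> 1" "j1 \<ge> 1" "j2 \<ge> 1" "even n1" "odd n2"
  shows "hcup A n1 n2 (omega n1 j1) (omega n2 j2) = omega (n1 + n2) (j1 + j2)"
  unfolding omega_def[of "n1 + n2"] omega_shift_add[OF disjI1[OF assms(5)], symmetric]
proof (rule coh_class_cup_eqI[OF assms(1-4), where h = "scalar.cup n1 (weighted (eta N)) (eta N)"])
  obtain m1 m2 where m: "n1 = 2 * m1" "n2 = 2 * m2 + 1" "m1 \<ge> 1"
    using assms by (auto elim!: evenE oddE)
  show "admissible (n1 + n2 - 1) (scalar.cup n1 (weighted (eta N)) (eta N)) (omega_shift n1 j1 + omega_shift n2 j2)"
    unfolding admissible_def
  proof (intro allI impI)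
    fix ls :: "nat list"
    assume l: "length ls = n1 + n2 - 1" and "scalar.cup n1 (weighted (eta N)) (eta N) ls \<noteq> (0 :: 'k)"
    then have e: "eta N (take n1 ls) \<noteq> (0 :: 'k)" "eta N (drop n1 ls) \<noteq> (0 :: 'k)"
      by (auto simp: scalar.cup_def weighted_def)
    note s = eta_support[OF e(1)] eta_support[OF e(2)]
    have lt: "\<forall>l\<in>set ls. l < N"
      using s set_append[of "take n1 ls" "drop n1 ls"] unfolding append_take_drop_id by blast
    have "sum_list ls = sum_list (take n1 ls) + sum_list (drop n1 ls)"
      unfolding sum_list_append[symmetric] append_take_drop_id ..
    moreover have "length (take n1 ls) div 2 = m1" "length (drop n1 ls) div 2 = m2" using l m by auto
    ultimately have sum: "m1 * N + m2 * N \<le> sum_list ls" using s by auto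
    then have "int (m1 * N + m2 * N) \<le> int (sum_list ls)" by (simp only: of_nat_le_iff)
    have "1 * N \<le> m1 * N" using m(3) by (intro mult_le_mono1)
    then have "1 \<le> sum_list ls" using sum N_ge by linarith
    moreover have "omega_shift n1 j1 + omega_shift n2 j2 = int (m1 * N + m2 * N) + 1 - int j1 - int j2"
      by (simp add: omega_shift_def m)
    moreover note \<open>int (m1 * N + m2 * N) \<le> int (sum_list ls)\<close>
    ultimately show "(\<forall>l\<in>set ls. l < N) \<and> 1 \<le> sum_list ls \<and> 1 \<le> int (sum_list ls) - (omega_shift n1 j1 + omega_shift n2 j2)"
      using lt assms(3,4) by auto
  qed
  fix ls :: "nat list" assume l: "length ls = n1 + n2" "\<forall>l\<in>set ls. l < N"
  define bs vs where "bs = take n1 ls" and "vs = drop (Suc n1) ls"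
  define k where "k = ls ! n1"
  have ls: "ls = bs @ k # vs" "length bs = n1" "length vs = 2 * m2"
    using l(1) m unfolding bs_def vs_def k_def by (auto simp: id_take_nth_drop[symmetric])
  obtain p cs where "bs = p # cs" using ls(2) assms(1) by (cases bs) auto
  then have bs: "bs = p # cs" "odd (length cs)" using ls(2) assms(5) by auto
  have "scalar.diff (scalar.cup n1 (weighted (eta N)) (eta N)) ls
     = scalar.diff (weighted (eta N)) (bs @ [k]) * eta N vs
       + scalar.alt n1 (weighted (eta N) bs * scalar.diff (eta N) (k # vs))"
    by (subst scalar.diff_cup) (use ls in simp_all)
  also have "scalar.diff (eta N) (k # vs) = (0 :: 'k)"
    by (rule diff_eta) (use ls l in auto)
  also have "scalar.diff (weighted (eta N)) (bs @ [k])
      = of_nat (sum_list (bs @ [k])) * scalar.diff (eta N) (bs @ [k])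
        - of_nat p * eta N (cs @ [k]) + eta N bs * (of_nat k :: 'k)"
    by (subst diff_weighted) (use bs in simp_all)
  also have "scalar.diff (eta N) (bs @ [k]) = (0 :: 'k)"
    by (rule diff_eta) (use ls l m in auto)
  finally have d: "scalar.diff (scalar.cup n1 (weighted (eta N)) (eta N)) ls
     = (eta N bs * of_nat k - of_nat p * eta N (cs @ [k])) * (eta N vs :: 'k)"
    by (simp add: scalar.alt_def)
  have "omega_coeff N ls = of_nat p * eta N ((cs @ [k]) @ vs)"
    using ls bs l m by (simp add: omega_coeff_def xi_def)
  also have "\<dots> = of_nat p * (eta N (cs @ [k]) * (eta N vs :: 'k))"
    by (subst eta_append) (use bs in simp_all)
  finally have o: "omega_coeff N ls = of_nat p * (eta N (cs @ [k]) * (eta N vs :: 'k))" .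
  have "scalar.cup n1 (omega_coeff N) (omega_coeff N) ls = eta N bs * (of_nat k * (eta N vs :: 'k))"
    using ls l m by (simp add: scalar.cup_def omega_coeff_def xi_def)
  then show "scalar.cup n1 (omega_coeff N) (omega_coeff N) ls
     = omega_coeff N ls + (scalar.diff (scalar.cup n1 (weighted (eta N)) (eta N)) ls :: 'k)"
    unfolding d o by (simp add: algebra_simps)
qed

text \<open>
  Here \<open>\<xi> \<union> \<eta>\<^sup>m \<union> \<xi>\<close> is moved to \<open>\<xi> \<union> \<xi> \<union> \<eta>\<^sup>m\<close> by the weighted power of \<open>eta\<close>, and \<open>\<xi> \<union> \<xi>\<close> is
  killed by half of \<open>\<xi>\<^sup>2\<close>; \<open>K\<close> is the sum of both homotopies. The error terms are supported
  where the first two lengths add up to at least \<open>N\<close>.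
\<close>

lemma hcup_odd:
  assumes "n1 \<ge> 1" "n2 \<ge> 1" "j1 \<ge> 1" "j2 \<ge> 1" "odd n1" "odd n2"
  shows "hcup A n1 n2 (omega n1 j1) (omega n2 j2) = \<one>\<^bsub>HH A (n1 + n2)\<^esub>"
proof -
  obtain m1 m2 where m: "n1 = 2 * m1 + 1" "n2 = 2 * m2 + 1"
    using assms by (auto elim!: oddE)
  define s where "s = omega_shift n1 j1 + omega_shift n2 j2"
  have s: "s = int (m1 * N + m2 * N) + 2 - int j1 - int j2" by (simp add: s_def omega_shift_def m)
  define K where "K ls = scalar.cup 1 (xi N) (weighted (eta N)) ls + (scalar.cup 1 (xi_sq N) (eta N) ls :: 'k)" for ls :: "nat list"
  define h where "h = scalar.cup n1 (\<lambda>ls. - K ls) (eta N :: _ \<Rightarrow> 'k)"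
  have "hcup A n1 n2 (omega n1 j1) (omega n2 j2) = coh_class (n1 + n2) (graded_cochain (\<lambda>_. 0) s)"
  proof (rule coh_class_cup_eqI[OF assms(1-4), where h = h, folded s_def])
    show "admissible (n1 + n2 - 1) h s"
      unfolding admissible_def
    proof (intro allI impI)
      fix ls :: "nat list"
      assume l: "length ls = n1 + n2 - 1" and h: "h ls \<noteq> (0 :: 'k)"
      obtain p r where ls: "ls = p # r" using l m by (cases ls) auto
      have e: "p < N" "p \<noteq> 0" "eta N (take (2 * m1) r) \<noteq> (0 :: 'k)" "eta N (drop (2 * m1) r) \<noteq> (0 :: 'k)"
        using h by (cases "p = 0"; auto simp: h_def K_def scalar.cup_def ls m weighted_def xi_def xi_sq_def split: if_splits)+
      note t = eta_support[OF e(3)] eta_support[OF e(4)]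
      have lt: "\<forall>l\<in>set r. l < N"
        using t set_append[of "take (2 * m1) r" "drop (2 * m1) r"] unfolding append_take_drop_id by blast
      have "sum_list r = sum_list (take (2 * m1) r) + sum_list (drop (2 * m1) r)"
        unfolding sum_list_append[symmetric] append_take_drop_id ..
      moreover have "length (take (2 * m1) r) div 2 = m1" "length (drop (2 * m1) r) div 2 = m2" using l m ls by auto
      ultimately have "m1 * N + m2 * N \<le> sum_list r" using t by auto
      then have "int (m1 * N + m2 * N) \<le> int (sum_list r)" by (simp only: of_nat_le_iff)
      then show "(\<forall>l\<in>set ls. l < N) \<and> 1 \<le> sum_list ls \<and> 1 \<le> int (sum_list ls) - s"
        using lt e assms(3,4) unfolding s ls by auto
    qed
    fix ls :: "nat list"
    assume l: "length ls = n1 + n2" "\<forall>l\<in>set ls. l < N" and small: "int (sum_list ls) - s < int N"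
    define bs vs where "bs = take n1 ls" and "vs = drop (Suc n1) ls"
    define k where "k = ls ! n1"
    have ls: "ls = bs @ k # vs" "length bs = n1" "length vs = 2 * m2"
      using l(1) m unfolding bs_def vs_def k_def by (auto simp: id_take_nth_drop[symmetric])
    obtain p cs where bs: "bs = p # cs" "even (length cs)" "length cs = 2 * m1" using ls(2) m by (cases bs) auto
    obtain q r where qr: "cs @ [k] = q # r" "length r = 2 * m1" using bs(3) by (cases cs) auto
    have bl: "butlast (q # r) = cs" "last (q # r) = k" unfolding qr(1)[symmetric] by simp_all
    have lt: "p < N" "q < N" "k < N" "\<forall>l\<in>set (q # r). l < N"
      using l(2) unfolding ls(1) bs(1) qr(1)[symmetric] using qr(1) by (auto simp: Cons_eq_append_conv append_eq_Cons_conv)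
    have "scalar.diff h ls = scalar.diff (\<lambda>ls. - K ls) (bs @ [k]) * eta N vs
         + scalar.alt n1 ((- K bs) * scalar.diff (eta N) (k # vs))"
      unfolding h_def by (subst scalar.diff_cup) (use ls in simp_all)
    also have "scalar.diff (eta N) (k # vs) = (0 :: 'k)"
      by (rule diff_eta) (use ls l in auto)
    also have "scalar.diff (\<lambda>ls. - K ls) (bs @ [k]) = - (scalar.diff K (bs @ [k]) :: 'k)"
      by (rule scalar.diff_minus)
    also have "scalar.diff K (bs @ [k]) = scalar.diff (scalar.cup 1 (xi N) (weighted (eta N))) (p # q # r)
        + (scalar.diff (scalar.cup 1 (xi_sq N) (eta N)) (p # q # r) :: 'k)"
      unfolding K_def[abs_def] scalar.diff_add using bs qr by simp
    also have "scalar.diff (scalar.cup 1 (xi N) (weighted (eta N))) (p # q # r) =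
        scalar.diff (xi N) [p, q] * weighted (eta N) r
        - of_nat p * (scalar.diff (weighted (eta N)) (q # r) :: 'k)"
      by (subst scalar.diff_cup) (simp_all add: scalar.alt_def numeral_2_eq_2 xi_def lt)
    also have "scalar.diff (weighted (eta N)) (q # r) =
        of_nat (sum_list (q # r)) * scalar.diff (eta N) (q # r) - of_nat q * eta N r + eta N cs * (of_nat k :: 'k)"
      unfolding diff_weighted[OF list.distinct(2)] bl list.sel using qr(2) by simp
    also have deta: "scalar.diff (eta N) (q # r) = (0 :: 'k)"
      by (rule diff_eta) (use qr lt in auto)
    also have "scalar.diff (scalar.cup 1 (xi_sq N) (eta N)) (p # q # r) = scalar.diff (xi_sq N) [p, q] * (eta N r :: 'k)"
      by (subst scalar.diff_cup) (simp_all add: deta scalar.alt_def numeral_2_eq_2)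
    finally have d: "scalar.diff h ls = - (scalar.diff (xi N) [p, q] * weighted (eta N) r
        - of_nat p * (- of_nat q * eta N r + eta N cs * of_nat k)
        + scalar.diff (xi_sq N) [p, q] * eta N r) * (eta N vs :: 'k)"
      by (simp add: scalar.alt_def)
    have c: "scalar.cup n1 (omega_coeff N) (omega_coeff N) ls = of_nat p * eta N cs * (of_nat k * (eta N vs :: 'k))"
      using ls bs m lt by (simp add: scalar.cup_def omega_coeff_def xi_def)
    show "scalar.cup n1 (omega_coeff N) (omega_coeff N) ls = 0 + (scalar.diff h ls :: 'k)"
    proof (cases "p + q < N")
      case True
      then show ?thesis unfolding d c diff_xi[OF lt(1,2)] diff_xi_sq[OF lt(1,2)] by (simp add: algebra_simps)
    next
      case False
      have z: "eta N r * eta N vs = (0 :: 'k)"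
      proof (rule ccontr)
        assume "eta N r * eta N vs \<noteq> (0 :: 'k)"
        then have e: "eta N r \<noteq> (0 :: 'k)" "eta N vs \<noteq> (0 :: 'k)" by auto
        have "m1 * N + m2 * N \<le> sum_list r + sum_list vs"
          using eta_support[OF e(1)] eta_support[OF e(2)] qr(2) ls(3) by auto
        moreover have "sum_list (cs @ [k]) = q + sum_list r" unfolding qr(1) by simp
        then have "sum_list ls = p + q + sum_list r + sum_list vs"
          unfolding ls(1) bs(1) by simp
        ultimately have "m1 * N + m2 * N + N \<le> sum_list ls" using False by linarith
        then have "int (m1 * N + m2 * N + N) \<le> int (sum_list ls)" by (simp only: of_nat_le_iff)
        then show False using small assms(3,4) unfolding s by simp
      qed
      have "scalar.diff h ls = of_nat p * eta N cs * (of_nat k * eta N vs)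
        - (scalar.diff (xi N) [p, q] * of_nat (sum_list r) + of_nat p * of_nat q + scalar.diff (xi_sq N) [p, q]) * (eta N r * (eta N vs :: 'k))"
        unfolding d weighted_def by (simp add: algebra_simps)
      then show ?thesis unfolding c z by simp
    qed
  qed
  also have "\<dots> = \<one>\<^bsub>HH A (n1 + n2)\<^esub>"
    using coh_class_graded_cochain_eq_one[of "n1 + n2 - 1" "\<lambda>_. 0"] assms(1) by simp
  finally show ?thesis .
qed

section \<open>Nonvanishing\<close>

text \<open>
  The power \<open>x\<^sup>i\<close> in \<open>A\<close>.
\<close>

definition x_power :: "nat \<Rightarrow> ((vertex, arrow) qpath \<Rightarrow> 'k) set" where
  "x_power i = (if i < N then basis_elem (xpath i) else \<zero>)"

lemma coords_x_power: "coords N (x_power i) = (if i < N then path_vec (xpath i) else 0)"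
  by (simp add: x_power_def coords_basis_elem)

lemma x_power_in [simp]: "x_power i \<in> carrier A"
  by (simp add: x_power_def basis_elem)

sublocale bar_complex_power "carrier A" "(\<otimes>)" "coords N" "(\<star>)" x_power N
proof
  show "x_power i \<otimes> x_power j = x_power (i + j)" for i j
    by (rule \<psi>_inj)
       (auto simp: mult_closed \<psi>_mult coords_x_power Delta.tconv_path_vec)
qed (simp_all add: coords_x_power)

text \<open>
  Makes a cochain vanish off the tuples of its degree, as the predicate \<open>vanishing\<close> speaks of all
  lists.
\<close>

definition zero_outside :: "nat \<Rightarrow> (((vertex, arrow) qpath \<Rightarrow> 'k) set list \<Rightarrow> (vertex, arrow) qpath \<Rightarrow> 'k)
    \<Rightarrow> ((vertex, arrow) qpath \<Rightarrow> 'k) set list \<Rightarrow> (vertex, arrow) qpath \<Rightarrow> 'k" where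
  "zero_outside n F xs = (if xs \<in> tuples A n then F xs else 0)"

lemma vanishing_zero_outside: "multilinear n F \<Longrightarrow> vanishing (zero_outside n F)"
  using multilinear_zero_arg by (auto simp: vanishing_def zero_outside_def x_power_def)

lemma snoc2_in_tuples: "zs \<in> tuples A p \<Longrightarrow> x \<in> carrier A \<Longrightarrow> y \<in> carrier A \<Longrightarrow> zs @ [x, y] \<in> tuples A (p + 2)"
  by (auto simp: tuples_def)

lemma contract_power_cong:
  assumes "\<And>xs. xs \<in> tuples A (p + 2 * k) \<Longrightarrow> F xs = G xs" "zs \<in> tuples A p"
  shows "(contract ^^ k) F zs = (contract ^^ k) G zs"
  using assms
proof (induction k arbitrary: p zs)
  case (Suc k)
  have "(contract ^^ k) F (zs @ [x_power i, x_power (Suc 0)]) = (contract ^^ k) G (zs @ [x_power i, x_power (Suc 0)])" for i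
    by (rule Suc.IH[of "p + 2"]) (use Suc.prems snoc2_in_tuples[OF Suc.prems(2)] in auto)
  then show ?case
    by (simp only: funpow.simps o_apply contract_def[of "(contract ^^ k) F"] contract_def[of "(contract ^^ k) G"])
qed simp

definition loops :: "nat \<Rightarrow> (vertex, arrow) qpath list" where
  "loops k = concat (replicate k [xpath (N - 1), xpath 1])"

lemma loops_Suc: "loops (Suc k) = [xpath (N - 1), xpath 1] @ loops k"
  by (simp add: loops_def)

lemma loops_props:
  "k > 0 \<Longrightarrow> loops k \<noteq> [] \<and> last (loops k) = xpath 1 \<and> fst (hd (loops k)) = v2"
  "chain (loops k)" "tlen (loops k) = k * N"
proof -
  show "k > 0 \<Longrightarrow> loops k \<noteq> [] \<and> last (loops k) = xpath 1 \<and> fst (hd (loops k)) = v2"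
    by (induction k) (auto simp: loops_Suc loops_def)
  show "chain (loops k)"
  proof (induction k)
    case (Suc k)
    have "loops k = [] \<or> fst (hd (loops k)) = v2" by (cases k) (auto simp: loops_Suc loops_def)
    then show ?case using Suc by (auto simp: loops_Suc chain_append simp del: append_Cons)
  qed (simp add: loops_def)
  show "tlen (loops k) = k * N"
    using N_ge by (induction k) (auto simp: loops_Suc loops_def)
qed

lemma shifted_path_times_vertex:
  assumes "qs \<noteq> []" "snd (snd (last qs)) = v2"
  shows "shifted_path N s qs \<star> path_vec (xpath 0) = shifted_path N s qs"
proof -
  have "path_vec (xpath 0) = (route_vec N v2 v2 0 :: _ \<Rightarrow> 'k)"
    using path_vec_eq_route_vec[of "xpath 0" N] N_ge by simp
  then show ?thesis using assms by (simp add: shifted_path_def route_vec_mult) (auto simp: route_vec_def feasible_def)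
qed

text \<open>
  In each sum only \<open>i = N - 1\<close> survives, since \<open>\<eta>(i, 1) = 0\<close> for smaller \<open>i\<close>; the factor \<open>x\<^sup>0\<close> that
  remains is the vertex \<open>v2\<close>.
\<close>

lemma contract_power_omega_coeff:
  assumes "length ps + 2 * k = n" "set ps \<subseteq> Delta.short_paths N"
  shows "(contract ^^ k) (zero_outside n (graded_cochain (omega_coeff N) s)) (map basis_elem ps) = scale (omega_coeff N (map qlen ps)) (shifted_path N s (ps @ loops k))"
  using assms
proof (induction k arbitrary: ps)
  case 0
  then show ?case using basis_in_tuples[of ps n] by (simp add: zero_outside_def graded_cochain_basis_elem loops_def)
next
  case (Suc k)
  have N1: "1 < N" using N_ge by simp
  have "(contract ^^ k) (zero_outside n (graded_cochain (omega_coeff N) s)) (map basis_elem ps @ [x_power i, x_power (Suc 0)]) \<star> coords N (x_power (N - Suc i))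
     = (if i = N - 1 then scale (omega_coeff N (map qlen ps)) (shifted_path N s (ps @ loops (Suc k))) else 0)"
    if i: "i < N" for i
  proof -
    have "map basis_elem ps @ [x_power i, x_power (Suc 0)] = map basis_elem (ps @ [xpath i, xpath 1])"
      using i N1 by (simp add: x_power_def)
    then have "(contract ^^ k) (zero_outside n (graded_cochain (omega_coeff N) s)) (map basis_elem ps @ [x_power i, x_power (Suc 0)])
       = scale (omega_coeff N (map qlen (ps @ [xpath i, xpath 1]))) (shifted_path N s ((ps @ [xpath i, xpath 1]) @ loops k))"
      using Suc.IH[of "ps @ [xpath i, xpath 1]"] Suc.prems i N1 by simp
    also have "omega_coeff N (map qlen (ps @ [xpath i, xpath 1])) = omega_coeff N (map qlen ps) * (eta N [i, 1] :: 'k)"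
      by (simp add: omega_coeff_append)
    also have "eta N [i, 1] = (if i = N - 1 then 1 else 0 :: 'k)" using i N1 by auto
    finally have e: "(contract ^^ k) (zero_outside n (graded_cochain (omega_coeff N) s)) (map basis_elem ps @ [x_power i, x_power (Suc 0)])
       = (if i = N - 1 then scale (omega_coeff N (map qlen ps)) (shifted_path N s (ps @ loops (Suc k))) else 0)"
      by (cases "i = N - 1") (simp_all add: loops_Suc zero_fun_def)
    have "shifted_path N s (ps @ loops (Suc k)) \<star> path_vec (xpath 0) = shifted_path N s (ps @ loops (Suc k))"
      by (rule shifted_path_times_vertex) (use loops_props(1)[of "Suc k"] in auto)
    then show ?thesis unfolding e using N1 by (auto simp: coords_x_power scale_left)
  qed
  then have "contract ((contract ^^ k) (zero_outside n (graded_cochain (omega_coeff N) s))) (map basis_elem ps)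
     = (\<Sum>i<N. if i = N - 1 then scale (omega_coeff N (map qlen ps)) (shifted_path N s (ps @ loops (Suc k))) else 0)"
    unfolding contract_def by (intro sum.cong) auto
  then show ?case using N1 by simp
qed

text \<open>
  The analogue of \<open>contract_diff_Nil\<close> for the word \<open>a x\<^sup>N\<^sup>-\<^sup>1\<close>. There are \<open>N - 1\<close> terms instead of \<open>N\<close>,
  because the arrow \<open>a\<close> takes one of the places.
\<close>

lemma contract_diff_apath:
  assumes "vanishing H"
  shows "(\<Sum>i<N - 1. diff H [basis_elem (apath i), x_power (Suc 0)] \<star> coords N (x_power (N - 1 - Suc i)))
    = (\<Sum>i<N - 1. path_vec (apath i) \<star> H [x_power (Suc 0)] \<star> coords N (x_power (N - 1 - Suc i)))
      + H [basis_elem (apath 0)] \<star> coords N (x_power (N - 1))"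
proof -
  define g where "g i = H [if i < N - 1 then basis_elem (apath i) else \<zero>]" for i
  have N1: "1 < N" using N_ge by simp
  have t: "(\<Sum>i<N - 1. g (Suc i) \<star> coords N (x_power (N - 1 - Suc i))) - (\<Sum>i<N - 1. g i \<star> coords N (x_power (N - 1 - i)))
      = - (g 0 \<star> coords N (x_power (N - 1)))"
    using vanishingD[OF assms, of N "[\<zero>]"] by (intro telescope) (auto simp: g_def x_power_def)
  have "diff H [basis_elem (apath i), x_power (Suc 0)] \<star> coords N (x_power (N - 1 - Suc i))
     = path_vec (apath i) \<star> H [x_power (Suc 0)] \<star> coords N (x_power (N - 1 - Suc i))
       - (g (Suc i) \<star> coords N (x_power (N - 1 - Suc i)) - g i \<star> coords N (x_power (N - 1 - i)))"
    if i: "i < N - 1" for i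
  proof -
    have s: "apath i \<in> Delta.short_paths N" "xpath 1 \<in> Delta.short_paths N" using i N1 by auto
    have "basis_elem (apath i) \<otimes> x_power (Suc 0) = (if Suc i < N - 1 then basis_elem (apath (Suc i)) else \<zero>)"
      using basis_elem_mult(1)[OF s] i N1 by (auto simp: x_power_def)
    moreover have "coords N (x_power (Suc 0)) \<star> coords N (x_power (N - 1 - Suc i)) = coords N (x_power (N - 1 - i))"
      using i by (simp add: \<psi>_e_mult Suc_diff_Suc)
    ultimately show ?thesis using i
      by (simp add: diff_def coords_basis_elem[OF s(1)] mul_simps mul_assoc g_def)
  qed
  then have "(\<Sum>i<N - 1. diff H [basis_elem (apath i), x_power (Suc 0)] \<star> coords N (x_power (N - 1 - Suc i)))
    = (\<Sum>i<N - 1. path_vec (apath i) \<star> H [x_power (Suc 0)] \<star> coords N (x_power (N - 1 - Suc i))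
       - (g (Suc i) \<star> coords N (x_power (N - 1 - Suc i)) - g i \<star> coords N (x_power (N - 1 - i))))"
    by (intro sum.cong) auto
  also have "\<dots> = (\<Sum>i<N - 1. path_vec (apath i) \<star> H [x_power (Suc 0)] \<star> coords N (x_power (N - 1 - Suc i)))
      + g 0 \<star> coords N (x_power (N - 1))"
    using t by (simp only: sum_subtractf) simp
  finally show ?thesis using N1 by (simp add: g_def)
qed

lemma omega_nonzero:
  assumes n: "n \<ge> 1" and j: "1 \<le> j" "j < N"
  shows "omega n j \<noteq> \<one>\<^bsub>HH A n\<^esub>"
proof
  assume one: "omega n j = \<one>\<^bsub>HH A n\<^esub>"
  have N1: "1 < N" using N_ge by simp
  obtain n' where n': "n = Suc n'" using n by (cases n) auto
  let ?F = "graded_cochain (omega_coeff N) (omega_shift n j)"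
  obtain H where H: "is_cochain n' H" "\<And>xs. xs \<in> tuples A n \<Longrightarrow> ?F xs = diff H xs"
    using coh_class_eq_oneD[OF is_cochain_graded_cochain one[unfolded omega_def n']] n' by metis
  let ?H = "zero_outside n' H"
  have van: "vanishing ?H" using H(1) by (auto simp: is_cochain_def intro: vanishing_zero_outside)
  have FH: "zero_outside n ?F xs = diff ?H xs" if xs: "xs \<in> tuples A n" for xs
  proof -
    have "diff H xs = diff ?H xs"
      by (rule diff_cong) (use xs n' in \<open>auto simp: zero_outside_def tuples_def\<close>)
    then show ?thesis using H(2)[OF xs] xs by (simp add: zero_outside_def)
  qed
  have key: "(contract ^^ k) (zero_outside n ?F) (ys @ [x_power (Suc 0)]) = diff ((contract ^^ k) ?H) (ys @ [x_power (Suc 0)])"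
    if "ys \<in> tuples A p" "Suc p + 2 * k = n" for ys p k
  proof -
    have "(contract ^^ k) (zero_outside n ?F) (ys @ [x_power (Suc 0)]) = (contract ^^ k) (diff ?H) (ys @ [x_power (Suc 0)])"
      by (rule contract_power_cong[of "Suc p"]) (use that FH in \<open>auto simp: tuples_def\<close>)
    then show ?thesis using diff_contract_power[OF van] by simp
  qed
  have x1: "x_power (Suc 0) = basis_elem (xpath (Suc 0))" using N1 by (simp add: x_power_def)
  show False
  proof (cases "even n")
    case False
    then obtain m where m: "n = Suc (2 * m)" by (auto elim!: oddE)
    let ?K = "(contract ^^ m) ?H"
    have s: "omega_shift n j = int (m * N) + 1 - int j" by (simp add: omega_shift_def m)
    have "(contract ^^ m) (zero_outside n ?F) [x_power (Suc 0)] = scale (omega_coeff N [1]) (shifted_path N (omega_shift n j) ([xpath 1] @ loops m))"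
      using contract_power_omega_coeff[of "[xpath 1]" m n "omega_shift n j"] N1 by (simp add: m x1)
    moreover have "omega_coeff N [1] = (1 :: 'k)" using N1 by (simp add: omega_coeff_def xi_def)
    moreover have "shifted_path N (omega_shift n j) ([xpath 1] @ loops m) = (route_vec N v2 v2 (int j) :: _ \<Rightarrow> 'k)"
      using loops_props(1)[of m] loops_props(2,3)[of m]
      by (cases "m = 0") (auto simp: shifted_path_def chain_append s loops_def simp del: append_Cons)
    ultimately have "route_vec N v2 v2 (int j) = diff ?K [x_power (Suc 0)]"
      using key[of "[]" 0 m] m by simp
    also have "\<dots> = path_vec (xpath 1) \<star> ?K [] - ?K [] \<star> path_vec (xpath 1)"
      using N1 by (simp add: diff_def coords_x_power)
    finally have "route_vec N v2 v2 (int j) (xpath j) = (path_vec (xpath 1) \<star> ?K [] - ?K [] \<star> path_vec (xpath 1)) (xpath j)"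
      by simp
    then show False using j by (simp add: route_vec_apply feasible_def tconv_coeff)
  next
    case True
    then obtain k where "n = 2 * k" by (rule evenE)
    then obtain m where m: "n = 2 * Suc m" using n by (cases k) auto
    let ?K = "(contract ^^ m) ?H"
    have s: "omega_shift n j = int (Suc m * N) - int j" by (simp add: omega_shift_def m)
    have vK: "vanishing ?K" using diff_contract_power[OF van] by blast
    define c where "c = ?K [x_power (Suc 0)] (xpath 0)"
    have Km: "(contract ^^ m) (zero_outside n ?F) [x, x_power (Suc 0)] = diff ?K [x, x_power (Suc 0)]" if "x \<in> carrier A" for x
      using key[of "[x]" 1 m] that m by (simp add: tuples_def)
    \<comment> \<open>The word \<open>x\<^sup>n\<^sup>N\<^sup>/\<^sup>2\<close>: all \<open>N\<close> summands contribute the constant term \<open>c\<close>.\<close>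
    have "of_nat N * (if j = N - 1 then c else 0) = (1 :: 'k)"
    proof -
      have "(contract ^^ Suc m) (zero_outside n ?F) [] = contract (diff ?K) []"
        by (simp only: funpow.simps o_apply contract_def[of "(contract ^^ m) _"] contract_def[of "diff _"] append_Nil Km[OF x_power_in])
      also have "\<dots> = (\<Sum>i<N. coords N (x_power i) \<star> ?K [x_power (Suc 0)] \<star> coords N (x_power (N - Suc i)))"
        by (rule contract_diff_Nil[OF vK])
      finally have a: "(contract ^^ Suc m) (zero_outside n ?F) [] (xpath j)
         = (\<Sum>i<N. (coords N (x_power i) \<star> ?K [x_power (Suc 0)] \<star> coords N (x_power (N - Suc i))) (xpath j))"
        by (simp only: sum_fun_apply)
      have "(coords N (x_power i) \<star> ?K [x_power (Suc 0)] \<star> coords N (x_power (N - Suc i))) (xpath j)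
          = (if j = N - 1 then c else 0)" if "i < N" for i
        using that j by (auto simp: coords_x_power tconv_coeff c_def)
      then have "(contract ^^ Suc m) (zero_outside n ?F) [] (xpath j) = of_nat N * (if j = N - 1 then c else 0)"
        unfolding a by simp
      moreover have "(contract ^^ Suc m) (zero_outside n ?F) [] = scale (omega_coeff N []) (shifted_path N (omega_shift n j) (loops (Suc m)))"
        using contract_power_omega_coeff[of "[]" "Suc m" n "omega_shift n j"] m by simp
      moreover have "shifted_path N (omega_shift n j) (loops (Suc m)) = (route_vec N v2 v2 (int j) :: _ \<Rightarrow> 'k)"
        using loops_props(1)[of "Suc m"] loops_props(2,3)[of "Suc m"] by (simp add: shifted_path_def s)
      ultimately show ?thesis using j by (simp add: omega_coeff_def route_vec_apply feasible_def)
    qed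
    \<comment> \<open>The word with \<open>a\<close> in front.\<close>
    moreover have "of_nat (N - 1) * (if j = N - 1 then c else 0) = (1 :: 'k)"
    proof -
      let ?T = "\<Sum>i<N - 1. diff ?K [basis_elem (apath i), x_power (Suc 0)] \<star> coords N (x_power (N - 1 - Suc i))"
      have "(path_vec (apath i) \<star> ?K [x_power (Suc 0)] \<star> coords N (x_power (N - 1 - Suc i))) (apath (j - 1))
          = (if j = N - 1 then c else 0)" if "i < N - 1" for i
        using that j by (auto simp: coords_x_power tconv_coeff c_def)
      moreover have "(?K [basis_elem (apath 0)] \<star> coords N (x_power (N - 1))) (apath (j - 1)) = 0"
        using j N1 by (auto simp: coords_x_power tconv_coeff)
      ultimately have "?T (apath (j - 1)) = of_nat (N - 1) * (if j = N - 1 then c else 0)"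
        unfolding contract_diff_apath[OF vK] by (simp add: sum_fun_apply)
      moreover have "diff ?K [basis_elem (apath i), x_power (Suc 0)] \<star> coords N (x_power (N - 1 - Suc i))
          = (if N - 2 = i then route_vec N v1 v2 (int j) else 0)" if i: "i < N - 1" for i
      proof -
        have "diff ?K [basis_elem (apath i), x_power (Suc 0)] = (contract ^^ m) (zero_outside n ?F) [basis_elem (apath i), basis_elem (xpath 1)]"
          using Km[of "basis_elem (apath i)"] i basis_elem(1)[of "apath i"] by (simp add: x1)
        also have "\<dots> = scale (omega_coeff N [Suc i, 1]) (shifted_path N (omega_shift n j) ([apath i, xpath 1] @ loops m))"
          using contract_power_omega_coeff[of "[apath i, xpath 1]" m n "omega_shift n j"] N1 i by (simp add: m)
        also have "omega_coeff N [Suc i, 1] = (if i = N - 2 then 1 else 0 :: 'k)"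
          using i N1 by (auto simp: omega_coeff_def)
        finally have e: "diff ?K [basis_elem (apath i), x_power (Suc 0)]
          = scale (if i = N - 2 then 1 else 0) (shifted_path N (omega_shift n j) ([apath i, xpath 1] @ loops m))" .
        have "shifted_path N (omega_shift n j) ([apath (N - 2), xpath 1] @ loops m) = (route_vec N v1 v2 (int j) :: _ \<Rightarrow> 'k)"
          using loops_props(1)[of m] loops_props(2,3)[of m] N1
          by (cases "m = 0") (auto simp: shifted_path_def chain_append s loops_def simp del: append_Cons)
        moreover have "shifted_path N (omega_shift n j) ([apath (N - 2), xpath 1] @ loops m) \<star> path_vec (xpath 0)
            = shifted_path N (omega_shift n j) ([apath (N - 2), xpath 1] @ loops m)"
          by (rule shifted_path_times_vertex) (cases "m = 0"; use loops_props(1)[of m] in \<open>auto simp: loops_def\<close>)+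
        ultimately show ?thesis unfolding e using N1 by (auto simp: coords_x_power)
      qed
      then have "?T = (\<Sum>i<N - 1. if N - 2 = i then route_vec N v1 v2 (int j) else 0)"
        by (intro sum.cong) auto
      then have "?T = (if N - 2 \<in> {..<N - 1} then route_vec N v1 v2 (int j) else 0)"
        by (simp only: sum.delta'[OF finite_lessThan])
      then have "?T = route_vec N v1 v2 (int j)" using N_ge by (subst (asm) if_P) auto
      ultimately have "route_vec N v1 v2 (int j) (apath (j - 1)) = of_nat (N - 1) * (if j = N - 1 then c else 0)"
        by (simp only:)
      then show ?thesis unfolding route_vec_apply(2)[OF j] by (rule sym)
    qed
    moreover have False if d: "of_nat N * d = 1" "of_nat (N - 1) * d = 1" for d :: 'k
    proof -
      have "of_nat N = of_nat (N - 1) + (1 :: 'k)" using N1 by (simp flip: of_nat_Suc)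
      then have "d = 0" using d by (simp add: distrib_right)
      then show False using d by simp
    qed
    ultimately show False by blast
  qed
qed

end

theorem mainTheorem4:
  fixes N :: nat
    and A :: "('k::field_char_0, ((vertex, arrow) qpath \<Rightarrow> 'k) set) module"
  assumes "N \<ge> 3"
    and "A = truncated_quiver_algebra \<Delta> N"
  shows "\<exists>\<omega> :: nat \<Rightarrow> nat \<Rightarrow> (((vertex, arrow) qpath \<Rightarrow> 'k) set list \<Rightarrow> ((vertex, arrow) qpath \<Rightarrow> 'k) set) set.
     (\<forall>n\<ge>1. \<forall>j\<in>{1..N-1}. \<omega> n j \<in> carrier (HH A n) \<and> \<omega> n j \<noteq> \<one>\<^bsub>HH A n\<^esub>) \<and>
     (\<forall>n1\<ge>1. \<forall>n2\<ge>1. \<forall>j1\<in>{1..N-1}. \<forall>j2\<in>{1..N-1}.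
        hcup A n1 n2 (\<omega> n1 j1) (\<omega> n2 j2) =
          (if (even n1 \<or> even n2) \<and> j1 + j2 < N then \<omega> (n1 + n2) (j1 + j2)
           else \<one>\<^bsub>HH A (n1 + n2)\<^esub>))"
proof -
  interpret truncated_delta N A by unfold_locales (use assms in auto)
  show ?thesis
  proof (intro exI[of _ omega] conjI allI impI ballI)
    fix n j :: nat assume "1 \<le> n" "j \<in> {1..N - 1}"
    then have "1 \<le> n" "1 \<le> j" "j < N" using assms(1) by auto
    then show "omega n j \<in> carrier (HH A n)" "omega n j \<noteq> \<one>\<^bsub>HH A n\<^esub>"
      using coh_class_in_HH[OF cocycle_omega_coeff] omega_nonzero by (auto simp: omega_def)
  next
    fix n1 n2 j1 j2 :: nat assume "1 \<le> n1" "1 \<le> n2" "j1 \<in> {1..N - 1}" "j2 \<in> {1..N - 1}"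
    then have a: "n1 \<ge> 1" "n2 \<ge> 1" "j1 \<ge> 1" "j2 \<ge> 1" by auto
    show "hcup A n1 n2 (omega n1 j1) (omega n2 j2) =
          (if (even n1 \<or> even n2) \<and> j1 + j2 < N then omega (n1 + n2) (j1 + j2)
           else \<one>\<^bsub>HH A (n1 + n2)\<^esub>)"
    proof (cases "even n1 \<or> even n2")
      case True
      then have "hcup A n1 n2 (omega n1 j1) (omega n2 j2) = omega (n1 + n2) (j1 + j2)"
        using hcup_even_left[OF a] hcup_even_right[OF a] by blast
      then show ?thesis using True omega_zero[of "j1 + j2" "n1 + n2"] a by simp
    next
      case False
      then show ?thesis using hcup_odd[OF a] by simp
    qed
  qed
qed

end
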